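(* Let $(\mathcal{A},\varphi,\psi)$ be a conditionally non-commutative probability space, let $\Phi$ and $\Psi$ be the characters on $T(T_+(\mathcal{A}))$ extending $\varphi$ and $\psi$, respectively, let $\beta$ be the infinitesimal character with $\Phi=\mathcal{E}_\succ(\beta)$ and let $\rho'$ be the infinitesimal character with $\Psi=\exp^*(\rho')$. Then the infinitesimal character $\mathsf{P}$ satisfying $$\mathsf{P}+\sum_{n>0}\frac{1}{(n+1)!}\,r^{(n)}_{\lhd\rho'}(\mathsf{P})=\beta$$ is the infinitesimal character associated to the conditionally monotone cumulants $\{h^{(c)}_n:\mathcal{A}^n\to\mathbb{C}\}_{n\ge1}$ of $(\mathcal{A},\varphi,\psi)$, i.e. $$\mathsf{P}(w)=h_n^{(c)}(a_1,\ldots,a_n)$$ for any word $w=a_1\cdots a_n\in T_+(\mathcal{A})$.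
   Context: **Probability spaces.** A non-commutative probability space $(\mathcal{A},\varphi)$ is an associative unital complex algebra $\mathcal{A}$ with a linear functional $\varphi:\mathcal{A}\to\mathbb{C}$, $\varphi(1_{\mathcal{A}})=1$. A conditionally non-commutative probability space $(\mathcal{A},\varphi,\psi)$ has in addition a second linear functional $\psi$ with $\psi(1_{\mathcal{A}})=1$. **Non-crossing partitions.** $\mathrm{NC}(n)$ is the set of non-crossing partitions of $[n]=\{1,\dots,n\}$. For blocks, $\pi_j<\pi_i$ (i.e. $\pi_i$ is nested in $\pi_j$) iff there are $a,b\in\pi_j$ with $a<c<b$ for all $c\in\pi_i$. A block is outer if it is minimal for this order, inner otherwise. The nesting forest $t(\pi)$ is the forest of rooted trees whose vertices are the blocks of $\pi$ and which encodes this nesting order (roots are the outer blocks). The tree factorial is $t!=1$ for a single vertex and $t!=|t|\,t_1!\cdots t_s!$ if $t$ is obtained by attaching the trees $t_1,\dots,t_s$ to a new root ($|t|$ = number of vertices); the factorial of a forest is the product over its trees. For multilinear functionals $f_m:\mathcal{A}^m\to\mathbb{C}$ and a block $V=\{i_1<\dots<i_m\}$ put $f_{|V|}(a_1,\dots,a_n|V)=f_m(a_{i_1},\dots,a_{i_m})$. **Cumulants.** The monotone cumulants $\{h'_n\}_{n\ge1}$ of $(\mathcal{A},\psi)$ are recursively defined by $\psi(a_1\cdots a_n)=\sum_{\pi\in\mathrm{NC}(n)}\frac1{t(\pi)!}\prod_{V\in\pi}h'_{|V|}(a_1,\dots,a_n|V)$. The conditionally monotone cumulants $\{h_n^{(c)}\}_{n\ge1}$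 of $(\mathcal{A},\varphi,\psi)$ are recursively defined by $$\varphi(a_1\cdots a_n)=\sum_{\pi\in\mathrm{NC}(n)}\frac{1}{t(\pi)!}\Big(\prod_{V\in\pi\text{ outer}}h^{(c)}_{|V|}(a_1,\dots,a_n|V)\Big)\Big(\prod_{V\in\pi\text{ inner}}h'_{|V|}(a_1,\dots,a_n|V)\Big).$$ **Double tensor Hopf algebra.** $T_+(\mathcal{A})=\bigoplus_{n\ge1}\mathcal{A}^{\otimes n}$ and $T(T_+(\mathcal{A}))=\bigoplus_{n\ge0}T_+(\mathcal{A})^{\otimes n}$. A word $a_1\cdots a_n$ in $T_+(\mathcal{A})$ denotes $a_1\otimes\cdots\otimes a_n$; pure tensors in $T(T_+(\mathcal{A}))$ are written $w_1|\cdots|w_m$. The product is concatenation with $|$, with unit the empty word $\mathbf{1}$. For $w=a_1\cdots a_n$ and $S=\{s_1<\dots<s_l\}\subseteq[n]$ let $w_S=a_{s_1}\cdots a_{s_l}$ ($w_\emptyset=\mathbf{1}$), and let $J_1,\dots,J_r$ be the connected components (maximal intervals of consecutive integers) of $[n]\setminus S$, ordered by minimal elements. The coproduct is $\Delta(w)=\sum_{S\subseteq[n]}w_S\otimes w_{J_1}|\cdots|w_{J_r}$, extended multiplicatively; the counit $\epsilon$ is the unital algebra morphism vanishing on $T_+(\mathcal{A})$. Split $\Delta=\Delta_\prec+\Delta_\succ$ on the augmentation ideal, where $\Delta_\prec(w)=\sum_{1\in S\subseteq[n]}w_S\otimes w_{J_1}|\cdots|w_{J_r}$ on words and $\Delta_\prec(w_1|w_2|\cdots|w_m)=\Delta_\prec(w_1)\Delta(w_2|\cdots|w_m)$,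 and likewise for $\Delta_\succ$. **Products on the dual.** For linear forms $f,g$ on $T(T_+(\mathcal{A}))$: $f*g=m_{\mathbb{C}}(f\otimes g)\Delta$ (associative, unit $\epsilon$), $f\prec g=m_{\mathbb{C}}(f\otimes g)\Delta_\prec$, $f\succ g=m_{\mathbb{C}}(f\otimes g)\Delta_\succ$, with $f\prec\epsilon=f=\epsilon\succ f$ and $\epsilon\prec f=0=f\succ\epsilon$ for $f\ne\epsilon$; half-shuffle products are only used when at least one factor vanishes on $\mathbf{1}$, and then they vanish on $\mathbf{1}$. They satisfy $(f\prec g)\prec h=f\prec(g*h)$, $(f\succ g)\prec h=f\succ(g\prec h)$, $f\succ(g\succ h)=(f*g)\succ h$. **Characters.** $G$ is the group (for $*$) of characters, i.e. unital algebra morphisms $T(T_+(\mathcal{A}))\to\mathbb{C}$. $\mathfrak{g}$ is the space of infinitesimal characters: linear forms $\alpha$ with $\alpha(\mathbf{1})=0$ and $\alpha(w_1|\cdots|w_k)=0$ for all $k\ge2$, $w_i\in T_+(\mathcal{A})$. The maps $\exp^*(\alpha)=\sum_{n\ge0}\alpha^{*n}/n!$ and $\mathcal{E}_\succ(\alpha)=\sum_{n\ge0}\alpha^{\succ n}$ ($\alpha^{\succ0}=\epsilon$, $\alpha^{\succ n}=\alpha^{\succ(n-1)}\succ\alpha$) are bijections $\mathfrak{g}\to G$. The character extending $\varphi$ is the $\Phi\in G$ with $\Phi(w)=\varphi(a_1\cdots a_n)$ (product in $\mathcal{A}$) for every word $w=a_1\cdots a_n$; similarly $\Psi$ for $\psi$.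 **Pre-Lie product.** On $\mathfrak{g}$, $\alpha\lhd\gamma=\alpha\prec\gamma-\gamma\succ\alpha$; $r^{(0)}_{\lhd\gamma}(\alpha)=\alpha$, $r^{(n+1)}_{\lhd\gamma}(\alpha)=r^{(n)}_{\lhd\gamma}(\alpha)\lhd\gamma$. The linear operator $\alpha\mapsto\sum_{n\ge0}\frac1{(n+1)!}r^{(n)}_{\lhd\rho'}(\alpha)$ on $\mathfrak{g}$ is invertible, so $\mathsf{P}$ exists and is unique. *)

theory Defs
  imports Complex_Main "HOL-Library.Poly_Mapping" "HOL-Library.Multiset" "HOL-Library.Disjoint_Sets"
begin

section \<open>Complex vector spaces and unital complex algebras\<close>

class complex_vect = ab_group_add +
  fixes scaleC :: "complex \<Rightarrow> 'a \<Rightarrow> 'a" (infixr \<open>*\<^sub>C\<close> 75)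
  assumes scaleC_add_right: "c *\<^sub>C (x + y) = c *\<^sub>C x + c *\<^sub>C y"
    and scaleC_add_left: "(c + d) *\<^sub>C x = c *\<^sub>C x + d *\<^sub>C x"
    and scaleC_scaleC: "c *\<^sub>C d *\<^sub>C x = (c * d) *\<^sub>C x"
    and scaleC_one: "1 *\<^sub>C x = x"

text \<open>Not based on \<open>ring_1\<close>, which demands \<open>0 \<noteq> 1\<close>: the zero algebra is allowed.\<close>

class complex_algebra_1 = complex_vect + ring + monoid_mult +
  assumes mult_scaleC_left: "(c *\<^sub>C x) * y = c *\<^sub>C (x * y)"
    and mult_scaleC_right: "x * (c *\<^sub>C y) = c *\<^sub>C (x * y)"

interpretation cvec: vector_space "scaleC :: complex \<Rightarrow> 'a \<Rightarrow> 'a::complex_vect"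
  by unfold_locales (simp_all add: scaleC_add_right scaleC_add_left scaleC_scaleC scaleC_one)

instantiation complex :: complex_algebra_1
begin
definition scaleC_complex :: "complex \<Rightarrow> complex \<Rightarrow> complex" where "scaleC_complex = (*)"
instance by standard (simp_all add: scaleC_complex_def algebra_simps)
end

abbreviation clinear :: "('a::complex_vect \<Rightarrow> 'b::complex_vect) \<Rightarrow> bool" where
  "clinear \<equiv> Vector_Spaces.linear scaleC scaleC"

lemma clinearI:
  assumes "\<And>x y. f (x + y) = f x + f y" "\<And>c x. f (c *\<^sub>C x) = c *\<^sub>C f x"
  shows "clinear (f :: 'a::complex_vect \<Rightarrow> 'b::complex_vect)"
  by (unfold_locales) (simp_all add: assms)

lemma clinear_add: "clinear f \<Longrightarrow> f (x + y) = f x + f y"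
  and clinear_scale: "clinear f \<Longrightarrow> f (c *\<^sub>C x) = c *\<^sub>C f x"
  and clinear_0: "clinear f \<Longrightarrow> f 0 = 0"
  and clinear_diff: "clinear f \<Longrightarrow> f (x - y) = f x - f y"
  using Vector_Spaces.linear.axioms(3)[of scaleC scaleC f]
  by (auto intro: module_hom.add module_hom.scale module_hom.zero module_hom.diff
      simp: Vector_Spaces.linear_def)

lemma clinear_sum: "clinear f \<Longrightarrow> f (sum g S) = (\<Sum>s\<in>S. f (g s))"
  by (induction S rule: infinite_finite_induct) (auto simp: clinear_add clinear_0)

lemma clinear_compose: "clinear f \<Longrightarrow> clinear g \<Longrightarrow> clinear (\<lambda>x. g (f x))"
  by (rule clinearI) (simp_all add: clinear_add clinear_scale)

section \<open>Free vector spaces\<close>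

instantiation poly_mapping :: (type, complex_vect) complex_vect
begin
lift_definition scaleC_poly_mapping :: "complex \<Rightarrow> ('a \<Rightarrow>\<^sub>0 'b) \<Rightarrow> ('a \<Rightarrow>\<^sub>0 'b)"
  is "\<lambda>c f k. c *\<^sub>C f k"
  by (rule finite_subset[rotated]) auto
instance
  by standard (transfer; simp add: scaleC_add_right scaleC_add_left scaleC_scaleC scaleC_one)+
end

abbreviation basis :: "'k \<Rightarrow> ('k \<Rightarrow>\<^sub>0 complex)" where
  "basis k \<equiv> Poly_Mapping.single k 1"

definition lin_ext :: "('k \<Rightarrow> 'v::complex_vect) \<Rightarrow> ('k \<Rightarrow>\<^sub>0 complex) \<Rightarrow> 'v" where
  "lin_ext g p = (\<Sum>k\<in>Poly_Mapping.keys p. Poly_Mapping.lookup p k *\<^sub>C g k)"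

lemma lookup_scaleC: "Poly_Mapping.lookup (c *\<^sub>C p) k = c *\<^sub>C Poly_Mapping.lookup p k"
  by transfer simp

lemma lin_ext_superset:
  assumes "finite K" "Poly_Mapping.keys p \<subseteq> K"
  shows "lin_ext g p = (\<Sum>k\<in>K. Poly_Mapping.lookup p k *\<^sub>C g k)"
  unfolding lin_ext_def
  by (rule sum.mono_neutral_left) (use assms in \<open>auto simp: in_keys_iff\<close>)

lemma clinear_lin_ext: "clinear (lin_ext g)"
proof (rule clinearI)
  fix p q :: "'a \<Rightarrow>\<^sub>0 complex" and c
  let ?K = "Poly_Mapping.keys p \<union> Poly_Mapping.keys q"
  have "lin_ext g (p + q) = (\<Sum>k\<in>?K. Poly_Mapping.lookup (p + q) k *\<^sub>C g k)"
    by (rule lin_ext_superset) (auto dest: keys_add[THEN subsetD])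
  also have "\<dots> = (\<Sum>k\<in>?K. Poly_Mapping.lookup p k *\<^sub>C g k) + (\<Sum>k\<in>?K. Poly_Mapping.lookup q k *\<^sub>C g k)"
    by (simp add: lookup_add scaleC_add_left sum.distrib)
  also have "\<dots> = lin_ext g p + lin_ext g q"
    by (simp add: lin_ext_superset[of ?K])
  finally show "lin_ext g (p + q) = lin_ext g p + lin_ext g q" .
  have "lin_ext g (c *\<^sub>C p) = (\<Sum>k\<in>Poly_Mapping.keys p. Poly_Mapping.lookup (c *\<^sub>C p) k *\<^sub>C g k)"
    by (rule lin_ext_superset) (auto simp: in_keys_iff lookup_scaleC)
  also have "\<dots> = c *\<^sub>C lin_ext g p"
    by (simp add: lin_ext_def lookup_scaleC cvec.scale_sum_right scaleC_complex_def)
  finally show "lin_ext g (c *\<^sub>C p) = c *\<^sub>C lin_ext g p" .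
qed

lemma lin_ext_basis [simp]: "lin_ext g (basis k) = g k"
  by (simp add: lin_ext_def scaleC_one)

lemma basis_expand: "p = (\<Sum>k\<in>Poly_Mapping.keys p. Poly_Mapping.lookup p k *\<^sub>C basis k)"
proof (rule poly_mapping_eqI)
  fix j
  have "Poly_Mapping.lookup (\<Sum>k\<in>Poly_Mapping.keys p. Poly_Mapping.lookup p k *\<^sub>C basis k) j
      = (\<Sum>k\<in>Poly_Mapping.keys p. if k = j then Poly_Mapping.lookup p k else 0)"
    unfolding lookup_sum lookup_scaleC
    by (intro sum.cong) (auto simp: lookup_single when_def scaleC_complex_def)
  also have "\<dots> = Poly_Mapping.lookup p j"
    by (auto simp: in_keys_iff sum.delta)
  finally show "Poly_Mapping.lookup p j =
    Poly_Mapping.lookup (\<Sum>k\<in>Poly_Mapping.keys p. Poly_Mapping.lookup p k *\<^sub>C basis k) j" ..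
qed

lemma clinear_eq_lin_ext: "clinear f \<Longrightarrow> f p = lin_ext (\<lambda>k. f (basis k)) p"
  by (subst basis_expand) (simp add: clinear_sum clinear_scale lin_ext_def)

lemma clinear_eqI:
  assumes "clinear f" "clinear g" "\<And>k. f (basis k) = g (basis k)"
  shows "f p = g p"
  by (subst clinear_eq_lin_ext[OF assms(1)], subst clinear_eq_lin_ext[OF assms(2)]) (simp only: assms(3))

lemma clinear_span_zero:
  assumes "clinear f" "\<And>r. r \<in> R \<Longrightarrow> f r = 0" "x \<in> cvec.span R"
  shows "f x = 0"
  using assms(3)
  by (induction rule: cvec.span_induct_alt) (auto simp: clinear_0[OF assms(1)]
      clinear_add[OF assms(1)] clinear_scale[OF assms(1)] assms(2))

lemma clinear_span_image:
  assumes "clinear f" "\<And>r. r \<in> R \<Longrightarrow> f r \<in> cvec.span S" "x \<in> cvec.span R"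
  shows "f x \<in> cvec.span S"
  using assms(3)
  by (induction rule: cvec.span_induct_alt) (auto simp: clinear_0[OF assms(1)]
      clinear_add[OF assms(1)] clinear_scale[OF assms(1)] 
      intro: cvec.span_zero cvec.span_add cvec.span_scale assms(2))

text \<open>The bilinear product on a free vector space induced by a binary operation on its basis.\<close>

definition free_mult :: "('k \<Rightarrow> 'k \<Rightarrow> 'k) \<Rightarrow> ('k \<Rightarrow>\<^sub>0 complex) \<Rightarrow> ('k \<Rightarrow>\<^sub>0 complex) \<Rightarrow> ('k \<Rightarrow>\<^sub>0 complex)" where
  "free_mult m p q = lin_ext (\<lambda>u. lin_ext (\<lambda>v. basis (m u v)) q) p"

lemma free_mult_basis: "free_mult m (basis u) (basis v) = basis (m u v)"
  by (simp add: free_mult_def)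

lemma clinear_free_mult_left: "clinear (\<lambda>p. free_mult m p q)"
  unfolding free_mult_def by (rule clinear_lin_ext)

lemma lin_ext_clinear_param:
  assumes "\<And>k. clinear (\<lambda>q. g q k)" shows "clinear (\<lambda>q. lin_ext (g q) p)"
  by (rule clinearI) (simp_all add: lin_ext_def clinear_add[OF assms] clinear_scale[OF assms]
      scaleC_add_right sum.distrib cvec.scale_sum_right scaleC_scaleC mult.commute)

lemma clinear_free_mult_right: "clinear (\<lambda>q. free_mult m p q)"
  unfolding free_mult_def by (rule lin_ext_clinear_param) (rule clinear_lin_ext)

lemma free_mult_assoc:
  assumes "\<And>u v w. m (m u v) w = m u (m v w)"
  shows "free_mult m (free_mult m p q) r = free_mult m p (free_mult m q r)"
proof -
  let ?M = "free_mult m"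
  have L: "clinear (\<lambda>x. ?M x y)" and R: "clinear (?M y)" for y
    using clinear_free_mult_left clinear_free_mult_right by blast+
  have 1: "?M (?M (basis u) (basis v)) r = ?M (basis u) (?M (basis v) r)" for u v
    by (rule clinear_eqI[where f = "\<lambda>r. ?M (?M (basis u) (basis v)) r" and g = "\<lambda>r. ?M (basis u) (?M (basis v) r)"])
      (simp_all only: R clinear_compose[OF R R] free_mult_basis assms)
  have 2: "?M (?M (basis u) q) r = ?M (basis u) (?M q r)" for u
    by (rule clinear_eqI[where f = "\<lambda>q. ?M (?M (basis u) q) r" and g = "\<lambda>q. ?M (basis u) (?M q r)"])
      (simp_all only: 1 clinear_compose[OF R L] clinear_compose[OF L R])
  show ?thesis
    by (rule clinear_eqI[where f = "\<lambda>p. ?M (?M p q) r" and g = "\<lambda>p. ?M p (?M q r)"])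
      (simp_all only: 2 clinear_compose[OF L L] L)
qed

lemma free_mult_one_left: "(\<And>u. m e u = u) \<Longrightarrow> free_mult m (basis e) p = p"
  by (rule clinear_eqI[where f = "free_mult m (basis e)" and g = "\<lambda>p. p"])
    (simp_all add: free_mult_basis clinear_free_mult_right clinearI)

lemma free_mult_one_right: "(\<And>u. m u e = u) \<Longrightarrow> free_mult m p (basis e) = p"
  by (rule clinear_eqI[where f = "\<lambda>p. free_mult m p (basis e)" and g = "\<lambda>p. p"])
    (simp_all add: free_mult_basis clinear_free_mult_left clinearI)

lemma free_mult_ideal_left:
  assumes "\<And>k r. r \<in> R \<Longrightarrow> free_mult m r (basis k) \<in> cvec.span R" "p \<in> cvec.span R"
  shows "free_mult m p q \<in> cvec.span R"
proof (subst basis_expand[of q], subst clinear_sum[OF clinear_free_mult_right],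
    rule cvec.span_sum, subst clinear_scale[OF clinear_free_mult_right], rule cvec.span_scale)
  show "free_mult m p (basis k) \<in> cvec.span R" for k
    by (rule clinear_span_image[OF clinear_free_mult_left assms(1) assms(2)])
qed

lemma free_mult_ideal_right:
  assumes "\<And>k r. r \<in> R \<Longrightarrow> free_mult m (basis k) r \<in> cvec.span R" "q \<in> cvec.span R"
  shows "free_mult m p q \<in> cvec.span R"
proof (subst basis_expand[of p], subst clinear_sum[OF clinear_free_mult_left],
    rule cvec.span_sum, subst clinear_scale[OF clinear_free_mult_left], rule cvec.span_scale)
  show "free_mult m (basis k) q \<in> cvec.span R" for k
    by (rule clinear_span_image[OF clinear_free_mult_right assms(1) assms(2)])
qed

lemma free_mult_cong:
  assumes "\<And>k r. r \<in> R \<Longrightarrow> free_mult m r (basis k) \<in> cvec.span R"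
    and "\<And>k r. r \<in> R \<Longrightarrow> free_mult m (basis k) r \<in> cvec.span R"
    and "p - p' \<in> cvec.span R" "q - q' \<in> cvec.span R"
  shows "free_mult m p q - free_mult m p' q' \<in> cvec.span R"
proof -
  have "free_mult m p q - free_mult m p' q' = free_mult m (p - p') q + free_mult m p' (q - q')"
    by (simp add: clinear_diff[OF clinear_free_mult_left] clinear_diff[OF clinear_free_mult_right])
  thus ?thesis
    using free_mult_ideal_left[OF assms(1,3)] free_mult_ideal_right[OF assms(2,4)]
    by (simp add: cvec.span_add)
qed

lemma equivp_span: "equivp (\<lambda>x y. x - y \<in> cvec.span R)"
proof (rule equivpI)
  show "reflp (\<lambda>x y. x - y \<in> cvec.span R)" by (auto intro!: reflpI cvec.span_zero)
  show "symp (\<lambda>x y. x - y \<in> cvec.span R)"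
    by (rule sympI) (metis cvec.span_neg minus_diff_eq)
  show "transp (\<lambda>x y. x - y \<in> cvec.span R)"
    by (rule transpI) (metis cvec.span_add diff_add_cancel add_diff_eq)
qed

lemma span_cong_add: "p - p' \<in> cvec.span R \<Longrightarrow> q - q' \<in> cvec.span R \<Longrightarrow> (p + q) - (p' + q') \<in> cvec.span R"
  by (metis add_diff_add cvec.span_add)

lemma span_cong_diff: "p - p' \<in> cvec.span R \<Longrightarrow> q - q' \<in> cvec.span R \<Longrightarrow> (p - q) - (p' - q') \<in> cvec.span R"
proof -
  assume "p - p' \<in> cvec.span R" "q - q' \<in> cvec.span R"
  moreover have "(p - q) - (p' - q') = (p - p') - (q - q')" by simp
  ultimately show ?thesis by (metis cvec.span_diff)
qed

lemma span_cong_scale: "p - p' \<in> cvec.span R \<Longrightarrow> c *\<^sub>C p - c *\<^sub>C p' \<in> cvec.span R"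
  by (metis cvec.scale_right_diff_distrib cvec.span_scale)

section \<open>Tensor product\<close>

definition tens_rel :: "(('a::complex_vect \<times> 'b::complex_vect) \<Rightarrow>\<^sub>0 complex) set" where
  "tens_rel =
     {basis (x + x', y) - basis (x, y) - basis (x', y) | x x' y. True} \<union>
     {basis (x, y + y') - basis (x, y) - basis (x, y') | x y y'. True} \<union>
     {basis (c *\<^sub>C x, y) - c *\<^sub>C basis (x, y) | c x y. True} \<union>
     {basis (x, c *\<^sub>C y) - c *\<^sub>C basis (x, y) | c x y. True}"

quotient_type (overloaded) ('a, 'b) tens = "('a::complex_vect \<times> 'b::complex_vect) \<Rightarrow>\<^sub>0 complex"
  / "\<lambda>p q. p - q \<in> cvec.span tens_rel"
  by (rule equivp_span)

instantiation tens :: (complex_vect, complex_vect) complex_vect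
begin
lift_definition zero_tens :: "('a, 'b) tens" is 0 .
lift_definition plus_tens :: "('a, 'b) tens \<Rightarrow> ('a, 'b) tens \<Rightarrow> ('a, 'b) tens" is "(+)"
  by (rule span_cong_add)
lift_definition minus_tens :: "('a, 'b) tens \<Rightarrow> ('a, 'b) tens \<Rightarrow> ('a, 'b) tens" is "(-)"
  by (rule span_cong_diff)
lift_definition uminus_tens :: "('a, 'b) tens \<Rightarrow> ('a, 'b) tens" is "uminus"
  by (metis cvec.span_neg minus_diff_minus)
lift_definition scaleC_tens :: "complex \<Rightarrow> ('a, 'b) tens \<Rightarrow> ('a, 'b) tens" is "scaleC"
  by (rule span_cong_scale)
instance
  by standard (transfer; simp add: cvec.span_zero algebra_simps scaleC_add_right scaleC_add_left scaleC_scaleC scaleC_one)+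
end

lift_definition tens :: "'a::complex_vect \<Rightarrow> 'b::complex_vect \<Rightarrow> ('a, 'b) tens" (infixr \<open>\<otimes>\<close> 72)
  is "\<lambda>x y. basis (x, y)" .

text \<open>For bilinear \<open>B\<close>, this is the linear map with \<open>x \<otimes> y \<mapsto> B x y\<close>; it does not depend on the
  representative \<open>rep_tens\<close> picks.\<close>

definition tens_lift :: "('a::complex_vect \<Rightarrow> 'b::complex_vect \<Rightarrow> 'c::complex_vect) \<Rightarrow> ('a, 'b) tens \<Rightarrow> 'c" where
  "tens_lift B t = lin_ext (\<lambda>(x, y). B x y) (rep_tens t)"


lemma lin_ext_cong_rel:
  assumes "\<And>r. r \<in> R \<Longrightarrow> lin_ext g r = 0" "p - q \<in> cvec.span R"
  shows "lin_ext g p = lin_ext g q"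
  using clinear_span_zero[OF clinear_lin_ext assms] by (simp add: clinear_diff[OF clinear_lin_ext])

definition bilinear2 :: "('a::complex_vect \<Rightarrow> 'b::complex_vect \<Rightarrow> 'c::complex_vect) \<Rightarrow> bool" where
  "bilinear2 B \<longleftrightarrow> (\<forall>y. clinear (\<lambda>x. B x y)) \<and> (\<forall>x. clinear (B x))"

lemma bilinear2D:
  assumes "bilinear2 B"
  shows "B (x + x') y = B x y + B x' y" "B x (y + y') = B x y + B x y'"
    "B (c *\<^sub>C x) y = c *\<^sub>C B x y" "B x (c *\<^sub>C y) = c *\<^sub>C B x y"
proof -
  have L: "clinear (\<lambda>x. B x y)" and R: "clinear (B x)" for x y
    using assms by (auto simp: bilinear2_def)
  show "B (x + x') y = B x y + B x' y" "B x (y + y') = B x y + B x y'"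
    "B (c *\<^sub>C x) y = c *\<^sub>C B x y" "B x (c *\<^sub>C y) = c *\<^sub>C B x y"
    using clinear_add[OF L] clinear_scale[OF L] clinear_add[OF R] clinear_scale[OF R] by blast+
qed

lemma rep_tens_eqv: "p - rep_tens (abs_tens p) \<in> cvec.span tens_rel"
  by (simp add: tens.abs_eq_iff[symmetric] Quotient_abs_rep[OF Quotient_tens])

lemma tens_lift_abs:
  assumes "bilinear2 B" shows "tens_lift B (abs_tens p) = lin_ext (\<lambda>(x, y). B x y) p"
  unfolding tens_lift_def
proof (rule lin_ext_cong_rel[symmetric, OF _ rep_tens_eqv])
  note lin = clinear_diff[OF clinear_lin_ext] clinear_scale[OF clinear_lin_ext]
  show "lin_ext (\<lambda>(x, y). B x y) r = 0" if "r \<in> tens_rel" for r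
    using that unfolding tens_rel_def
    by (auto simp: lin bilinear2D[OF assms])
qed

lemma tens_lift_tens: "bilinear2 B \<Longrightarrow> tens_lift B (x \<otimes> y) = B x y"
  by (simp add: tens.abs_eq tens_lift_abs)

lemma clinear_tens_lift:
  assumes "bilinear2 B" shows "clinear (tens_lift B)"
proof (rule clinearI)
  show "tens_lift B (s + t) = tens_lift B s + tens_lift B t" for s t
    by (induction s; induction t)
      (simp add: plus_tens.abs_eq tens_lift_abs[OF assms] clinear_add[OF clinear_lin_ext])
  show "tens_lift B (c *\<^sub>C s) = c *\<^sub>C tens_lift B s" for c s
    by (induction s)
      (simp add: scaleC_tens.abs_eq tens_lift_abs[OF assms] clinear_scale[OF clinear_lin_ext])
qed

lemma bilinear2_tens: "bilinear2 (\<otimes>)"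
proof -
  have "(x + x') \<otimes> y = x \<otimes> y + x' \<otimes> y" "x \<otimes> (y + y') = x \<otimes> y + x \<otimes> y'"
    "(c *\<^sub>C x) \<otimes> y = c *\<^sub>C (x \<otimes> y)" "x \<otimes> (c *\<^sub>C y) = c *\<^sub>C (x \<otimes> y)"
    for x x' :: 'a and y y' :: 'b and c
    by (transfer; rule cvec.span_base; unfold tens_rel_def diff_diff_eq[symmetric]; blast)+
  thus ?thesis by (auto simp: bilinear2_def intro!: clinearI)
qed

abbreviation pair_mult :: "('a::complex_algebra_1 \<times> 'b::complex_algebra_1) \<Rightarrow> 'a \<times> 'b \<Rightarrow> 'a \<times> 'b" where
  "pair_mult p q \<equiv> (fst p * fst q, snd p * snd q)"

lemma tens_rel_ideal:
  assumes "r \<in> tens_rel"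
  shows "free_mult pair_mult r (basis k) \<in> cvec.span tens_rel"
    and "free_mult pair_mult (basis k) r \<in> cvec.span tens_rel"
proof -
  note lin = clinear_diff[OF clinear_free_mult_left] clinear_scale[OF clinear_free_mult_left]
    clinear_diff[OF clinear_free_mult_right] clinear_scale[OF clinear_free_mult_right]
  show "free_mult pair_mult r (basis k) \<in> cvec.span tens_rel"
    using assms unfolding tens_rel_def
    by (intro cvec.span_base)
      (auto simp: lin free_mult_basis distrib_right mult_scaleC_left, blast+)
  show "free_mult pair_mult (basis k) r \<in> cvec.span tens_rel"
    using assms unfolding tens_rel_def
    by (intro cvec.span_base)
      (auto simp: lin free_mult_basis distrib_left mult_scaleC_right, blast+)
qed

instantiation tens :: (complex_algebra_1, complex_algebra_1) complex_algebra_1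
begin
lift_definition one_tens :: "('a, 'b) tens" is "basis (1, 1)" .
lift_definition times_tens :: "('a, 'b) tens \<Rightarrow> ('a, 'b) tens \<Rightarrow> ('a, 'b) tens"
  is "free_mult pair_mult"
  by (rule free_mult_cong[OF tens_rel_ideal])
instance
proof
  fix a b c :: "('a, 'b) tens" and z :: complex
  show "a * b * c = a * (b * c)"
    by transfer (simp add: free_mult_assoc mult.assoc cvec.span_zero)
  show "1 * a = a" by transfer (simp add: free_mult_one_left cvec.span_zero)
  show "a * 1 = a" by transfer (simp add: free_mult_one_right cvec.span_zero)
  show "(a + b) * c = a * c + b * c"
    by transfer (simp add: clinear_add[OF clinear_free_mult_left] cvec.span_zero)
  show "a * (b + c) = a * b + a * c"
    by transfer (simp add: clinear_add[OF clinear_free_mult_right] cvec.span_zero)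
  show "(z *\<^sub>C a) * b = z *\<^sub>C (a * b)"
    by transfer (simp add: clinear_scale[OF clinear_free_mult_left] cvec.span_zero)
  show "a * (z *\<^sub>C b) = z *\<^sub>C (a * b)"
    by transfer (simp add: clinear_scale[OF clinear_free_mult_right] cvec.span_zero)
qed
end

lemma tens_mult: "(a \<otimes> b) * (c \<otimes> d) = (a * c) \<otimes> (b * d)"
  by transfer (simp add: free_mult_basis cvec.span_zero)

section \<open>Tensor algebra\<close>

definition talg_rel :: "('v::complex_vect list \<Rightarrow>\<^sub>0 complex) set" where
  "talg_rel =
     {basis (us @ (x + y) # vs) - basis (us @ x # vs) - basis (us @ y # vs) | us vs x y. True} \<union>
     {basis (us @ (c *\<^sub>C x) # vs) - c *\<^sub>C basis (us @ x # vs) | us vs c x. True}"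

quotient_type (overloaded) 'v talg = "'v::complex_vect list \<Rightarrow>\<^sub>0 complex"
  / "\<lambda>p q. p - q \<in> cvec.span talg_rel"
  by (rule equivp_span)

lemma talg_rel_ideal:
  assumes "r \<in> talg_rel"
  shows "free_mult (@) r (basis k) \<in> cvec.span talg_rel"
    and "free_mult (@) (basis k) r \<in> cvec.span talg_rel"
proof -
  note lin = clinear_diff[OF clinear_free_mult_left] clinear_scale[OF clinear_free_mult_left]
    clinear_diff[OF clinear_free_mult_right] clinear_scale[OF clinear_free_mult_right]
  show "free_mult (@) r (basis k) \<in> cvec.span talg_rel"
    using assms unfolding talg_rel_def
    by (intro cvec.span_base) (auto simp: lin free_mult_basis, blast+)
  show "free_mult (@) (basis k) r \<in> cvec.span talg_rel"
    using assms unfolding talg_rel_def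
    by (intro cvec.span_base) (auto simp: lin free_mult_basis append_assoc[symmetric] simp del: append_assoc, blast+)
qed

instantiation talg :: (complex_vect) complex_algebra_1
begin
lift_definition zero_talg :: "'a talg" is 0 .
lift_definition plus_talg :: "'a talg \<Rightarrow> 'a talg \<Rightarrow> 'a talg" is "(+)"
  by (rule span_cong_add)
lift_definition minus_talg :: "'a talg \<Rightarrow> 'a talg \<Rightarrow> 'a talg" is "(-)"
  by (rule span_cong_diff)
lift_definition uminus_talg :: "'a talg \<Rightarrow> 'a talg" is "uminus"
  by (metis cvec.span_neg minus_diff_minus)
lift_definition scaleC_talg :: "complex \<Rightarrow> 'a talg \<Rightarrow> 'a talg" is "scaleC"
  by (rule span_cong_scale)
lift_definition one_talg :: "'a talg" is "basis []" .
lift_definition times_talg :: "'a talg \<Rightarrow> 'a talg \<Rightarrow> 'a talg" is "free_mult (@)"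
  by (rule free_mult_cong[OF talg_rel_ideal])
instance
proof
  fix a b c :: "'a talg" and z z' :: complex
  show "a * b * c = a * (b * c)"
    by transfer (simp add: free_mult_assoc cvec.span_zero)
  show "1 * a = a" by transfer (simp add: free_mult_one_left cvec.span_zero)
  show "a * 1 = a" by transfer (simp add: free_mult_one_right cvec.span_zero)
  show "(a + b) * c = a * c + b * c"
    by transfer (simp add: clinear_add[OF clinear_free_mult_left] cvec.span_zero)
  show "a * (b + c) = a * b + a * c"
    by transfer (simp add: clinear_add[OF clinear_free_mult_right] cvec.span_zero)
  show "(z *\<^sub>C a) * b = z *\<^sub>C (a * b)"
    by transfer (simp add: clinear_scale[OF clinear_free_mult_left] cvec.span_zero)
  show "a * (z *\<^sub>C b) = z *\<^sub>C (a * b)"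
    by transfer (simp add: clinear_scale[OF clinear_free_mult_right] cvec.span_zero)
qed (transfer; simp add: cvec.span_zero algebra_simps scaleC_add_right scaleC_add_left scaleC_scaleC scaleC_one)+
end

lift_definition tpure :: "'v::complex_vect list \<Rightarrow> 'v talg" is basis .

lemma tpure_Nil: "tpure [] = 1"
  by transfer (simp add: cvec.span_zero)

lemma tpure_append: "tpure (xs @ ys) = tpure xs * tpure ys"
  by transfer (simp add: free_mult_basis cvec.span_zero)

definition multilinear :: "('v::complex_vect list \<Rightarrow> 'w::complex_vect) \<Rightarrow> bool" where
  "multilinear g \<longleftrightarrow> (\<forall>us vs. clinear (\<lambda>x. g (us @ x # vs)))"

lemma multilinearD:
  assumes "multilinear g"
  shows "g (us @ (x + y) # vs) = g (us @ x # vs) + g (us @ y # vs)"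
    "g (us @ (c *\<^sub>C x) # vs) = c *\<^sub>C g (us @ x # vs)"
proof -
  have "clinear (\<lambda>x. g (us @ x # vs))" using assms by (simp add: multilinear_def)
  from clinear_add[OF this] clinear_scale[OF this]
  show "g (us @ (x + y) # vs) = g (us @ x # vs) + g (us @ y # vs)"
    "g (us @ (c *\<^sub>C x) # vs) = c *\<^sub>C g (us @ x # vs)" .
qed

text \<open>For multilinear \<open>g\<close>, this is the linear map with \<open>tpure xs \<mapsto> g xs\<close> (see \<open>talg_lift_tpure\<close>
  and \<open>clinear_talg_lift\<close> below).\<close>

definition talg_lift :: "('v::complex_vect list \<Rightarrow> 'w::complex_vect) \<Rightarrow> 'v talg \<Rightarrow> 'w" where
  "talg_lift g t = lin_ext g (rep_talg t)"

lemma rep_talg_eqv: "p - rep_talg (abs_talg p) \<in> cvec.span talg_rel"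
  by (simp add: talg.abs_eq_iff[symmetric] Quotient_abs_rep[OF Quotient_talg])

lemma talg_lift_abs:
  assumes "multilinear g" shows "talg_lift g (abs_talg p) = lin_ext g p"
  unfolding talg_lift_def
proof (rule lin_ext_cong_rel[symmetric, OF _ rep_talg_eqv])
  note lin = clinear_diff[OF clinear_lin_ext] clinear_scale[OF clinear_lin_ext]
  have g: "g (us @ (x + y) # vs) = g (us @ x # vs) + g (us @ y # vs)"
    "g (us @ (c *\<^sub>C x) # vs) = c *\<^sub>C g (us @ x # vs)" for us vs x y c
    using multilinearD[OF assms] by blast+
  show "lin_ext g r = 0" if "r \<in> talg_rel" for r
    using that unfolding talg_rel_def by (auto simp: lin g)
qed

lemma talg_lift_tpure: "multilinear g \<Longrightarrow> talg_lift g (tpure xs) = g xs"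
  by (simp add: tpure.abs_eq talg_lift_abs)

lemma clinear_talg_lift:
  assumes "multilinear g" shows "clinear (talg_lift g)"
proof (rule clinearI)
  show "talg_lift g (s + t) = talg_lift g s + talg_lift g t" for s t
    by (induction s; induction t)
      (simp add: plus_talg.abs_eq talg_lift_abs[OF assms] clinear_add[OF clinear_lin_ext])
  show "talg_lift g (c *\<^sub>C s) = c *\<^sub>C talg_lift g s" for c s
    by (induction s)
      (simp add: scaleC_talg.abs_eq talg_lift_abs[OF assms] clinear_scale[OF clinear_lin_ext])
qed

lemma multilinear_tpure: "multilinear tpure"
proof -
  have "tpure (us @ (x + y) # vs) = tpure (us @ x # vs) + tpure (us @ y # vs)"
    "tpure (us @ (c *\<^sub>C x) # vs) = c *\<^sub>C tpure (us @ x # vs)" for us vs and x y :: 'a and c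
    by (transfer; rule cvec.span_base; unfold talg_rel_def diff_diff_eq[symmetric]; blast)+
  thus ?thesis by (auto simp: multilinear_def intro!: clinearI)
qed

typedef (overloaded) 'v tplus = "cvec.span (tpure ` {w :: 'v::complex_vect list. w \<noteq> []})"
  by (rule exI[of _ 0]) (rule cvec.span_zero)

setup_lifting type_definition_tplus

instantiation tplus :: (complex_vect) complex_vect
begin
lift_definition zero_tplus :: "'a tplus" is 0 by (rule cvec.span_zero)
lift_definition plus_tplus :: "'a tplus \<Rightarrow> 'a tplus \<Rightarrow> 'a tplus" is "(+)" by (rule cvec.span_add)
lift_definition minus_tplus :: "'a tplus \<Rightarrow> 'a tplus \<Rightarrow> 'a tplus" is "(-)" by (rule cvec.span_diff)
lift_definition uminus_tplus :: "'a tplus \<Rightarrow> 'a tplus" is "uminus" by (rule cvec.span_neg)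
lift_definition scaleC_tplus :: "complex \<Rightarrow> 'a tplus \<Rightarrow> 'a tplus" is "scaleC" by (rule cvec.span_scale)
instance
  by standard (transfer; simp add: algebra_simps scaleC_add_right scaleC_add_left scaleC_scaleC scaleC_one)+
end

text \<open>Only nonempty words belong to \<open>T\<^sub>+(V)\<close>; the value at \<open>[]\<close> is a dummy.\<close>

lift_definition tword :: "'v::complex_vect list \<Rightarrow> 'v tplus"
  is "\<lambda>w. if w = [] then 0 else tpure w"
  by (auto intro: cvec.span_base cvec.span_zero)

definition tplus_lift :: "('v::complex_vect list \<Rightarrow> 'w::complex_vect) \<Rightarrow> 'v tplus \<Rightarrow> 'w" where
  "tplus_lift g v = talg_lift g (Rep_tplus v)"

lemma tplus_lift_tword: "multilinear g \<Longrightarrow> w \<noteq> [] \<Longrightarrow> tplus_lift g (tword w) = g w"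
  by (simp add: tplus_lift_def tword.rep_eq talg_lift_tpure)

lemma clinear_tplus_lift: "multilinear g \<Longrightarrow> clinear (tplus_lift g)"
  unfolding tplus_lift_def
  by (rule clinearI) (simp_all add: plus_tplus.rep_eq scaleC_tplus.rep_eq
      clinear_add[OF clinear_talg_lift] clinear_scale[OF clinear_talg_lift])

lemma multilinear_tword: "multilinear tword"
proof -
  have "tpure (us @ (x + y) # vs) = tpure (us @ x # vs) + tpure (us @ y # vs)"
    "tpure (us @ (c *\<^sub>C x) # vs) = c *\<^sub>C tpure (us @ x # vs)" for us vs and x y :: 'a and c
    using multilinearD[OF multilinear_tpure] by blast+
  hence "tword (us @ (x + y) # vs) = tword (us @ x # vs) + tword (us @ y # vs)"
    "tword (us @ (c *\<^sub>C x) # vs) = c *\<^sub>C tword (us @ x # vs)" for us vs and x y :: 'a and c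
    by (transfer; simp)+
  thus ?thesis by (auto simp: multilinear_def intro!: clinearI)
qed

section \<open>The double tensor Hopf algebra\<close>

type_synonym 'a dta = "'a tplus talg"

text \<open>\<open>T(T\<^sub>+(A))\<close> is the tensor algebra of the vector space \<open>T\<^sub>+(A)\<close>, itself the augmentation ideal of
  \<open>T(A)\<close>; the product of \<open>'a dta\<close> is concatenation with bars. The pure tensor \<open>w\<^sub>1 | \<dots> | w\<^sub>m\<close> of nonempty
  words is \<open>bars [w\<^sub>1, \<dots>, w\<^sub>m]\<close>.\<close>

definition bars :: "'a::complex_vect list list \<Rightarrow> 'a dta" where
  "bars ws = tpure (map tword ws)"

definition interval_components :: "nat set \<Rightarrow> nat set set" where
  "interval_components J = {I. I \<noteq> {} \<and> I \<subseteq> J \<and> (\<exists>a b. I = {a..b}) \<and>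
     (\<forall>a b. I \<subseteq> {a..b} \<and> {a..b} \<subseteq> J \<longrightarrow> {a..b} = I)}"

definition components_list :: "nat set \<Rightarrow> nat set list" where
  "components_list J = sorted_key_list_of_set Min (interval_components J)"

text \<open>Positions in a word of length \<open>n\<close> are counted from 0, so \<open>{..<n}\<close> plays the role of
  \<open>{1, \<dots>, n}\<close>, the condition \<open>1 \<in> S\<close> reads \<open>0 \<in> S\<close>, and \<open>nths w S\<close> is \<open>w\<^sub>S\<close>. The empty word denotes
  the unit of \<open>T(T\<^sub>+(A))\<close>, whereas \<open>bars [[]] = 0\<close>; hence the case distinction.\<close>

definition coproduct_term :: "'a::complex_vect list \<Rightarrow> nat set \<Rightarrow> ('a dta, 'a dta) tens" where
  "coproduct_term w S =
     (if nths w S = [] then 1 else bars [nths w S]) \<otimes>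
     bars (map (nths w) (components_list ({..<length w} - S)))"

definition coproduct_word :: "'a::complex_vect list \<Rightarrow> ('a dta, 'a dta) tens" where
  "coproduct_word w = (\<Sum>S\<in>Pow {..<length w}. coproduct_term w S)"

definition coproduct_word_prec :: "'a::complex_vect list \<Rightarrow> ('a dta, 'a dta) tens" where
  "coproduct_word_prec w = (\<Sum>S\<in>{S\<in>Pow {..<length w}. 0 \<in> S}. coproduct_term w S)"

definition coproduct_word_succ :: "'a::complex_vect list \<Rightarrow> ('a dta, 'a dta) tens" where
  "coproduct_word_succ w = (\<Sum>S\<in>{S\<in>Pow {..<length w}. 0 \<notin> S}. coproduct_term w S)"

definition coproduct :: "'a::complex_vect dta \<Rightarrow> ('a dta, 'a dta) tens" where
  "coproduct = talg_lift (\<lambda>vs. prod_list (map (tplus_lift coproduct_word) vs))"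

text \<open>The half-coproducts live on the augmentation ideal; they are extended by 0 to the unit. With this
  extension, \<open>f \<prec> \<epsilon> = f = \<epsilon> \<succ> f\<close> and \<open>\<epsilon> \<prec> f = 0 = f \<succ> \<epsilon>\<close> hold for all linear \<open>f\<close> vanishing on the unit,
  so the half-shuffle products below need no separate convention for the counit.\<close>

definition coproduct_prec :: "'a::complex_vect dta \<Rightarrow> ('a dta, 'a dta) tens" where
  "coproduct_prec = talg_lift (\<lambda>vs. case vs of [] \<Rightarrow> 0
     | v # vs' \<Rightarrow> tplus_lift coproduct_word_prec v * prod_list (map (tplus_lift coproduct_word) vs'))"

definition coproduct_succ :: "'a::complex_vect dta \<Rightarrow> ('a dta, 'a dta) tens" where
  "coproduct_succ = talg_lift (\<lambda>vs. case vs of [] \<Rightarrow> 0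
     | v # vs' \<Rightarrow> tplus_lift coproduct_word_succ v * prod_list (map (tplus_lift coproduct_word) vs'))"

definition counit :: "'a::complex_vect dta \<Rightarrow> complex" where
  "counit = talg_lift (\<lambda>vs. if vs = [] then 1 else 0)"

subsection \<open>The coproducts on pure tensors\<close>

lemma interval_components_disjoint:
  assumes "I \<in> interval_components J" "I' \<in> interval_components J" "i \<in> I" "i \<in> I'"
  shows "I = I'"
proof -
  obtain a b c d where ab: "I = {a..b}" and cd: "I' = {c..d}"
    using assms(1,2) by (auto simp: interval_components_def)
  let ?U = "{min a c..max b d}"
  have i: "a \<le> i" "i \<le> b" "c \<le> i" "i \<le> d" using assms(3,4) ab cd by auto
  hence U: "?U = I \<union> I'" unfolding ab cd by (auto simp: min_def max_def split: if_splits)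
  hence "?U \<subseteq> J" "I \<subseteq> ?U" "I' \<subseteq> ?U" using assms(1,2) by (auto simp: interval_components_def)
  thus ?thesis using assms(1,2) unfolding interval_components_def by blast
qed

lemma interval_components_cover:
  assumes "finite J" "i \<in> J"
  obtains I where "I \<in> interval_components J" "i \<in> I"
proof -
  define K where "K = {I. (\<exists>a b. I = {a..b}) \<and> i \<in> I \<and> I \<subseteq> J}"
  have "finite K" unfolding K_def by (rule finite_subset[of _ "Pow J"]) (use assms(1) in auto)
  moreover have "\<exists>a b. {i..i} = {a..b}" by blast
  hence "{i..i} \<in> K" using assms(2) unfolding K_def by simp
  ultimately have "\<exists>I\<in>K. {i..i} \<subseteq> I \<and> (\<forall>I'\<in>K. I \<subseteq> I' \<longrightarrow> I = I')"
    by (rule finite_has_maximal2)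
  then obtain I where IK: "I \<in> K" and "{i..i} \<subseteq> I \<and> (\<forall>I'\<in>K. I \<subseteq> I' \<longrightarrow> I = I')" by (rule bexE)
  hence max: "I = I'" if "I' \<in> K" "I \<subseteq> I'" for I' using that by simp
  have iI: "i \<in> I" "I \<subseteq> J" "\<exists>a b. I = {a..b}" using IK by (simp_all add: K_def)
  have "I \<in> interval_components J"
    unfolding interval_components_def
  proof (intro CollectI conjI allI impI)
    fix a b assume ab: "I \<subseteq> {a..b} \<and> {a..b} \<subseteq> J"
    hence "{a..b} \<in> K" unfolding K_def using iI(1) by blast
    from max[OF this conjunct1[OF ab]] show "{a..b} = I" by (rule sym)
  next
    show "I \<noteq> {}" using iI(1) by blast
  qed (fact iI)+
  thus ?thesis using that iI(1) by simp
qed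

lemma (in linorder) sorted_key_list_of_set_inj:
  assumes "inj_on f A" "finite A"
  shows "set (sorted_key_list_of_set f A) = A \<and> distinct (sorted_key_list_of_set f A) \<and>
    sorted (map f (sorted_key_list_of_set f A))"
proof -
  interpret folding_insort_key less_eq less A f by unfold_locales (fact assms(1))
  show ?thesis
    using set_sorted_key_list_of_set[OF subset_refl assms(2)]
      distinct_if_distinct_map[OF distinct_sorted_key_list_of_set[OF subset_refl]]
      sorted_sorted_key_list_of_set[OF subset_refl] by simp
qed

lemma components_list:
  assumes "finite J"
  shows "set (components_list J) = interval_components J" "distinct (components_list J)"
    "sorted (map Min (components_list J))"
proof -
  have fin: "finite (interval_components J)"
    by (rule finite_subset[of _ "Pow J"]) (use assms in \<open>auto simp: interval_components_def\<close>)
  have Min: "Min I \<in> I" if "I \<in> interval_components J" for I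
    using that assms by (intro Min_in) (auto simp: interval_components_def)
  have "inj_on Min (interval_components J)"
  proof (rule inj_onI)
    fix I I' assume I: "I \<in> interval_components J" "I' \<in> interval_components J" "Min I = Min I'"
    show "I = I'"
      using interval_components_disjoint[OF I(1,2) Min[OF I(1)]] Min[OF I(2)] I(3) by simp
  qed
  from sorted_key_list_of_set_inj[OF this fin]
  show "set (components_list J) = interval_components J" "distinct (components_list J)"
    "sorted (map Min (components_list J))"
    unfolding components_list_def by simp_all
qed

lemma nths_slot:
  "nths (us @ x # vs) A =
     nths us A @ (if length us \<in> A then [x] else []) @ nths vs {j. Suc j + length us \<in> A}"
  by (simp add: nths_append nths_Cons)

lemma multilinearI:
  assumes "\<And>us vs x y. g (us @ (x + y) # vs) = g (us @ x # vs) + g (us @ y # vs)"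
    and "\<And>us vs x c. g (us @ (c *\<^sub>C x) # vs) = c *\<^sub>C g (us @ x # vs)"
  shows "multilinear g"
  unfolding multilinear_def by (intro allI clinearI assms)

lemma multilinear_slot: "multilinear g \<Longrightarrow> clinear (\<lambda>x. g (us @ x # vs))"
  by (simp add: multilinear_def)

lemma clinear_bars_slot: "clinear (\<lambda>x. bars (ws @ (us @ x # vs) # ws'))"
  using clinear_compose[OF multilinear_slot[OF multilinear_tword] multilinear_slot[OF multilinear_tpure]]
  by (simp add: bars_def)

lemma multilinear_coproduct_term: "multilinear (\<lambda>w. coproduct_term w S)"
  unfolding multilinear_def
proof (intro allI)
  fix us vs :: "'a list"
  let ?i = "length us" and ?J = "{..<Suc (length us + length vs)} - S"
  have lin: "clinear (\<lambda>s. s \<otimes> t)" "clinear (\<lambda>s. t \<otimes> s)" for t :: "'a dta"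
    using bilinear2_tens by (auto simp: bilinear2_def)
  have const: "nths (us @ x # vs) A = nths (us @ 0 # vs) A" if "?i \<notin> A" for A and x :: 'a
    using that by (simp add: nths_slot)
  show "clinear (\<lambda>x. coproduct_term (us @ x # vs) S)"
  proof (cases "?i \<in> S")
    case True
    let ?vs = "nths vs {j. Suc j + length us \<in> S}"
    have 1: "map (nths (us @ x # vs)) (components_list ?J) = map (nths (us @ 0 # vs)) (components_list ?J)"
      for x :: 'a
    proof (rule map_cong[OF refl], rule const)
      fix I assume "I \<in> set (components_list ?J)"
      hence "I \<subseteq> ?J" by (simp add: components_list interval_components_def)
      thus "?i \<notin> I" using True by blast
    qed
    have 2: "coproduct_term (us @ x # vs) S =
      bars ([] @ (nths us S @ x # ?vs) # []) \<otimes> bars (map (nths (us @ 0 # vs)) (components_list ?J))" for x :: 'a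
      unfolding 1[of x, symmetric] using True by (simp add: coproduct_term_def nths_slot)
    show ?thesis unfolding 2 by (rule clinear_compose[OF clinear_bars_slot lin(1)])
  next
    case False
    then obtain I where I: "I \<in> interval_components ?J" "?i \<in> I"
      using interval_components_cover[of ?J ?i] by auto
    have "I \<in> set (components_list ?J)" using I by (simp add: components_list)
    then obtain As Bs where AB: "components_list ?J = As @ I # Bs" by (meson split_list)
    have no: "?i \<notin> I'" if "I' \<in> set As \<union> set Bs" for I'
    proof
      assume "?i \<in> I'"
      moreover have "I' \<in> interval_components ?J"
        using that AB components_list(1)[of ?J] by auto
      ultimately have "I' = I" using interval_components_disjoint I by blast
      thus False using that AB components_list(2)[of ?J] by auto
    qed
    let ?vs = "nths vs {j. Suc j + length us \<in> I}"
    let ?A = "map (nths (us @ 0 # vs)) As" and ?B = "map (nths (us @ 0 # vs)) Bs"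
    have A: "map (nths (us @ x # vs)) As = ?A" and B: "map (nths (us @ x # vs)) Bs = ?B" for x :: 'a
      by (rule map_cong[OF refl], rule const, use no in blast)+
    have 2: "coproduct_term (us @ x # vs) S =
      (if nths (us @ 0 # vs) S = [] then 1 else bars [nths (us @ 0 # vs) S]) \<otimes>
      bars (?A @ (nths us I @ x # ?vs) # ?B)" for x :: 'a
      unfolding A[of x, symmetric] B[of x, symmetric] const[OF False, of x, symmetric]
      using AB I(2) by (simp add: coproduct_term_def nths_slot[of us x vs I])
    show ?thesis unfolding 2 by (rule clinear_compose[OF clinear_bars_slot lin(2)])
  qed
qed

lemma multilinear_sum_slots:
  assumes "\<And>S. multilinear (\<lambda>w. g w S)"
  shows "multilinear (\<lambda>w. \<Sum>S\<in>T (length w). g w S)"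
  by (rule multilinearI) (simp_all add: multilinearD[OF assms] sum.distrib cvec.scale_sum_right)

lemma multilinear_coproduct_word:
  "multilinear coproduct_word" "multilinear coproduct_word_prec" "multilinear coproduct_word_succ"
  unfolding coproduct_word_def[abs_def] coproduct_word_prec_def[abs_def] coproduct_word_succ_def[abs_def]
  by (rule multilinear_sum_slots[OF multilinear_coproduct_term])+

lemma clinear_mult: "clinear (\<lambda>x. x * (b :: 'a::complex_algebra_1))" "clinear (\<lambda>x. b * x)"
  by (auto intro!: clinearI simp: distrib_left distrib_right mult_scaleC_left mult_scaleC_right)

lemma multilinear_prod_list:
  assumes "clinear (f :: 'v::complex_vect \<Rightarrow> 'w::complex_algebra_1)"
  shows "multilinear (\<lambda>vs. prod_list (map f vs))"
  by (rule multilinearI) (simp_all add: clinear_add[OF assms] clinear_scale[OF assms]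
      distrib_left distrib_right mult_scaleC_left mult_scaleC_right)

lemma multilinear_half:
  assumes "clinear g" "clinear (f :: 'v::complex_vect \<Rightarrow> 'w::complex_algebra_1)"
  shows "multilinear (\<lambda>vs. case vs of [] \<Rightarrow> 0 | v # vs' \<Rightarrow> g v * prod_list (map f vs'))"
proof (rule multilinearI)
  fix us vs x y c
  let ?h = "\<lambda>vs. case vs of [] \<Rightarrow> 0 | v # vs' \<Rightarrow> g v * prod_list (map f vs')"
  show "?h (us @ (x + y) # vs) = ?h (us @ x # vs) + ?h (us @ y # vs)"
    by (cases us) (simp_all add: clinear_add[OF assms(1)] clinear_add[OF assms(2)] distrib_left distrib_right)
  show "?h (us @ (c *\<^sub>C x) # vs) = c *\<^sub>C ?h (us @ x # vs)"
    by (cases us) (simp_all add: clinear_scale[OF assms(1)] clinear_scale[OF assms(2)]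
        mult_scaleC_left mult_scaleC_right)
qed

lemma map_tplus_lift_tword:
  "multilinear g \<Longrightarrow> [] \<notin> set ws \<Longrightarrow> map (tplus_lift g) (map tword ws) = map g ws"
  by (induction ws) (auto simp: tplus_lift_tword)

lemma clinear_coproduct: "clinear coproduct" "clinear coproduct_prec" "clinear coproduct_succ"
  unfolding coproduct_def coproduct_prec_def coproduct_succ_def
  by (intro clinear_talg_lift multilinear_prod_list multilinear_half clinear_tplus_lift
      multilinear_coproduct_word)+

lemma coproduct_bars:
  assumes "[] \<notin> set ws"
  shows "coproduct (bars ws) = prod_list (map coproduct_word ws)"
  unfolding coproduct_def bars_def
  by (subst talg_lift_tpure)
    (simp_all only: map_tplus_lift_tword[OF _ assms] multilinear_coproduct_word
      multilinear_prod_list clinear_tplus_lift)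

lemma half_coproduct_bars:
  assumes g: "multilinear g" and ne: "[] \<notin> set (w # ws)"
  shows "talg_lift (\<lambda>vs. case vs of [] \<Rightarrow> 0
     | v # vs' \<Rightarrow> tplus_lift g v * prod_list (map (tplus_lift coproduct_word) vs')) (bars (w # ws))
    = g w * coproduct (bars ws)" (is "talg_lift ?h _ = _")
proof -
  have ne': "w \<noteq> []" "[] \<notin> set ws" using ne by auto
  have "multilinear ?h"
    by (intro multilinear_half clinear_tplus_lift g multilinear_coproduct_word)
  hence "talg_lift ?h (bars (w # ws)) = ?h (map tword (w # ws))"
    unfolding bars_def by (rule talg_lift_tpure)
  also have "\<dots> = g w * prod_list (map (tplus_lift coproduct_word) (map tword ws))"
    by (simp add: tplus_lift_tword[OF g ne'(1)])
  finally show ?thesis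
    by (simp only: map_tplus_lift_tword[OF multilinear_coproduct_word(1) ne'(2)] coproduct_bars[OF ne'(2)])
qed

lemma coproduct_prec_bars:
  "[] \<notin> set (w # ws) \<Longrightarrow> coproduct_prec (bars (w # ws)) = coproduct_word_prec w * coproduct (bars ws)"
  unfolding coproduct_prec_def by (rule half_coproduct_bars[OF multilinear_coproduct_word(2)])

lemma coproduct_succ_bars:
  "[] \<notin> set (w # ws) \<Longrightarrow> coproduct_succ (bars (w # ws)) = coproduct_word_succ w * coproduct (bars ws)"
  unfolding coproduct_succ_def by (rule half_coproduct_bars[OF multilinear_coproduct_word(3)])

lemma coproduct_word_split: "coproduct_word w = coproduct_word_prec w + coproduct_word_succ w"
proof -
  have "Pow {..<length w} = {S\<in>Pow {..<length w}. 0 \<in> S} \<union> {S\<in>Pow {..<length w}. 0 \<notin> S}" by blast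
  thus ?thesis unfolding coproduct_word_def coproduct_word_prec_def coproduct_word_succ_def
    by (metis (no_types, lifting) sum.union_disjoint finite_Pow_iff finite_lessThan finite_Un
        disjoint_iff mem_Collect_eq)
qed

section \<open>Products on the dual\<close>

definition conv :: "('a::complex_vect dta \<Rightarrow> complex) \<Rightarrow> ('a dta \<Rightarrow> complex) \<Rightarrow> 'a dta \<Rightarrow> complex" where
  "conv f g x = tens_lift (\<lambda>s t. f s * g t) (coproduct x)"

definition hs_prec :: "('a::complex_vect dta \<Rightarrow> complex) \<Rightarrow> ('a dta \<Rightarrow> complex) \<Rightarrow> 'a dta \<Rightarrow> complex" where
  "hs_prec f g x = tens_lift (\<lambda>s t. f s * g t) (coproduct_prec x)"

definition hs_succ :: "('a::complex_vect dta \<Rightarrow> complex) \<Rightarrow> ('a dta \<Rightarrow> complex) \<Rightarrow> 'a dta \<Rightarrow> complex" where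
  "hs_succ f g x = tens_lift (\<lambda>s t. f s * g t) (coproduct_succ x)"

definition character :: "('a::complex_vect dta \<Rightarrow> complex) \<Rightarrow> bool" where
  "character f \<longleftrightarrow> clinear f \<and> f 1 = 1 \<and> (\<forall>x y. f (x * y) = f x * f y)"

definition infinitesimal_character :: "('a::complex_vect dta \<Rightarrow> complex) \<Rightarrow> bool" where
  "infinitesimal_character \<alpha> \<longleftrightarrow>
     clinear \<alpha> \<and> \<alpha> 1 = 0 \<and> (\<forall>vs. length vs \<ge> 2 \<longrightarrow> \<alpha> (tpure vs) = 0)"

primrec conv_power :: "('a::complex_vect dta \<Rightarrow> complex) \<Rightarrow> nat \<Rightarrow> 'a dta \<Rightarrow> complex" where
  "conv_power \<alpha> 0 = counit"
| "conv_power \<alpha> (Suc n) = conv (conv_power \<alpha> n) \<alpha>"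

primrec succ_power :: "('a::complex_vect dta \<Rightarrow> complex) \<Rightarrow> nat \<Rightarrow> 'a dta \<Rightarrow> complex" where
  "succ_power \<alpha> 0 = counit"
| "succ_power \<alpha> (Suc n) = hs_succ (succ_power \<alpha> n) \<alpha>"

text \<open>On each element, only finitely many terms of the following series are nonzero when \<open>\<alpha>\<close> is an
  infinitesimal character, so \<open>suminf\<close> is a finite sum there.\<close>

definition exp_conv :: "('a::complex_vect dta \<Rightarrow> complex) \<Rightarrow> 'a dta \<Rightarrow> complex" where
  "exp_conv \<alpha> x = suminf (\<lambda>n. conv_power \<alpha> n x / fact n)"

definition exp_succ :: "('a::complex_vect dta \<Rightarrow> complex) \<Rightarrow> 'a dta \<Rightarrow> complex" where
  "exp_succ \<alpha> x = suminf (\<lambda>n. succ_power \<alpha> n x)"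

definition pre_lie :: "('a::complex_vect dta \<Rightarrow> complex) \<Rightarrow> ('a dta \<Rightarrow> complex) \<Rightarrow> 'a dta \<Rightarrow> complex" where
  "pre_lie \<alpha> \<gamma> x = hs_prec \<alpha> \<gamma> x - hs_succ \<gamma> \<alpha> x"

primrec pre_lie_right_iter :: "('a::complex_vect dta \<Rightarrow> complex) \<Rightarrow> nat \<Rightarrow> ('a dta \<Rightarrow> complex) \<Rightarrow> 'a dta \<Rightarrow> complex" where
  "pre_lie_right_iter \<gamma> 0 \<alpha> = \<alpha>"
| "pre_lie_right_iter \<gamma> (Suc n) \<alpha> = pre_lie (pre_lie_right_iter \<gamma> n \<alpha>) \<gamma>"

section \<open>Non-crossing partitions and nesting forests\<close>

definition noncrossing :: "nat set set \<Rightarrow> bool" where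
  "noncrossing \<pi> \<longleftrightarrow> (\<forall>V\<in>\<pi>. \<forall>W\<in>\<pi>. V \<noteq> W \<longrightarrow>
     \<not> (\<exists>a b c d. a < b \<and> b < c \<and> c < d \<and> a \<in> V \<and> c \<in> V \<and> b \<in> W \<and> d \<in> W))"

definition NC :: "nat \<Rightarrow> nat set set set" where
  "NC n = {\<pi>. partition_on {..<n} \<pi> \<and> noncrossing \<pi>}"

definition nests :: "nat set \<Rightarrow> nat set \<Rightarrow> bool" where
  "nests V U \<longleftrightarrow> (\<exists>a\<in>V. \<exists>b\<in>V. \<forall>c\<in>U. a < c \<and> c < b)"

definition outer_blocks :: "nat set set \<Rightarrow> nat set set" where
  "outer_blocks \<pi> = {V \<in> \<pi>. \<not> (\<exists>W\<in>\<pi>. nests W V)}"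

definition inner_blocks :: "nat set set \<Rightarrow> nat set set" where
  "inner_blocks \<pi> = \<pi> - outer_blocks \<pi>"

definition child_blocks :: "nat set set \<Rightarrow> nat set \<Rightarrow> nat set set" where
  "child_blocks \<pi> V = {U \<in> \<pi>. nests V U \<and> \<not> (\<exists>W\<in>\<pi>. nests V W \<and> nests W U)}"

datatype 'b rtree = Node 'b "'b rtree multiset"

primrec tree_size :: "'b rtree \<Rightarrow> nat" where
  "tree_size (Node v ts) = Suc (\<Sum>t\<in>#ts. tree_size t)"

primrec tree_factorial :: "'b rtree \<Rightarrow> nat" where
  "tree_factorial (Node v ts) = tree_size (Node v ts) * (\<Prod>t\<in>#ts. tree_factorial t)"

definition forest_factorial :: "'b rtree multiset \<Rightarrow> nat" where
  "forest_factorial ts = (\<Prod>t\<in>#ts. tree_factorial t)"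

lemma image_mset_fundef_cong [fundef_cong]:
  "M = N \<Longrightarrow> (\<And>x. x \<in># N \<Longrightarrow> f x = g x) \<Longrightarrow> image_mset f M = image_mset g N"
  by (auto intro: image_mset_cong)

function nesting_tree :: "nat set set \<Rightarrow> nat set \<Rightarrow> nat set rtree" where
  "nesting_tree \<pi> V = Node V (image_mset (nesting_tree \<pi>) (mset_set (child_blocks \<pi> V)))"
  by pat_completeness auto

termination
proof (relation "measures [\<lambda>(\<pi>, V). if finite V then 0 else 1,
    \<lambda>(\<pi>, V). if V = {} then 0 else Suc (Max V - Min V)]", goal_cases)
  case 1
  show ?case by simp
next
  case (2 \<pi> V U)
  hence "nests V U" by (metis (no_types, lifting) child_blocks_def elem_mset_set empty_iff infinite_set_mset_mset_set mem_Collect_eq)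
  then obtain a b where ab: "a \<in> V" "b \<in> V" "\<And>c. c \<in> U \<Longrightarrow> a < c \<and> c < b"
    by (auto simp: nests_def)
  have "finite U" by (rule finite_subset[of _ "{a..b}"]) (auto dest: ab(3) intro: less_imp_le)
  moreover have "Max U - Min U < Max V - Min V" if "finite V" "U \<noteq> {}"
  proof -
    have "Max U < b" "a < Min U" using ab(3) \<open>finite U\<close> that by auto
    moreover have "b \<le> Max V" "Min V \<le> a" using ab(1,2) that by auto
    moreover have "Min U \<le> Max U" using \<open>finite U\<close> that by simp
    ultimately show ?thesis by linarith
  qed
  ultimately show ?case using ab(1) by auto
qed

declare nesting_tree.simps [simp del]

definition nesting_forest :: "nat set set \<Rightarrow> nat set rtree multiset" where
  "nesting_forest \<pi> = image_mset (nesting_tree \<pi>) (mset_set (outer_blocks \<pi>))"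

section \<open>Cumulants and the characters of a probability space\<close>

definition nc_prob_space :: "('a::complex_algebra_1 \<Rightarrow> complex) \<Rightarrow> bool" where
  "nc_prob_space \<phi> \<longleftrightarrow> clinear \<phi> \<and> \<phi> 1 = 1"

definition cond_nc_prob_space :: "('a::complex_algebra_1 \<Rightarrow> complex) \<Rightarrow> ('a \<Rightarrow> complex) \<Rightarrow> bool" where
  "cond_nc_prob_space \<phi> \<psi> \<longleftrightarrow> nc_prob_space \<phi> \<and> clinear \<psi> \<and> \<psi> 1 = 1"

definition extending_character :: "('a::complex_algebra_1 \<Rightarrow> complex) \<Rightarrow> ('a dta \<Rightarrow> complex) \<Rightarrow> bool" where
  "extending_character \<phi> \<Phi> \<longleftrightarrow>
     character \<Phi> \<and> (\<forall>w. w \<noteq> [] \<longrightarrow> \<Phi> (bars [w]) = \<phi> (prod_list w))"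

text \<open>A family \<open>{h\<^sub>n : A\<^sup>n \<rightarrow> \<complex>}\<^sub>n\<^sub>\<ge>\<^sub>1\<close> is a function on nonempty lists, \<open>n\<close> being the length. The
  equations below determine its values on nonempty lists, since the one-block partition contributes
  \<open>h w\<close> and all other terms involve shorter lists only; multilinearity is a consequence.\<close>

definition monotone_cumulants :: "('a::complex_algebra_1 \<Rightarrow> complex) \<Rightarrow> ('a list \<Rightarrow> complex) \<Rightarrow> bool" where
  "monotone_cumulants \<psi> h' \<longleftrightarrow> (\<forall>w. w \<noteq> [] \<longrightarrow>
     \<psi> (prod_list w) = (\<Sum>\<pi>\<in>NC (length w).
       1 / of_nat (forest_factorial (nesting_forest \<pi>)) * (\<Prod>V\<in>\<pi>. h' (nths w V))))"

definition cond_monotone_cumulants ::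
    "('a::complex_algebra_1 \<Rightarrow> complex) \<Rightarrow> ('a list \<Rightarrow> complex) \<Rightarrow> ('a list \<Rightarrow> complex) \<Rightarrow> bool" where
  "cond_monotone_cumulants \<phi> h' hc \<longleftrightarrow> (\<forall>w. w \<noteq> [] \<longrightarrow>
     \<phi> (prod_list w) = (\<Sum>\<pi>\<in>NC (length w).
       1 / of_nat (forest_factorial (nesting_forest \<pi>)) *
       (\<Prod>V\<in>outer_blocks \<pi>. hc (nths w V)) * (\<Prod>V\<in>inner_blocks \<pi>. h' (nths w V))))"

end

theory Submission
  imports Defs
begin

text \<open>On a word, a product whose right factor is an infinitesimal character removes one nonempty interval of
  letters: the removed letters have to form a single component, and that component is evaluated by the
  right factor. Hence \<open>conv_power \<rho>' n\<close> sums over all ways to remove \<open>n\<close> intervals one after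
  the other until nothing is left, each interval being one of the word that remains. In
  \<open>\<alpha> \<lhd> \<rho>'\<close> the subtracted half removes a proper suffix, so that just the intervals avoiding the
  first and the last letter survive. In \<open>exp_succ \<beta>\<close> the intervals removed are prefixes.

  The intervals removed one after the other are the blocks of a non-crossing partition \<open>\<pi>\<close> of the original
  word, and a removal order is a linear extension of the nesting forest of \<open>\<pi>\<close> that takes a
  block after all blocks nested in it. By the hook length formula there are \<open>|\<pi>|! / t(\<pi>)!\<close> such orders.
  What is needed of that formula is its recursion, obtained by removing one leaf
  (\<open>hook_weight_leaf_recursion\<close>). It matches the removal of one interval because the leaves of the
  forest are exactly the blocks that are intervals (\<open>leaf_iff_convex_in\<close>), so that induction on the
  number of removals gives both expansions:

  \<^item> \<open>exp_conv \<rho>'\<close> is the sum of \<open>\<Prod>V\<in>\<pi>. \<rho>'(w\<^sub>V)\<close> with weights \<open>1 / t(\<pi>)!\<close>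
    (\<open>exp_conv_eq_moment_sum\<close>), which is the formula defining the monotone cumulants, whence \<open>\<rho>' = h'\<close>;
  \<^item> \<open>P + (\<Sum>n>0. r\<^sup>n(P) / (n+1)!)\<close> is the analogous sum over the partitions whose first and last letter share
    a block, this block being weighted by \<open>P\<close> and every other one by \<open>\<rho>'\<close>
    (\<open>pre_lie_exponential_eq_irreducible_sum\<close>). A partition with \<open>n + 1\<close> blocks arises from \<open>n\<close>
    removals, and its root has hook length \<open>n + 1\<close>; this is where the factor \<open>1/(n+1)!\<close> comes from.

  The second sum is \<open>\<beta>\<close>. A non-crossing partition is cut into one of that kind and a shorter one at the last
  letter of the block of the first letter, and \<open>exp_succ \<beta>\<close> obeys the corresponding recursion. Therefore
  \<open>\<Phi>\<close> is the sum over all non-crossing partitions with outer blocks weighted by \<open>P\<close> and inner ones by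
  \<open>\<rho>' = h'\<close> (\<open>exp_succ_eq_moment_sum\<close>), which is the formula defining the conditionally monotone
  cumulants. That formula determines its outer weights by induction on the length
  (\<open>moment_sum_determines\<close>), so \<open>P\<close> is the cumulant.\<close>

section \<open>Hook weights of forests\<close>

text \<open>The nesting order of the blocks of a non-crossing partition is of this kind: \<open>R u v\<close> says that \<open>v\<close> lies
  below \<open>u\<close> in a forest with vertex set \<open>X\<close>. That the ancestors of a vertex form a chain is what makes the
  order a forest.\<close>

definition forest_order :: "('b \<Rightarrow> 'b \<Rightarrow> bool) \<Rightarrow> 'b set \<Rightarrow> bool" where
  "forest_order R X \<longleftrightarrow> finite X \<and> asymp_on X R \<and> transp_on X R \<and>
     (\<forall>u\<in>X. \<forall>v\<in>X. \<forall>x\<in>X. R u x \<longrightarrow> R v x \<longrightarrow> u = v \<or> R u v \<or> R v u)"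

definition hook :: "('b \<Rightarrow> 'b \<Rightarrow> bool) \<Rightarrow> 'b set \<Rightarrow> 'b \<Rightarrow> nat" where
  "hook R X v = card {u\<in>X. u = v \<or> R v u}"

text \<open>The inverse of the tree factorial of the forest; multiplied by \<open>fact (card X)\<close>, it is the number of linear
  extensions.\<close>

definition hook_weight :: "('b \<Rightarrow> 'b \<Rightarrow> bool) \<Rightarrow> 'b set \<Rightarrow> complex" where
  "hook_weight R X = (\<Prod>v\<in>X. 1 / of_nat (hook R X v))"

definition leaves :: "('b \<Rightarrow> 'b \<Rightarrow> bool) \<Rightarrow> 'b set \<Rightarrow> 'b set" where
  "leaves R X = {x\<in>X. \<forall>u\<in>X. \<not> R x u}"

lemma forest_order_subset: "forest_order R X \<Longrightarrow> Y \<subseteq> X \<Longrightarrow> forest_order R Y"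
  unfolding forest_order_def
  by (auto intro: finite_subset asymp_on_subset transp_on_subset dest: subsetD)

lemma forest_orderD:
  assumes "forest_order R X"
  shows "finite X" "x \<in> X \<Longrightarrow> \<not> R x x" "x \<in> X \<Longrightarrow> y \<in> X \<Longrightarrow> R x y \<Longrightarrow> \<not> R y x"
    "x \<in> X \<Longrightarrow> y \<in> X \<Longrightarrow> z \<in> X \<Longrightarrow> R x y \<Longrightarrow> R y z \<Longrightarrow> R x z"
    "x \<in> X \<Longrightarrow> y \<in> X \<Longrightarrow> z \<in> X \<Longrightarrow> R x z \<Longrightarrow> R y z \<Longrightarrow> x = y \<or> R x y \<or> R y x"
  using assms unfolding forest_order_def asymp_on_def transp_on_def by blast+

lemma hook_weight_Un:
  assumes "finite Y" "finite Z" "Y \<inter> Z = {}"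
    and "\<And>y z. y \<in> Y \<Longrightarrow> z \<in> Z \<Longrightarrow> \<not> R y z \<and> \<not> R z y"
  shows "hook_weight R (Y \<union> Z) = hook_weight R Y * hook_weight R Z"
proof -
  have "hook R (Y \<union> Z) y = hook R Y y" if "y \<in> Y" for y
    unfolding hook_def using assms(3,4) that by (intro arg_cong[where f = card]) auto
  moreover have "hook R (Y \<union> Z) z = hook R Z z" if "z \<in> Z" for z
    unfolding hook_def using assms(3,4) that by (intro arg_cong[where f = card]) auto
  ultimately show ?thesis
    unfolding hook_weight_def using assms(1-3) by (simp add: prod.union_disjoint)
qed

lemma hook_weight_root:
  assumes "finite Y" "r \<notin> Y" "\<And>v. v \<in> Y \<Longrightarrow> R r v \<and> \<not> R v r"
  shows "hook_weight R (insert r Y) = hook_weight R Y / of_nat (Suc (card Y))"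
proof -
  have "{u \<in> insert r Y. u = r \<or> R r u} = insert r Y" using assms(3) by auto
  hence "hook R (insert r Y) r = Suc (card Y)"
    unfolding hook_def using assms(1,2) by simp
  moreover have "hook R (insert r Y) v = hook R Y v" if "v \<in> Y" for v
    unfolding hook_def using assms(2,3) that by (intro arg_cong[where f = card]) auto
  ultimately show ?thesis
    unfolding hook_weight_def using assms(1,2) by simp
qed

text \<open>For linear extensions this is the classification by their last vertex. For hook weights it follows by
  induction on the forest. If there is a root above everything else, deleting it divides out its hook
  length and leaves the leaves as they are; otherwise a tree splits off, the weight is multiplicative,
  and the recursion behaves like a derivation.\<close>

lemma hook_weight_leaf_recursion:
  assumes "forest_order R X"
  shows "of_nat (card X) * hook_weight R X = (\<Sum>l\<in>leaves R X. hook_weight R (X - {l}))"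
  using assms
proof (induction "card X" arbitrary: X rule: less_induct)
  case less
  note fD = forest_orderD[OF less.prems]
  show ?case
  proof (cases "X = {}")
    case True
    thus ?thesis by (simp add: leaves_def)
  next
    case False
    \<comment> \<open>A minimal vertex is a root; Y is the tree hanging from it.\<close>
    then obtain r where r: "r \<in> X" "\<And>x. x \<in> X \<Longrightarrow> x \<noteq> r \<Longrightarrow> \<not> R x r"
      using Finite_Set.bex_min_element[of X R] less.prems unfolding forest_order_def by metis
    define Y where "Y = {u\<in>X. u = r \<or> R r u}"
    define Z where "Z = X - Y"
    have fin: "finite Y" "finite Z" and Y: "r \<in> Y" "Y \<subseteq> X" and Z: "Z \<subseteq> X"
      and X: "X = Y \<union> Z" and YZ: "Y \<inter> Z = {}"
      using fD(1) r(1) by (auto simp: Y_def Z_def)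
    have unrel: "\<not> R y z \<and> \<not> R z y" if "y \<in> Y" "z \<in> Z" for y z
    proof -
      have z: "z \<in> X" "z \<noteq> r" "\<not> R r z" using that(2) by (auto simp: Y_def Z_def)
      have y: "y \<in> X" "y = r \<or> R r y" using that(1) by (auto simp: Y_def)
      have "\<not> R y z" using y z fD(4)[OF r(1) y(1) z(1)] by blast
      moreover have "\<not> R z y" using y(2) z r(2) fD(5)[OF r(1) z(1) y(1)] by blast
      ultimately show ?thesis by blast
    qed
    show ?thesis
    proof (cases "Z = {}")
      case True
      define Y' where "Y' = X - {r}"
      have Y': "finite Y'" "r \<notin> Y'" "X = insert r Y'" using fD(1) r(1) by (auto simp: Y'_def)
      have root: "R r v \<and> \<not> R v r" if "v \<in> Y'" for v
      proof -
        have "v \<in> X" "v \<noteq> r" using that by (auto simp: Y'_def)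
        moreover have "v \<in> Y" using \<open>v \<in> X\<close> True by (auto simp: Z_def)
        ultimately show ?thesis using r(2) by (auto simp: Y_def)
      qed
      show ?thesis
      proof (cases "Y' = {}")
        case True
        hence X: "X = {r}" using Y' by simp
        have "leaves R X = {r}" using fD(2) unfolding X leaves_def by auto
        moreover have "{u \<in> {r}. u = r \<or> R r u} = {r}" by blast
        hence "hook R {r} r = 1" unfolding hook_def by simp
        ultimately show ?thesis by (simp add: X hook_weight_def)
      next
        case False
        have "card Y' < card X" using Y' by simp
        moreover have "forest_order R Y'"
          using less.prems Y'(3) by (auto intro: forest_order_subset)
        ultimately have IH: "of_nat (card Y') * hook_weight R Y' =
            (\<Sum>l\<in>leaves R Y'. hook_weight R (Y' - {l}))" by (rule less.hyps)
        have leaves: "leaves R X = leaves R Y'"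
          using root False fD(2)[OF r(1)] unfolding leaves_def Y'(3) by auto
        have c: "Suc (card (Y' - {l})) = card Y'" if "l \<in> Y'" for l
          using that Y'(1) card_Suc_Diff1 by metis
        have "hook_weight R (X - {l}) = hook_weight R (Y' - {l}) / of_nat (card Y')"
          if "l \<in> leaves R Y'" for l
        proof -
          have l: "l \<in> Y'" using that by (simp add: leaves_def)
          hence "X - {l} = insert r (Y' - {l})" using Y'(2,3) by auto
          thus ?thesis using hook_weight_root[of "Y' - {l}" r R] Y'(1,2) root c[OF l] by simp
        qed
        hence "(\<Sum>l\<in>leaves R X. hook_weight R (X - {l})) =
            (\<Sum>l\<in>leaves R Y'. hook_weight R (Y' - {l}) / of_nat (card Y'))"
          by (simp add: leaves)
        also have "\<dots> = hook_weight R Y'"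
          unfolding sum_divide_distrib[symmetric] IH[symmetric] using False Y'(1) by simp
        also have "\<dots> = of_nat (card X) * hook_weight R X"
        proof -
          have "hook_weight R X = hook_weight R Y' / of_nat (Suc (card Y'))"
            unfolding Y'(3) by (rule hook_weight_root[OF Y'(1,2)]) (rule root)
          moreover have "card X = Suc (card Y')" using Y' by simp
          ultimately show ?thesis by (simp del: of_nat_Suc)
        qed
        finally show ?thesis ..
      qed
    next
      case False
      have less: "card Y < card X" "card Z < card X"
        using fD(1) Y Z False YZ X by (auto intro!: psubset_card_mono)
      have IH: "of_nat (card Y) * hook_weight R Y = (\<Sum>l\<in>leaves R Y. hook_weight R (Y - {l}))"
          "of_nat (card Z) * hook_weight R Z = (\<Sum>l\<in>leaves R Z. hook_weight R (Z - {l}))"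
        using less less.hyps forest_order_subset[OF less.prems] Y Z by blast+
      have lv: "leaves R X = leaves R Y \<union> leaves R Z"
        using unrel unfolding leaves_def X by auto
      have lv_disj: "leaves R Y \<inter> leaves R Z = {}" using YZ by (auto simp: leaves_def)
      have fl: "finite (leaves R Y)" "finite (leaves R Z)" using fin by (auto simp: leaves_def)
      have 1: "hook_weight R (X - {l}) = hook_weight R (Y - {l}) * hook_weight R Z"
        if "l \<in> leaves R Y" for l
      proof -
        have "X - {l} = (Y - {l}) \<union> Z" using that X YZ by (auto simp: leaves_def)
        thus ?thesis using hook_weight_Un[of "Y - {l}" Z R] fin YZ unrel by auto
      qed
      have 2: "hook_weight R (X - {l}) = hook_weight R Y * hook_weight R (Z - {l})"
        if "l \<in> leaves R Z" for l
      proof -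
        have "X - {l} = Y \<union> (Z - {l})" using that X YZ by (auto simp: leaves_def)
        thus ?thesis using hook_weight_Un[of Y "Z - {l}" R] fin YZ unrel by auto
      qed
      have "(\<Sum>l\<in>leaves R X. hook_weight R (X - {l})) =
          (\<Sum>l\<in>leaves R Y. hook_weight R (Y - {l})) * hook_weight R Z +
          hook_weight R Y * (\<Sum>l\<in>leaves R Z. hook_weight R (Z - {l}))"
        unfolding lv sum.union_disjoint[OF fl lv_disj]
        by (simp add: 1 2 sum_distrib_left sum_distrib_right)
      also have "\<dots> = of_nat (card Y + card Z) * (hook_weight R Y * hook_weight R Z)"
        unfolding IH[symmetric] by (simp add: algebra_simps)
      also have "\<dots> = of_nat (card X) * hook_weight R X"
        unfolding X using hook_weight_Un[of Y Z R] fin YZ unrel by (simp add: card_Un_disjoint)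
      finally show ?thesis ..
    qed
  qed
qed

section \<open>Non-crossing partitions ordered by nesting\<close>

text \<open>Arbitrary finite sets of positions are allowed, so that a block can be removed without renumbering the
  remaining positions.\<close>

definition NC_on :: "nat set \<Rightarrow> nat set set set" where
  "NC_on A = {\<pi>. partition_on A \<pi> \<and> noncrossing \<pi>}"

lemma NC_on_lessThan: "NC n = NC_on {..<n}"
  by (simp add: NC_def NC_on_def)

lemma finite_NC_on: "finite A \<Longrightarrow> finite (NC_on A)"
  by (rule finite_subset[of _ "Pow (Pow A)"]) (auto simp: NC_on_def partition_on_def)

lemma NC_onD:
  assumes "\<pi> \<in> NC_on A" "finite A"
  shows "finite \<pi>" "V \<in> \<pi> \<Longrightarrow> finite V" "V \<in> \<pi> \<Longrightarrow> V \<noteq> {}" "V \<in> \<pi> \<Longrightarrow> V \<subseteq> A" "\<Union>\<pi> = A"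
    "V \<in> \<pi> \<Longrightarrow> W \<in> \<pi> \<Longrightarrow> x \<in> V \<Longrightarrow> x \<in> W \<Longrightarrow> V = W"
    "V \<in> \<pi> \<Longrightarrow> W \<in> \<pi> \<Longrightarrow> a \<in> V \<Longrightarrow> b \<in> W \<Longrightarrow> c \<in> V \<Longrightarrow> d \<in> W \<Longrightarrow> a < b \<Longrightarrow> b < c \<Longrightarrow> c < d \<Longrightarrow> V = W"
proof -
  have p: "partition_on A \<pi>" and nc: "noncrossing \<pi>" using assms(1) by (auto simp: NC_on_def)
  show "finite \<pi>" using p assms(2) by (rule finite_elements[rotated])
  show U: "\<Union>\<pi> = A" using p by (simp add: partition_on_def)
  thus "V \<in> \<pi> \<Longrightarrow> V \<subseteq> A" "V \<in> \<pi> \<Longrightarrow> finite V" using assms(2) by (auto intro: finite_subset)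
  show "V \<in> \<pi> \<Longrightarrow> V \<noteq> {}" using p by (auto simp: partition_on_def)
  show "V \<in> \<pi> \<Longrightarrow> W \<in> \<pi> \<Longrightarrow> x \<in> V \<Longrightarrow> x \<in> W \<Longrightarrow> V = W"
    using p by (auto simp: partition_on_def disjoint_def)
  show "V \<in> \<pi> \<Longrightarrow> W \<in> \<pi> \<Longrightarrow> a \<in> V \<Longrightarrow> b \<in> W \<Longrightarrow> c \<in> V \<Longrightarrow> d \<in> W \<Longrightarrow> a < b \<Longrightarrow> b < c \<Longrightarrow> c < d \<Longrightarrow> V = W"
    using nc[unfolded noncrossing_def, rule_format, of V W] by metis
qed

text \<open>Nesting is inclusion of convex hulls, strict at both ends, hence visibly a strict order.\<close>

lemma nests_iff:
  assumes "finite V" "finite U" "V \<noteq> {}" "U \<noteq> {}"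
  shows "nests V U \<longleftrightarrow> Min V < Min U \<and> Max U < Max V"
proof
  assume "nests V U"
  then obtain a b where "a \<in> V" "b \<in> V" "\<And>c. c \<in> U \<Longrightarrow> a < c \<and> c < b" by (auto simp: nests_def)
  thus "Min V < Min U \<and> Max U < Max V"
    using assms Min_in[of U] Max_in[of U] Min_le[of V a] Max_ge[of V b]
    by (meson le_less_trans less_le_trans)
next
  assume *: "Min V < Min U \<and> Max U < Max V"
  show "nests V U" unfolding nests_def
    using * assms by (intro bexI[of _ "Min V"] bexI[of _ "Max V"]) (auto intro: less_le_trans le_less_trans)
qed

text \<open>Two different blocks above a common third one have overlapping hulls; being non-crossing, one of the
  hulls contains the other.\<close>

lemma forest_order_nests:
  assumes "\<pi> \<in> NC_on A" "finite A"
  shows "forest_order nests \<pi>"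
proof -
  note D = NC_onD[OF assms]
  have n: "nests V U \<longleftrightarrow> Min V < Min U \<and> Max U < Max V" if "V \<in> \<pi>" "U \<in> \<pi>" for U V
    using that D(2,3) by (intro nests_iff) auto
  have comparable: "nests V W"
    if "V \<in> \<pi>" "W \<in> \<pi>" "U \<in> \<pi>" "nests V U" "nests W U" "Min V \<le> Min W" "V \<noteq> W" for U V W
  proof -
    have in': "Min V \<in> V" "Max V \<in> V" "Min W \<in> W" "Max W \<in> W"
      using that(1,2) D(2,3) by simp_all
    have ne: "Min V \<noteq> Min W" "Max V \<noteq> Max W" using D(6)[OF that(1,2)] in' that(7) by metis+
    have "Min U \<le> Max U" using that(3) D(2,3) by simp
    hence "Min W < Max V" using that n by fastforce
    hence "\<not> Max V < Max W"
      using D(7)[OF that(1,2) in'(1,3,2,4)] ne that(6,7) by linarith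
    thus ?thesis using n[OF that(1,2)] ne that(6) by linarith
  qed
  show ?thesis unfolding forest_order_def
  proof (intro conjI ballI impI)
    show "finite \<pi>" by (fact D(1))
    show "asymp_on \<pi> nests" by (rule asymp_onI) (auto simp: n)
    show "transp_on \<pi> nests" by (rule transp_onI) (auto simp: n)
    fix V W U assume "V \<in> \<pi>" "W \<in> \<pi>" "U \<in> \<pi>" "nests V U" "nests W U"
    thus "V = W \<or> nests V W \<or> nests W V"
      using comparable[of V W U] comparable[of W V U] by (metis linear)
  qed
qed

text \<open>The nonempty intervals of the ordered set \<open>A\<close>: consecutive letters of the word that remains when only the
  positions in \<open>A\<close> are kept.\<close>

definition convex_in :: "nat set \<Rightarrow> nat set \<Rightarrow> bool" where
  "convex_in A J \<longleftrightarrow> J \<noteq> {} \<and> J \<subseteq> A \<and> (\<forall>a\<in>J. \<forall>b\<in>J. \<forall>x\<in>A. a < x \<and> x < b \<longrightarrow> x \<in> J)"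

lemma convex_inD: "convex_in A J \<Longrightarrow> J \<noteq> {}" "convex_in A J \<Longrightarrow> J \<subseteq> A"
  by (simp_all add: convex_in_def)

text \<open>A position between two elements of \<open>J\<close> but outside \<open>J\<close> belongs to some other block, which cannot cross \<open>J\<close>
  and is therefore nested in it.\<close>

lemma leaf_iff_convex_in:
  assumes "\<pi> \<in> NC_on A" "finite A" "J \<in> \<pi>"
  shows "J \<in> leaves nests \<pi> \<longleftrightarrow> convex_in A J"
proof
  note D = NC_onD[OF assms(1,2)]
  assume leaf: "J \<in> leaves nests \<pi>"
  show "convex_in A J"
    unfolding convex_in_def
  proof (intro conjI ballI impI)
    fix a b x assume x: "a \<in> J" "b \<in> J" "x \<in> A" "a < x \<and> x < b"
    show "x \<in> J"
    proof (rule ccontr)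
      assume "x \<notin> J"
      obtain W where W: "W \<in> \<pi>" "x \<in> W" using x(3) D(5) by blast
      hence WJ: "W \<noteq> J" using \<open>x \<notin> J\<close> by blast
      have "a < c \<and> c < b" if c: "c \<in> W" for c
      proof -
        have "c \<noteq> a" "c \<noteq> b" using D(6)[OF W(1) assms(3)] c x(1,2) WJ by metis+
        moreover have "\<not> c < a"
          using D(7)[OF W(1) assms(3) c x(1) W(2) x(2)] x(4) WJ by blast
        moreover have "\<not> b < c"
          using D(7)[OF assms(3) W(1) x(1) W(2) x(2) c] x(4) WJ by blast
        ultimately show ?thesis by linarith
      qed
      hence "nests J W" using x(1,2) by (auto simp: nests_def)
      thus False using leaf W(1) by (auto simp: leaves_def)
    qed
  qed (use D(3,4) assms(3) in auto)
next
  note D = NC_onD[OF assms(1,2)]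
  assume c: "convex_in A J"
  have False if W: "W \<in> \<pi>" and n: "nests J W" for W
  proof -
    obtain a b where ab: "a \<in> J" "b \<in> J" "\<And>c. c \<in> W \<Longrightarrow> a < c \<and> c < b"
      using n by (auto simp: nests_def)
    have "W \<subseteq> J" using c ab D(4)[OF W] unfolding convex_in_def by blast
    hence "W = J" using D(3,6)[OF W] assms(3) by blast
    thus False using ab by blast
  qed
  thus "J \<in> leaves nests \<pi>" using assms(3) by (auto simp: leaves_def)
qed

lemma noncrossing_subset: "noncrossing \<pi> \<Longrightarrow> \<pi>' \<subseteq> \<pi> \<Longrightarrow> noncrossing \<pi>'"
  unfolding noncrossing_def by (rule ballI, rule ballI, drule bspec, erule (1) subsetD, drule bspec, erule (1) subsetD)

lemma NC_on_iff:
  "\<pi> \<in> NC_on A \<longleftrightarrow> \<Union>\<pi> = A \<and> {} \<notin> \<pi> \<and> (\<forall>V\<in>\<pi>. \<forall>W\<in>\<pi>. V \<noteq> W \<longrightarrow> V \<inter> W = {}) \<and> noncrossing \<pi>"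
  unfolding NC_on_def partition_on_def disjoint_def mem_Collect_eq by (rule iffI) simp_all

lemma NC_on_remove_block:
  assumes "\<pi> \<in> NC_on A" "J \<in> \<pi>"
  shows "\<pi> - {J} \<in> NC_on (A - J)"
proof -
  have p: "\<Union>\<pi> = A" "{} \<notin> \<pi>" "\<forall>V\<in>\<pi>. \<forall>W\<in>\<pi>. V \<noteq> W \<longrightarrow> V \<inter> W = {}" and nc: "noncrossing \<pi>"
    using assms(1) by (simp_all add: NC_on_iff)
  have "\<Union>(\<pi> - {J}) = A - J"
  proof
    show "\<Union>(\<pi> - {J}) \<subseteq> A - J" using p(1) p(3)[rule_format, OF _ assms(2)] by blast
    show "A - J \<subseteq> \<Union>(\<pi> - {J})" unfolding p(1)[symmetric] by blast
  qed
  thus ?thesis using p(2,3) noncrossing_subset[OF nc, of "\<pi> - {J}"] by (simp add: NC_on_iff)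
qed

lemma NC_on_insert_block:
  assumes "\<pi> \<in> NC_on (A - J)" "convex_in A J"
  shows "insert J \<pi> \<in> NC_on A" "J \<notin> \<pi>"
proof -
  have p: "\<Union>\<pi> = A - J" "{} \<notin> \<pi>" "\<forall>V\<in>\<pi>. \<forall>W\<in>\<pi>. V \<noteq> W \<longrightarrow> V \<inter> W = {}" and nc: "noncrossing \<pi>"
    using assms(1) by (simp_all add: NC_on_iff)
  have J: "J \<noteq> {}" "J \<subseteq> A" "\<And>a b x. a \<in> J \<Longrightarrow> b \<in> J \<Longrightarrow> x \<in> A \<Longrightarrow> a < x \<Longrightarrow> x < b \<Longrightarrow> x \<in> J"
    using assms(2) unfolding convex_in_def by metis+
  have VJ: "V \<inter> J = {}" "V \<subseteq> A" if "V \<in> \<pi>" for V using that p(1) by blast+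
  show "J \<notin> \<pi>" using VJ J(1) by blast
  have "\<Union>(insert J \<pi>) = A" using p(1) J(2) by blast
  moreover have "\<forall>V\<in>insert J \<pi>. \<forall>W\<in>insert J \<pi>. V \<noteq> W \<longrightarrow> V \<inter> W = {}"
  proof (intro ballI impI)
    fix V W assume "V \<in> insert J \<pi>" "W \<in> insert J \<pi>" "V \<noteq> W"
    thus "V \<inter> W = {}" using p(3) VJ(1)[of V] VJ(1)[of W] by (metis Int_commute insert_iff)
  qed
  moreover have "noncrossing (insert J \<pi>)"
    unfolding noncrossing_def
  proof (intro ballI impI notI)
    fix V W assume VW: "V \<in> insert J \<pi>" "W \<in> insert J \<pi>" "V \<noteq> W"
    assume "\<exists>a b c d. a < b \<and> b < c \<and> c < d \<and> a \<in> V \<and> c \<in> V \<and> b \<in> W \<and> d \<in> W"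
    then obtain a b c d where h: "a < b" "b < c" "c < d" "a \<in> V" "c \<in> V" "b \<in> W" "d \<in> W" by blast
    consider "V = J" "W \<in> \<pi>" | "W = J" "V \<in> \<pi>" | "V \<in> \<pi>" "W \<in> \<pi>" using VW by blast
    thus False
    proof cases
      case 1 thus False using h(1-5) J(3)[of a c b] VJ[of W] h(6) by auto
    next
      case 2 thus False using h(1-4) h(6,7) J(3)[of b d c] VJ[of V] h(5) by auto
    next
      case 3 thus False using h nc VW(3) unfolding noncrossing_def by metis
    qed
  qed
  ultimately show "insert J \<pi> \<in> NC_on A" using p(2) J(1) by (simp add: NC_on_iff)
qed

lemma finite_convex_in: "finite A \<Longrightarrow> finite {J. convex_in A J}"
  by (rule finite_subset[of _ "Pow A"]) (simp_all add: convex_in_def subset_iff)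

section \<open>Tree factorials as products of hook lengths\<close>

text \<open>A set closed under descendants is the disjoint union of the trees hanging from its roots. Taking for \<open>Y\<close>
  all vertices gives the decomposition of a forest into trees, and taking the proper descendants of a
  vertex gives the subtrees of its children.\<close>

lemma forest_order_components:
  assumes "forest_order R X" "Y \<subseteq> X"
    and down: "\<And>u v. u \<in> Y \<Longrightarrow> v \<in> X \<Longrightarrow> R u v \<Longrightarrow> v \<in> Y"
  defines "C \<equiv> {v\<in>Y. \<not> (\<exists>u\<in>Y. R u v)}"
  shows "(\<Union>c\<in>C. {v\<in>X. v = c \<or> R c v}) = Y"
    and "c \<in> C \<Longrightarrow> c' \<in> C \<Longrightarrow> c \<noteq> c' \<Longrightarrow> {v\<in>X. v = c \<or> R c v} \<inter> {v\<in>X. v = c' \<or> R c' v} = {}"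
proof -
  note D = forest_orderD[OF assms(1)]
  have as: "asymp_on X R" and tr: "transp_on X R" using assms(1) by (simp_all add: forest_order_def)
  have "u \<in> (\<Union>c\<in>C. {v\<in>X. v = c \<or> R c v})" if u: "u \<in> Y" for u
  proof -
    let ?S = "{w\<in>Y. w = u \<or> R w u}"
    have uX: "u \<in> X" using u assms(2) by blast
    have S: "u \<in> ?S" "?S \<subseteq> X" using u assms(2) by auto
    have "\<exists>w\<in>?S. \<forall>x\<in>?S. x \<noteq> w \<longrightarrow> \<not> R x w"
      by (rule Finite_Set.bex_min_element[OF finite_subset[OF S(2) D(1)]
            asymp_on_subset[OF as S(2)] transp_on_subset[OF tr S(2)]]) (use S(1) in blast)
    then obtain w where w: "w \<in> ?S" "\<And>x. x \<in> ?S \<Longrightarrow> x \<noteq> w \<Longrightarrow> \<not> R x w" by blast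
    have "\<not> R x w" if x: "x \<in> Y" for x
    proof
      assume h: "R x w"
      have xw: "x \<in> X" "w \<in> X" using x w(1) assms(2) by auto
      have "x = u \<or> R x u" using w(1) h D(4)[OF xw uX] by auto
      moreover have "x \<noteq> w" using h D(2)[OF xw(1)] by blast
      ultimately show False using w(2)[of x] h x by blast
    qed
    hence "w \<in> C" using w(1) by (auto simp: C_def)
    thus ?thesis using w(1) uX by auto
  qed
  moreover have "v \<in> Y" if "c \<in> C" "v \<in> X" "v = c \<or> R c v" for c v
    using that down[of c v] by (auto simp: C_def)
  ultimately show "(\<Union>c\<in>C. {v\<in>X. v = c \<or> R c v}) = Y" by blast
  show "{v\<in>X. v = c \<or> R c v} \<inter> {v\<in>X. v = c' \<or> R c' v} = {}" if c: "c \<in> C" "c' \<in> C" "c \<noteq> c'" for c c'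
  proof (rule ccontr)
    have X: "c \<in> X" "c' \<in> X" using c(1,2) assms(2) by (auto simp: C_def)
    have nR: "\<not> R c c'" "\<not> R c' c" using c(1,2) by (auto simp: C_def)
    assume "\<not> ?thesis"
    then obtain v where v: "v \<in> X" "v = c \<or> R c v" "v = c' \<or> R c' v" by blast
    thus False using D(5)[OF X v(1)] nR c(3) by blast
  qed
qed

text \<open>Unfolding the recursion for tree factorials leaves one factor per vertex, the size of the subtree at
  that vertex, which is its hook length.\<close>

lemma tree_factorial_nesting_tree:
  assumes "forest_order nests \<pi>" "V \<in> \<pi>"
  shows "tree_size (nesting_tree \<pi> V) = hook nests \<pi> V"
    and "tree_factorial (nesting_tree \<pi> V) = (\<Prod>U | U \<in> \<pi> \<and> (U = V \<or> nests V U). hook nests \<pi> U)"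
proof -
  let ?D = "\<lambda>V. {U\<in>\<pi>. U = V \<or> nests V U}"
  note D = forest_orderD[OF assms(1)]
  have "tree_size (nesting_tree \<pi> V) = hook nests \<pi> V \<and>
      tree_factorial (nesting_tree \<pi> V) = prod (hook nests \<pi>) (?D V)"
    using assms(2)
  proof (induction "card (?D V)" arbitrary: V rule: less_induct)
    case less
    let ?C = "child_blocks \<pi> V"
    let ?Y = "{U\<in>\<pi>. nests V U}"
    have C: "?C = {U\<in>?Y. \<not> (\<exists>W\<in>?Y. nests W U)}"
      by (auto simp: child_blocks_def)
    have sub: "?Y \<subseteq> \<pi>" by blast
    have down: "W \<in> ?Y" if "U \<in> ?Y" "W \<in> \<pi>" "nests U W" for U W
      using that D(4)[OF less.prems, of U W] by blast
    note comp = forest_order_components[OF assms(1) sub down, folded C]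
    have "?D V = insert V ?Y" using less.prems by blast
    also have "?Y = (\<Union>U\<in>?C. ?D U)" by (rule comp(1)[symmetric])
    finally have desc: "?D V = insert V (\<Union>U\<in>?C. ?D U)" .
    have disj: "?D U \<inter> ?D U' = {}" if "U \<in> ?C" "U' \<in> ?C" "U \<noteq> U'" for U U'
      by (rule comp(2)) (use that in blast)+
    have finD: "finite (?D U)" for U using D(1) by simp
    have finC: "finite ?C" using D(1) by (simp add: C)
    have nV: "V \<notin> (\<Union>U\<in>?C. ?D U)"
      using D(2,3) less.prems by (auto simp: C)
    have IH: "tree_size (nesting_tree \<pi> U) = hook nests \<pi> U \<and>
      tree_factorial (nesting_tree \<pi> U) = prod (hook nests \<pi>) (?D U)" if U: "U \<in> ?C" for U
    proof (rule less.hyps)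
      have "?D U \<subseteq> ?D V" unfolding desc using U by blast
      moreover have "V \<notin> ?D U" using nV U by blast
      ultimately have "?D U \<subset> ?D V" using less.prems by blast
      thus "card (?D U) < card (?D V)" by (rule psubset_card_mono[OF finD])
      show "U \<in> \<pi>" using U by (simp add: C)
    qed
    have "card (?D V) = Suc (card (\<Union>U\<in>?C. ?D U))"
      unfolding desc using nV finC finD by (subst card_insert_disjoint) auto
    also have "card (\<Union>U\<in>?C. ?D U) = (\<Sum>U\<in>?C. card (?D U))"
      by (rule card_UN_disjoint[OF finC]) (use finD disj in auto)
    finally have sz: "hook nests \<pi> V = Suc (\<Sum>U\<in>?C. hook nests \<pi> U)" by (simp add: hook_def)
    have "prod (hook nests \<pi>) (?D V) = hook nests \<pi> V * prod (hook nests \<pi>) (\<Union>U\<in>?C. ?D U)"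
      unfolding desc using nV finC finD by (subst prod.insert) auto
    also have "prod (hook nests \<pi>) (\<Union>U\<in>?C. ?D U) = (\<Prod>U\<in>?C. prod (hook nests \<pi>) (?D U))"
      by (rule prod.UNION_disjoint[OF finC]) (use finD disj in auto)
    finally have fac: "prod (hook nests \<pi>) (?D V) =
      hook nests \<pi> V * (\<Prod>U\<in>?C. prod (hook nests \<pi>) (?D U))" .
    have size: "tree_size (nesting_tree \<pi> V) = hook nests \<pi> V"
      unfolding sz nesting_tree.simps[of \<pi> V]
      by (simp add: image_mset.compositionality o_def sum_unfold_sum_mset[symmetric] IH)
    have "tree_factorial (nesting_tree \<pi> V) =
        tree_size (nesting_tree \<pi> V) * (\<Prod>U\<in>?C. tree_factorial (nesting_tree \<pi> U))"
      unfolding nesting_tree.simps[of \<pi> V]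
      by (simp add: image_mset.compositionality o_def prod_unfold_prod_mset)
    thus ?case using size fac IH by simp
  qed
  thus "tree_size (nesting_tree \<pi> V) = hook nests \<pi> V"
    "tree_factorial (nesting_tree \<pi> V) = prod (hook nests \<pi>) (?D V)" by blast+
qed

lemma forest_factorial_nesting_forest:
  assumes "forest_order nests \<pi>"
  shows "1 / of_nat (forest_factorial (nesting_forest \<pi>)) = hook_weight nests \<pi>"
proof -
  let ?D = "\<lambda>V. {U\<in>\<pi>. U = V \<or> nests V U}"
  note D = forest_orderD[OF assms]
  have C: "outer_blocks \<pi> = {V\<in>\<pi>. \<not> (\<exists>W\<in>\<pi>. nests W V)}" by (simp add: outer_blocks_def)
  note root = forest_order_components[OF assms order_refl, folded C]
  have disj: "?D U \<inter> ?D V = {}" if "U \<in> outer_blocks \<pi>" "V \<in> outer_blocks \<pi>" "U \<noteq> V" for U V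
    by (rule root(2)) (use that in blast)+
  have "forest_factorial (nesting_forest \<pi>) = (\<Prod>V\<in>outer_blocks \<pi>. tree_factorial (nesting_tree \<pi> V))"
    by (simp add: forest_factorial_def nesting_forest_def image_mset.compositionality o_def prod_unfold_prod_mset)
  also have "\<dots> = (\<Prod>V\<in>outer_blocks \<pi>. prod (hook nests \<pi>) (?D V))"
    using tree_factorial_nesting_tree(2)[OF assms] by (intro prod.cong) (auto simp: C)
  also have "\<dots> = prod (hook nests \<pi>) (\<Union>V\<in>outer_blocks \<pi>. ?D V)"
    by (rule prod.UNION_disjoint[symmetric]) (use D(1) disj in \<open>auto simp: C\<close>)
  also have "(\<Union>V\<in>outer_blocks \<pi>. ?D V) = \<pi>" by (rule root(1))
  finally show ?thesis by (simp add: hook_weight_def prod_dividef)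
qed

section \<open>Sums over non-crossing partitions by repeated removal of intervals\<close>

text \<open>A non-crossing partition with a marked leaf is the same thing as an interval \<open>J\<close> of \<open>A\<close> together with a
  non-crossing partition of \<open>A - J\<close>, since adding an interval as a block never creates a crossing. The
  leaf recursion provides the marked leaf.\<close>

lemma sum_NC_on_remove_leaf:
  fixes w :: "nat set set \<Rightarrow> complex"
  assumes A: "finite A"
  shows "(\<Sum>\<pi> | \<pi> \<in> NC_on A \<and> card \<pi> = Suc n. fact (Suc n) * hook_weight nests \<pi> * w \<pi>) =
    (\<Sum>J | convex_in A J. \<Sum>\<pi> | \<pi> \<in> NC_on (A - J) \<and> card \<pi> = n.
       fact n * hook_weight nests \<pi> * w (insert J \<pi>))"
proof -
  let ?P = "{\<pi>. \<pi> \<in> NC_on A \<and> card \<pi> = Suc n}"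
  let ?Q = "\<lambda>J. {\<pi>. \<pi> \<in> NC_on (A - J) \<and> card \<pi> = n}"
  have fin: "finite ?P" "finite (?Q J)" for J
    by (rule finite_subset[OF _ finite_NC_on[of A]], blast, fact A)
      (rule finite_subset[OF _ finite_NC_on[of "A - J"]], blast, rule finite_Diff, fact A)
  have fl: "finite (leaves nests \<pi>)" if "\<pi> \<in> ?P" for \<pi>
    using that NC_onD(1) A by (auto simp: leaves_def)
  have "(\<Sum>\<pi>\<in>?P. fact (Suc n) * hook_weight nests \<pi> * w \<pi>) =
      (\<Sum>\<pi>\<in>?P. \<Sum>J\<in>leaves nests \<pi>. fact n * hook_weight nests (\<pi> - {J}) * w \<pi>)"
  proof (rule sum.cong[OF refl])
    fix \<pi> assume "\<pi> \<in> ?P"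
    hence "of_nat (Suc n) * hook_weight nests \<pi> = (\<Sum>J\<in>leaves nests \<pi>. hook_weight nests (\<pi> - {J}))"
      using hook_weight_leaf_recursion[OF forest_order_nests[OF _ A], of \<pi>] by simp
    hence "fact n * (of_nat (Suc n) * hook_weight nests \<pi>) * w \<pi> =
        (\<Sum>J\<in>leaves nests \<pi>. fact n * hook_weight nests (\<pi> - {J}) * w \<pi>)"
      by (simp only: sum_distrib_left sum_distrib_right)
    thus "fact (Suc n) * hook_weight nests \<pi> * w \<pi> =
        (\<Sum>J\<in>leaves nests \<pi>. fact n * hook_weight nests (\<pi> - {J}) * w \<pi>)"
      by (simp add: algebra_simps)
  qed
  also have "\<dots> = (\<Sum>(\<pi>, J)\<in>Sigma ?P (leaves nests). fact n * hook_weight nests (\<pi> - {J}) * w \<pi>)"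
    using fin(1) fl by (subst sum.Sigma) auto
  also have "\<dots> = (\<Sum>(J, \<pi>)\<in>Sigma {J. convex_in A J} ?Q. fact n * hook_weight nests \<pi> * w (insert J \<pi>))"
  proof (rule sum.reindex_bij_witness[of _ "\<lambda>(J, \<pi>). (insert J \<pi>, J)" "\<lambda>(\<pi>, J). (J, \<pi> - {J})"])
    fix p assume "p \<in> Sigma ?P (leaves nests)"
    then obtain \<pi> J where p: "p = (\<pi>, J)" "\<pi> \<in> NC_on A" "card \<pi> = Suc n" "J \<in> leaves nests \<pi>" by auto
    hence J: "J \<in> \<pi>" by (simp add: leaves_def)
    hence ins: "insert J (\<pi> - {J}) = \<pi>" by blast
    show "(case (case p of (\<pi>, J) \<Rightarrow> (J, \<pi> - {J})) of (J, \<pi>) \<Rightarrow> (insert J \<pi>, J)) = p"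
      using ins p(1) by simp
    show "(case p of (\<pi>, J) \<Rightarrow> (J, \<pi> - {J})) \<in> Sigma {J. convex_in A J} ?Q"
      using p J leaf_iff_convex_in[OF p(2) A J] NC_on_remove_block[OF p(2) J] by simp
    show "(case case p of (\<pi>, J) \<Rightarrow> (J, \<pi> - {J}) of
        (J, \<pi>) \<Rightarrow> fact n * hook_weight nests \<pi> * w (insert J \<pi>)) =
      (case p of (\<pi>, J) \<Rightarrow> fact n * hook_weight nests (\<pi> - {J}) * w \<pi>)"
      using ins p(1) by simp
  next
    fix p assume "p \<in> Sigma {J. convex_in A J} ?Q"
    then obtain \<pi> J where p: "p = (J, \<pi>)" "\<pi> \<in> NC_on (A - J)" "card \<pi> = n" "convex_in A J" by auto
    note ins = NC_on_insert_block[OF p(2,4)]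
    have "card (insert J \<pi>) = Suc n" using ins(2) p(3) NC_onD(1)[OF p(2)] A by simp
    thus "(case p of (J, \<pi>) \<Rightarrow> (insert J \<pi>, J)) \<in> Sigma ?P (leaves nests)"
      using p(1,4) ins leaf_iff_convex_in[OF ins(1) A, of J] by simp
    show "(case (case p of (J, \<pi>) \<Rightarrow> (insert J \<pi>, J)) of (\<pi>, J) \<Rightarrow> (J, \<pi> - {J})) = p"
      using p(1) ins(2) by simp
  qed
  also have "\<dots> = (\<Sum>J | convex_in A J. \<Sum>\<pi>\<in>?Q J. fact n * hook_weight nests \<pi> * w (insert J \<pi>))"
    using finite_convex_in[OF A] fin(2) by (subst sum.Sigma) auto
  finally show ?thesis .
qed

text \<open>For \<open>p\<close> the conditionally monotone and \<open>r\<close> the monotone cumulants this is the right-hand side of the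
  moment-cumulant formula.\<close>

definition moment_sum :: "(nat set \<Rightarrow> complex) \<Rightarrow> (nat set \<Rightarrow> complex) \<Rightarrow> nat set \<Rightarrow> complex" where
  "moment_sum p r A = (\<Sum>\<pi>\<in>NC_on A. hook_weight nests \<pi> *
     ((\<Prod>V\<in>outer_blocks \<pi>. p V) * (\<Prod>V\<in>inner_blocks \<pi>. r V)))"

text \<open>The sum has at most one term: the block containing both ends of \<open>A\<close>, if there is one. It is then the only
  outer block, and partitions without such a block get weight 0.\<close>

definition spanning_weight :: "(nat set \<Rightarrow> complex) \<Rightarrow> (nat set \<Rightarrow> complex) \<Rightarrow> nat set \<Rightarrow> nat set set \<Rightarrow> complex" where
  "spanning_weight p r A \<pi> = (\<Sum>V | V \<in> \<pi> \<and> Min A \<in> V \<and> Max A \<in> V. p V * (\<Prod>U\<in>\<pi> - {V}. r U))"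

definition irreducible_sum :: "(nat set \<Rightarrow> complex) \<Rightarrow> (nat set \<Rightarrow> complex) \<Rightarrow> nat set \<Rightarrow> complex" where
  "irreducible_sum p r A = (\<Sum>\<pi>\<in>NC_on A. hook_weight nests \<pi> * spanning_weight p r A \<pi>)"

lemma NC_on_empty: "NC_on {} = {{}}"
  by (auto simp: NC_on_iff noncrossing_def)

lemma card_NC_on_le:
  assumes "\<pi> \<in> NC_on A" "finite A"
  shows "card \<pi> \<le> card A"
proof (rule card_inj_on_le[OF _ _ assms(2)])
  note D = NC_onD[OF assms]
  have M: "Min V \<in> V" if "V \<in> \<pi>" for V using D(2,3) that by simp
  show "inj_on Min \<pi>" by (rule inj_onI) (metis D(6) M)
  show "Min ` \<pi> \<subseteq> A" using D(4) M by blast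
qed

lemma singleton_in_NC_on: "A \<noteq> {} \<Longrightarrow> {A} \<in> NC_on A"
  by (simp add: NC_on_iff noncrossing_def)

lemma NC_on_card_1:
  assumes "A \<noteq> {}"
  shows "{\<pi>. \<pi> \<in> NC_on A \<and> card \<pi> = Suc 0} = {{A}}"
proof -
  have "\<pi> = {A}" if "\<pi> \<in> NC_on A" "card \<pi> = Suc 0" for \<pi>
  proof -
    obtain V where "\<pi> = {V}" using \<open>card \<pi> = Suc 0\<close> by (auto simp: card_1_singleton_iff)
    thus ?thesis using \<open>\<pi> \<in> NC_on A\<close> by (simp add: NC_on_iff)
  qed
  moreover have "card {A} = Suc 0" by simp
  ultimately show ?thesis using singleton_in_NC_on[OF assms] by blast
qed

lemma hook_weight_singleton: "finite V \<Longrightarrow> V \<noteq> {} \<Longrightarrow> hook_weight nests {V} = 1"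
proof -
  assume "finite V" "V \<noteq> {}"
  have "{u \<in> {V}. u = V \<or> nests V u} = {V}" by blast
  thus ?thesis by (simp add: hook_weight_def hook_def)
qed

text \<open>By \<open>sum_NC_on_remove_leaf\<close>, the sums on the right obey the recursion that defines \<open>c\<close>.\<close>

lemma iterated_interval_removal:
  assumes X: "finite X"
    and c0: "\<And>A. A \<subseteq> X \<Longrightarrow> c 0 A = (if A = {} then 1 else 0)"
    and cS: "\<And>n A. A \<subseteq> X \<Longrightarrow> c (Suc n) A = (\<Sum>J | convex_in A J. c n (A - J) * r J)"
  shows "A \<subseteq> X \<Longrightarrow> c n A = (\<Sum>\<pi> | \<pi> \<in> NC_on A \<and> card \<pi> = n. fact n * hook_weight nests \<pi> * (\<Prod>V\<in>\<pi>. r V))"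
proof (induction n arbitrary: A)
  case 0
  have fA: "finite A" using 0 X by (rule finite_subset)
  have "{\<pi>. \<pi> \<in> NC_on A \<and> card \<pi> = 0} = (if A = {} then {{}} else {})"
    using NC_onD(1)[OF _ fA] by (auto simp: NC_on_empty) (auto simp: NC_on_iff)
  thus ?case using c0[OF 0] by (simp add: hook_weight_def)
next
  case (Suc n)
  have fA: "finite A" using Suc.prems X by (rule finite_subset)
  have "c (Suc n) A = (\<Sum>J | convex_in A J. c n (A - J) * r J)" by (rule cS[OF Suc.prems])
  also have "\<dots> = (\<Sum>J | convex_in A J. \<Sum>\<pi> | \<pi> \<in> NC_on (A - J) \<and> card \<pi> = n.
       fact n * hook_weight nests \<pi> * (\<Prod>V\<in>insert J \<pi>. r V))"
  proof (rule sum.cong[OF refl])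
    fix J assume "J \<in> {J. convex_in A J}"
    hence J: "convex_in A J" by simp
    have "c n (A - J) = (\<Sum>\<pi> | \<pi> \<in> NC_on (A - J) \<and> card \<pi> = n. fact n * hook_weight nests \<pi> * (\<Prod>V\<in>\<pi>. r V))"
      by (rule Suc.IH) (use Suc.prems in blast)
    moreover have "(\<Prod>V\<in>insert J \<pi>. r V) = (\<Prod>V\<in>\<pi>. r V) * r J" if "\<pi> \<in> NC_on (A - J)" for \<pi>
      using NC_onD(1)[OF that] NC_on_insert_block(2)[OF that J] fA by simp
    ultimately show "c n (A - J) * r J = (\<Sum>\<pi> | \<pi> \<in> NC_on (A - J) \<and> card \<pi> = n.
       fact n * hook_weight nests \<pi> * (\<Prod>V\<in>insert J \<pi>. r V))"
      by (simp add: sum_distrib_right mult.assoc)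
  qed
  finally show ?case using sum_NC_on_remove_leaf[OF fA, of n "\<lambda>\<pi>. \<Prod>V\<in>\<pi>. r V"] by simp
qed

lemma Min_Max_remove:
  assumes "finite A" "A \<noteq> {}" "Min A \<notin> J" "Max A \<notin> J"
  shows "A - J \<noteq> {}" "Min (A - J) = Min A" "Max (A - J) = Max A"
proof -
  show "A - J \<noteq> {}" using assms Min_in by blast
  show "Min (A - J) = Min A" by (rule Min_eqI) (use assms in auto)
  show "Max (A - J) = Max A" by (rule Max_eqI) (use assms in auto)
qed

text \<open>If \<open>J\<close> contains just one end of \<open>A\<close>, no block contains both ends; if \<open>J\<close> contains both, convexity forces
  \<open>J = A\<close>, leaving nothing to be partitioned by \<open>\<pi>\<close>. So just the intervals avoiding both ends contribute.\<close>

lemma spanning_weight_insert: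
  assumes A: "finite A" "A \<noteq> {}" and J: "convex_in A J" and \<pi>: "\<pi> \<in> NC_on (A - J)" "\<pi> \<noteq> {}"
  shows "spanning_weight p r A (insert J \<pi>) =
    (if Min A \<notin> J \<and> Max A \<notin> J then spanning_weight p r (A - J) \<pi> * r J else 0)"
proof -
  note D = NC_onD[OF \<pi>(1) finite_Diff[OF A(1)]]
  have JA: "J \<subseteq> A" using J by (simp add: convex_in_def)
  let ?S = "{V. V \<in> insert J \<pi> \<and> Min A \<in> V \<and> Max A \<in> V}"
  have notJ: "\<not> (Min A \<in> J \<and> Max A \<in> J)"
  proof
    assume h: "Min A \<in> J \<and> Max A \<in> J"
    have "x \<in> J" if x: "x \<in> A" for x
    proof -
      have "Min A \<le> x" "x \<le> Max A" using A x by auto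
      thus ?thesis using J h x unfolding convex_in_def by (metis le_neq_implies_less)
    qed
    hence "A - J = {}" by blast
    hence "\<pi> \<in> NC_on {}" using \<pi>(1) by (simp only:)
    thus False using \<pi>(2) by (simp add: NC_on_empty)
  qed
  show ?thesis
  proof (cases "Min A \<notin> J \<and> Max A \<notin> J")
    case True
    note M = Min_Max_remove[OF A conjunct1[OF True] conjunct2[OF True]]
    have S: "?S = {V. V \<in> \<pi> \<and> Min (A - J) \<in> V \<and> Max (A - J) \<in> V}" using True M by auto
    have "p V * (\<Prod>U\<in>insert J \<pi> - {V}. r U) = p V * (\<Prod>U\<in>\<pi> - {V}. r U) * r J" if "V \<in> \<pi>" for V
    proof -
      have "insert J \<pi> - {V} = insert J (\<pi> - {V})" "J \<notin> \<pi>"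
        using that NC_on_insert_block(2)[OF \<pi>(1) J] by auto
      thus ?thesis using D(1) by simp
    qed
    hence "(\<Sum>V | V \<in> \<pi> \<and> Min (A - J) \<in> V \<and> Max (A - J) \<in> V. p V * (\<Prod>U\<in>insert J \<pi> - {V}. r U)) =
        spanning_weight p r (A - J) \<pi> * r J"
      unfolding spanning_weight_def sum_distrib_right by (intro sum.cong) auto
    thus ?thesis unfolding spanning_weight_def[of p r A] S using True by simp
  next
    case False
    have S: "?S = {}" using False notJ D(4) by auto
    show ?thesis unfolding spanning_weight_def[of p r A] S using False by auto
  qed
qed

text \<open>The counterpart of \<open>iterated_interval_removal\<close> for removals that keep the first and the last position.
  Here \<open>n\<close> removals leave one last block, so the partitions have \<open>n + 1\<close> blocks, and \<open>p\<close> evaluates the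
  block that is left.\<close>

lemma iterated_inner_interval_removal:
  assumes X: "finite X"
    and k0: "\<And>A. A \<subseteq> X \<Longrightarrow> A \<noteq> {} \<Longrightarrow> k 0 A = p A"
    and kS: "\<And>n A. A \<subseteq> X \<Longrightarrow> A \<noteq> {} \<Longrightarrow>
      k (Suc n) A = (\<Sum>J | convex_in A J \<and> Min A \<notin> J \<and> Max A \<notin> J. k n (A - J) * r J)"
  shows "A \<subseteq> X \<Longrightarrow> A \<noteq> {} \<Longrightarrow> k n A = (\<Sum>\<pi> | \<pi> \<in> NC_on A \<and> card \<pi> = Suc n.
      fact (Suc n) * hook_weight nests \<pi> * spanning_weight p r A \<pi>)"
proof (induction n arbitrary: A)
  case 0
  have fA: "finite A" using 0(1) X by (rule finite_subset)
  have "{V. V = A \<and> Min A \<in> V \<and> Max A \<in> V} = {A}" using Min_in[OF fA 0(2)] Max_in[OF fA 0(2)] by auto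
  thus ?case using k0[OF 0] fA 0(2)
    by (simp add: NC_on_card_1 hook_weight_singleton spanning_weight_def)
next
  case (Suc n)
  have fA: "finite A" using Suc.prems(1) X by (rule finite_subset)
  let ?in = "\<lambda>J. Min A \<notin> J \<and> Max A \<notin> J"
  have "k (Suc n) A = (\<Sum>J | convex_in A J \<and> ?in J. k n (A - J) * r J)" by (rule kS[OF Suc.prems])
  also have "{J. convex_in A J \<and> ?in J} = {J\<in>{J. convex_in A J}. ?in J}" by simp
  also have "(\<Sum>J\<in>\<dots>. k n (A - J) * r J) = (\<Sum>J | convex_in A J. if ?in J then k n (A - J) * r J else 0)"
    by (rule sum.inter_filter[OF finite_convex_in[OF fA]])
  also have "\<dots> = (\<Sum>J | convex_in A J. \<Sum>\<pi> | \<pi> \<in> NC_on (A - J) \<and> card \<pi> = Suc n.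
       fact (Suc n) * hook_weight nests \<pi> * spanning_weight p r A (insert J \<pi>))"
  proof (rule sum.cong[OF refl])
    fix J assume "J \<in> {J. convex_in A J}"
    hence J: "convex_in A J" by simp
    have w: "spanning_weight p r A (insert J \<pi>) = (if ?in J then spanning_weight p r (A - J) \<pi> * r J else 0)"
      if "\<pi> \<in> NC_on (A - J)" "card \<pi> = Suc n" for \<pi>
      by (rule spanning_weight_insert[OF fA Suc.prems(2) J that(1)]) (use that(2) in auto)
    show "(if ?in J then k n (A - J) * r J else 0) =
      (\<Sum>\<pi> | \<pi> \<in> NC_on (A - J) \<and> card \<pi> = Suc n.
       fact (Suc n) * hook_weight nests \<pi> * spanning_weight p r A (insert J \<pi>))"
    proof (cases "?in J")
      case True
      have "A - J \<subseteq> X" using Suc.prems(1) by blast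
      hence "k n (A - J) = (\<Sum>\<pi> | \<pi> \<in> NC_on (A - J) \<and> card \<pi> = Suc n.
         fact (Suc n) * hook_weight nests \<pi> * spanning_weight p r (A - J) \<pi>)"
        using True by (intro Suc.IH Min_Max_remove(1)[OF fA Suc.prems(2)]) auto
      thus ?thesis using True w by (simp add: sum_distrib_right mult.assoc del: fact_Suc)
    next
      case False
      have "spanning_weight p r A (insert J \<pi>) = 0" if "\<pi> \<in> NC_on (A - J)" "card \<pi> = Suc n" for \<pi>
        unfolding w[OF that] if_not_P[OF False] ..
      thus ?thesis unfolding if_not_P[OF False] by (simp del: fact_Suc)
    qed
  qed
  also have "\<dots> = (\<Sum>\<pi> | \<pi> \<in> NC_on A \<and> card \<pi> = Suc (Suc n).
      fact (Suc (Suc n)) * hook_weight nests \<pi> * spanning_weight p r A \<pi>)"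
    by (rule sum_NC_on_remove_leaf[OF fA, symmetric])
  finally show ?case .
qed

lemma sum_over_card_NC_on:
  fixes g :: "nat set set \<Rightarrow> complex"
  assumes "finite A" "card A \<le> N"
  shows "(\<Sum>n\<le>N. (\<Sum>\<pi> | \<pi> \<in> NC_on A \<and> card \<pi> = n. g \<pi>)) = (\<Sum>\<pi>\<in>NC_on A. g \<pi>)"
  by (rule sum.group[where h = g and g = card, OF finite_NC_on[OF assms(1)]])
    (use card_NC_on_le[OF _ assms(1)] assms(2) in \<open>auto intro: order_trans\<close>)

lemma moment_sum_same:
  assumes "finite A"
  shows "moment_sum r r A = (\<Sum>\<pi>\<in>NC_on A. hook_weight nests \<pi> * (\<Prod>V\<in>\<pi>. r V))"
  unfolding moment_sum_def
proof (intro sum.cong refl arg_cong[where f = "(*) (hook_weight nests _)"])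
  fix \<pi> assume "\<pi> \<in> NC_on A"
  hence "finite \<pi>" by (rule NC_onD(1)) (fact assms)
  moreover have "outer_blocks \<pi> \<subseteq> \<pi>" by (auto simp: outer_blocks_def)
  ultimately show "(\<Prod>V\<in>outer_blocks \<pi>. r V) * (\<Prod>V\<in>inner_blocks \<pi>. r V) = (\<Prod>V\<in>\<pi>. r V)"
    unfolding inner_blocks_def by (simp add: prod.subset_diff[of "outer_blocks \<pi>" \<pi>] mult.commute)
qed

text \<open>The one-block partition has hook weight 1 and contributes \<open>p A\<close>; all other partitions have smaller blocks
  (\<open>block_psubset_if_not_top\<close>). This is why moments determine cumulants.\<close>

lemma moment_sum_split_top:
  assumes "finite A" "A \<noteq> {}"
  shows "moment_sum p r A = p A + (\<Sum>\<pi>\<in>NC_on A - {{A}}. hook_weight nests \<pi> *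
     ((\<Prod>V\<in>outer_blocks \<pi>. p V) * (\<Prod>V\<in>inner_blocks \<pi>. r V)))"
proof -
  have "\<not> nests A A" by (auto simp: nests_def)
  hence o: "outer_blocks {A} = {A}" by (auto simp: outer_blocks_def)
  hence "inner_blocks {A} = {}" by (simp add: inner_blocks_def)
  thus ?thesis
    unfolding moment_sum_def sum.remove[OF finite_NC_on[OF assms(1)] singleton_in_NC_on[OF assms(2)]]
    using o hook_weight_singleton[OF assms] by simp
qed

lemma block_psubset_if_not_top:
  assumes "\<pi> \<in> NC_on A - {{A}}" "V \<in> \<pi>"
  shows "V \<subset> A" "V \<noteq> {}"
proof -
  have p: "\<Union>\<pi> = A" "{} \<notin> \<pi>" "\<forall>V\<in>\<pi>. \<forall>W\<in>\<pi>. V \<noteq> W \<longrightarrow> V \<inter> W = {}"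
    using DiffD1[OF assms(1)] by (simp_all add: NC_on_iff)
  show "V \<noteq> {}" using p(2) assms(2) by blast
  have "V \<noteq> A"
  proof
    assume VA: "V = A"
    have "W = A" if "W \<in> \<pi>" for W
    proof (rule ccontr)
      assume "W \<noteq> A"
      hence "W \<inter> A = {}" using p(3)[rule_format, OF that assms(2)] VA by blast
      moreover have "W \<subseteq> A" "W \<noteq> {}" using p(1,2) that by blast+
      ultimately show False by blast
    qed
    hence "\<pi> = {A}" using assms(2) VA by blast
    thus False using assms(1) by blast
  qed
  thus "V \<subset> A" using p(1) assms(2) by blast
qed

lemma moment_sum_determines:
  assumes A: "finite A" "A \<noteq> {}"
    and smaller: "\<And>V. V \<subset> A \<Longrightarrow> V \<noteq> {} \<Longrightarrow> p V = p' V \<and> r V = r' V"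
    and eq: "moment_sum p r A = moment_sum p' r' A"
  shows "p A = p' A"
proof -
  have "(\<Sum>\<pi>\<in>NC_on A - {{A}}. hook_weight nests \<pi> *
     ((\<Prod>V\<in>outer_blocks \<pi>. p V) * (\<Prod>V\<in>inner_blocks \<pi>. r V))) =
    (\<Sum>\<pi>\<in>NC_on A - {{A}}. hook_weight nests \<pi> *
     ((\<Prod>V\<in>outer_blocks \<pi>. p' V) * (\<Prod>V\<in>inner_blocks \<pi>. r' V)))"
  proof (intro sum.cong refl arg_cong2[where f = "(*)"] prod.cong)
    fix \<pi> V assume "\<pi> \<in> NC_on A - {{A}}"
    note D = block_psubset_if_not_top[OF this]
    show "V \<in> outer_blocks \<pi> \<Longrightarrow> p V = p' V" "V \<in> inner_blocks \<pi> \<Longrightarrow> r V = r' V"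
      using D smaller by (auto simp: outer_blocks_def inner_blocks_def)
  qed
  thus ?thesis using eq unfolding moment_sum_split_top[OF A] by simp
qed

section \<open>Cutting off the first outer block\<close>

lemma initial_segment_less:
  assumes "finite A" "convex_in A U" "Min A \<in> U" "u \<in> U" "x \<in> A - U"
  shows "u < x"
proof (rule ccontr)
  assume "\<not> u < x"
  moreover have "u \<noteq> x" using assms(4,5) by blast
  ultimately have "x < u" by simp
  moreover have "Min A \<le> x" "Min A \<noteq> x" using assms(1,3,5) by auto
  ultimately have "Min A < x \<and> x < u" by simp
  moreover have "x \<in> A" using assms(5) by blast
  ultimately have "x \<in> U" using assms(2-4) unfolding convex_in_def by blast
  thus False using assms(5) by blast
qed

lemma noncrossing_union_separated:
  assumes "noncrossing \<pi>" "noncrossing \<sigma>"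
    and "\<And>V W x y. V \<in> \<pi> \<Longrightarrow> W \<in> \<sigma> \<Longrightarrow> x \<in> V \<Longrightarrow> y \<in> W \<Longrightarrow> x < y"
  shows "noncrossing (\<pi> \<union> \<sigma>)"
  unfolding noncrossing_def
proof (intro ballI impI notI)
  fix V W assume VW: "V \<in> \<pi> \<union> \<sigma>" "W \<in> \<pi> \<union> \<sigma>" "V \<noteq> W"
  assume ex: "\<exists>a b c d. a < b \<and> b < c \<and> c < d \<and> a \<in> V \<and> c \<in> V \<and> b \<in> W \<and> d \<in> W"
  then obtain a b c d where h: "a < b" "b < c" "c < d" "a \<in> V" "c \<in> V" "b \<in> W" "d \<in> W" by blast
  consider "V \<in> \<pi>" "W \<in> \<pi>" | "V \<in> \<pi>" "W \<in> \<sigma>" | "V \<in> \<sigma>" "W \<in> \<pi>" | "V \<in> \<sigma>" "W \<in> \<sigma>"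
    using VW(1,2) by blast
  thus False
  proof cases
    case 1
    show False
      by (rule notE[OF mp[OF assms(1)[unfolded noncrossing_def, THEN bspec, OF 1(1), THEN bspec, OF 1(2)] VW(3)] ex])
  next
    case 2
    from assms(3)[OF 2 h(5,6)] h(2) show False by simp
  next
    case 3
    from assms(3)[OF 3(2,1) h(6,4)] h(1) show False by simp
  next
    case 4
    show False
      by (rule notE[OF mp[OF assms(2)[unfolded noncrossing_def, THEN bspec, OF 4(1), THEN bspec, OF 4(2)] VW(3)] ex])
  qed
qed

text \<open>Placing a partition \<open>\<sigma>\<close> of \<open>A - U\<close> to the right of a partition \<open>\<pi>\<close> of the initial segment \<open>U\<close> creates neither
  crossings nor nestings, so hook weights multiply. On \<open>U\<close> the block with both ends encloses all others and
  is the only outer one. The last three equations recover \<open>U\<close> and both partitions from the union.\<close>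

lemma NC_on_join:
  assumes A: "finite A" and U: "convex_in A U" "Min A \<in> U"
    and \<pi>: "\<pi> \<in> NC_on U" and V: "V \<in> \<pi>" "Min U \<in> V" "Max U \<in> V" and \<sigma>: "\<sigma> \<in> NC_on (A - U)"
  shows "\<pi> \<union> \<sigma> \<in> NC_on A"
    and "hook_weight nests (\<pi> \<union> \<sigma>) = hook_weight nests \<pi> * hook_weight nests \<sigma>"
    and "outer_blocks (\<pi> \<union> \<sigma>) = insert V (outer_blocks \<sigma>)"
    and "inner_blocks (\<pi> \<union> \<sigma>) = (\<pi> - {V}) \<union> inner_blocks \<sigma>"
    and "{B \<in> \<pi> \<union> \<sigma>. B \<subseteq> U} = \<pi>" and "\<pi> \<inter> \<sigma> = {}"
    and "{a\<in>A. \<exists>V\<in>\<pi> \<union> \<sigma>. Min A \<in> V \<and> a \<le> Max V} = U"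
proof -
  have UA: "U \<subseteq> A" "U \<noteq> {}" using U(1) by (simp_all add: convex_in_def)
  have fU: "finite U" using UA(1) A by (rule finite_subset)
  note D = NC_onD[OF \<pi> fU] and E = NC_onD[OF \<sigma> finite_Diff[OF A]]
  have less: "u < x" if "u \<in> U" "x \<in> A - U" for u x
    using initial_segment_less[OF A U that] .
  have sep: "x < y" if "B \<in> \<pi>" "C \<in> \<sigma>" "x \<in> B" "y \<in> C" for B C x y
    using less D(4)[OF that(1)] E(4)[OF that(2)] that(3,4) by blast
  show disj: "\<pi> \<inter> \<sigma> = {}" using sep D(3) by fastforce
  have nn: "\<not> nests B C \<and> \<not> nests C B" if BC: "B \<in> \<pi>" "C \<in> \<sigma>" for B C
    using D(3)[OF BC(1)] E(3)[OF BC(2)] sep[OF BC] unfolding nests_def by (metis all_not_in_conv less_asym)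
  have BC: "B \<inter> C = {}" if "B \<in> \<pi>" "C \<in> \<sigma>" for B C using sep[OF that] by blast
  show "\<pi> \<union> \<sigma> \<in> NC_on A"
  proof -
    have "\<Union>(\<pi> \<union> \<sigma>) = A" using D(5) E(5) UA(1) by blast
    moreover have "{} \<notin> \<pi> \<union> \<sigma>" using D(3) E(3) by blast
    moreover have "\<forall>V\<in>\<pi> \<union> \<sigma>. \<forall>W\<in>\<pi> \<union> \<sigma>. V \<noteq> W \<longrightarrow> V \<inter> W = {}"
    proof (intro ballI impI)
      fix B C assume "B \<in> \<pi> \<union> \<sigma>" "C \<in> \<pi> \<union> \<sigma>" "B \<noteq> C"
      thus "B \<inter> C = {}" using D(6)[of B C] E(6)[of B C] BC[of B C] BC[of C B] by blast
    qed
    moreover have "noncrossing (\<pi> \<union> \<sigma>)"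
      by (rule noncrossing_union_separated) (use \<pi> \<sigma> sep in \<open>simp_all add: NC_on_iff\<close>)
    ultimately show ?thesis by (simp only: NC_on_iff) blast
  qed
  show "hook_weight nests (\<pi> \<union> \<sigma>) = hook_weight nests \<pi> * hook_weight nests \<sigma>"
    by (rule hook_weight_Un[OF D(1) E(1) disj]) (use nn in blast)
  have MU: "Min U = Min A"
    using U(2) A UA by (metis Min_antimono Min_le antisym fU)
  have V_top: "\<not> nests W V" if "W \<in> \<pi>" for W
  proof
    assume "nests W V"
    then obtain a where "a \<in> W" "a < Min U" using V(2) by (auto simp: nests_def)
    moreover have "Min U \<le> a" using \<open>a \<in> W\<close> D(4)[OF that] fU by auto
    ultimately show False by simp
  qed
  have V_below: "nests V B" if B: "B \<in> \<pi>" "B \<noteq> V" for B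
    unfolding nests_def
  proof (rule bexI[OF _ V(2)], rule bexI[OF _ V(3)], rule ballI)
    fix c assume c: "c \<in> B"
    have "c \<in> U" using c D(4)[OF B(1)] by blast
    hence "Min U \<le> c" "c \<le> Max U" using fU by auto
    moreover have "c \<noteq> Min U" "c \<noteq> Max U" using D(6)[OF B(1) V(1) c] V(2,3) B(2) by blast+
    ultimately show "Min U < c \<and> c < Max U" by linarith
  qed
  show outer: "outer_blocks (\<pi> \<union> \<sigma>) = insert V (outer_blocks \<sigma>)"
  proof (intro equalityI subsetI)
    fix B assume "B \<in> outer_blocks (\<pi> \<union> \<sigma>)"
    thus "B \<in> insert V (outer_blocks \<sigma>)"
      using V_below V(1) by (auto simp: outer_blocks_def)
  next
    fix B assume "B \<in> insert V (outer_blocks \<sigma>)"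
    thus "B \<in> outer_blocks (\<pi> \<union> \<sigma>)"
      using V_top V(1) nn by (auto simp: outer_blocks_def)
  qed
  show "inner_blocks (\<pi> \<union> \<sigma>) = (\<pi> - {V}) \<union> inner_blocks \<sigma>"
    using disj V(1) unfolding inner_blocks_def outer by (auto simp: outer_blocks_def)
  show "{B \<in> \<pi> \<union> \<sigma>. B \<subseteq> U} = \<pi>"
    using D(4) E(3,4) by blast
  show "{a\<in>A. \<exists>V\<in>\<pi> \<union> \<sigma>. Min A \<in> V \<and> a \<le> Max V} = U"
  proof (intro equalityI subsetI)
    fix a assume "a \<in> {a\<in>A. \<exists>V\<in>\<pi> \<union> \<sigma>. Min A \<in> V \<and> a \<le> Max V}"
    then obtain W where W: "a \<in> A" "W \<in> \<pi> \<union> \<sigma>" "Min A \<in> W" "a \<le> Max W" by blast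
    have "W \<in> \<pi>" using W(2,3) E(4)[of W] U(2) by blast
    hence "Max W \<in> U" using D(2-4) Max_in by blast
    show "a \<in> U"
    proof (rule ccontr)
      assume "a \<notin> U"
      hence "Max W < a" using less \<open>Max W \<in> U\<close> W(1) by blast
      thus False using W(4) by simp
    qed
  next
    fix a assume a: "a \<in> U"
    have "Max V = Max U"
      using V(1,3) D(2,4) fU by (metis Max_ge Max_mono antisym empty_iff)
    hence "a \<le> Max V" using a fU by simp
    thus "a \<in> {a\<in>A. \<exists>V\<in>\<pi> \<union> \<sigma>. Min A \<in> V \<and> a \<le> Max V}"
      using V(1,2) MU a UA(1) by auto
  qed
qed

text \<open>The inverse of \<open>NC_on_join\<close>: \<open>U\<close> ends at the last element of the block \<open>V\<close> of the first position. A block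
  on both sides of this cut would cross \<open>V\<close>.\<close>

lemma NC_on_cut:
  assumes A: "finite A" "A \<noteq> {}" and \<pi>: "\<pi> \<in> NC_on A"
  defines "U \<equiv> {a\<in>A. \<exists>V\<in>\<pi>. Min A \<in> V \<and> a \<le> Max V}"
  shows "convex_in A U" "Min A \<in> U"
    and "{B\<in>\<pi>. B \<subseteq> U} \<in> NC_on U" and "{B\<in>\<pi>. \<not> B \<subseteq> U} \<in> NC_on (A - U)"
    and "\<exists>V\<in>{B\<in>\<pi>. B \<subseteq> U}. Min U \<in> V \<and> Max U \<in> V"
proof -
  note D = NC_onD[OF \<pi> A(1)]
  have MA: "Min A \<in> A" using A by simp
  then obtain V where V: "V \<in> \<pi>" "Min A \<in> V" using D(5) by blast
  have U: "U = {a\<in>A. a \<le> Max V}"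
    unfolding U_def using V D(6)[OF _ V(1) _ V(2)] by blast
  have fV: "finite V" "V \<noteq> {}" "V \<subseteq> A" using D(2-4)[OF V(1)] .
  have MV: "Max V \<in> V" using fV by simp
  have fU: "finite U" unfolding U using A(1) by simp
  show MU: "Min A \<in> U" unfolding U using MA V(2) fV by simp
  show "convex_in A U"
    unfolding convex_in_def U using MU U by auto
  have "Max U = Max V" by (rule Max_eqI[OF fU]) (use MV fV(3) in \<open>auto simp: U\<close>)
  moreover have "Min U = Min A" by (rule Min_eqI[OF fU]) (use MU A(1) in \<open>auto simp: U\<close>)
  moreover have "V \<subseteq> U" unfolding U using fV by auto
  ultimately show "\<exists>V\<in>{B\<in>\<pi>. B \<subseteq> U}. Min U \<in> V \<and> Max U \<in> V"
    using V MV by auto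
  have inside: "B \<subseteq> U" if B: "B \<in> \<pi>" and b: "b \<in> B" "b \<in> U" for B b
  proof (rule ccontr)
    assume "\<not> B \<subseteq> U"
    then obtain d where d: "d \<in> B" "d \<notin> U" by blast
    hence dV: "Max V < d" using D(4)[OF B] by (auto simp: U)
    hence BV: "B \<noteq> V" using d(1) fV by (meson Max_ge leD)
    have "b \<noteq> Min A" "b \<noteq> Max V" using D(6)[OF B V(1) b(1)] BV V(2) MV by auto
    moreover have "Min A \<le> b" "b \<le> Max V" using b(2) A(1) by (auto simp: U)
    ultimately have "Min A < b" "b < Max V" by simp_all
    thus False using D(7)[OF V(1) B V(2) b(1) MV d(1)] dV BV by blast
  qed
  have nc: "noncrossing \<pi>" using \<pi> by (simp add: NC_on_iff)
  have "\<Union>{B\<in>\<pi>. B \<subseteq> U} = U"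
  proof
    show "U \<subseteq> \<Union>{B\<in>\<pi>. B \<subseteq> U}"
    proof
      fix u assume u: "u \<in> U"
      hence "u \<in> \<Union>\<pi>" unfolding D(5) U by simp
      thus "u \<in> \<Union>{B\<in>\<pi>. B \<subseteq> U}" using inside u by blast
    qed
  qed blast
  thus "{B\<in>\<pi>. B \<subseteq> U} \<in> NC_on U"
    using \<pi> noncrossing_subset[OF nc, of "{B\<in>\<pi>. B \<subseteq> U}"] by (simp add: NC_on_iff)
  have "\<Union>{B\<in>\<pi>. \<not> B \<subseteq> U} = A - U"
  proof
    show "\<Union>{B\<in>\<pi>. \<not> B \<subseteq> U} \<subseteq> A - U" using D(4) inside by blast
    show "A - U \<subseteq> \<Union>{B\<in>\<pi>. \<not> B \<subseteq> U}"
    proof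
      fix u assume u: "u \<in> A - U"
      hence "u \<in> \<Union>\<pi>" unfolding D(5) by simp
      thus "u \<in> \<Union>{B\<in>\<pi>. \<not> B \<subseteq> U}" using u by blast
    qed
  qed
  thus "{B\<in>\<pi>. \<not> B \<subseteq> U} \<in> NC_on (A - U)"
    using \<pi> noncrossing_subset[OF nc, of "{B\<in>\<pi>. \<not> B \<subseteq> U}"] by (simp add: NC_on_iff)
qed

definition spanned_NC_on :: "nat set \<Rightarrow> nat set set set" where
  "spanned_NC_on U = {\<pi>\<in>NC_on U. \<exists>V\<in>\<pi>. Min U \<in> V \<and> Max U \<in> V}"

lemma irreducible_sum_spanned:
  assumes "finite U"
  shows "irreducible_sum p r U = (\<Sum>\<pi>\<in>spanned_NC_on U. hook_weight nests \<pi> * spanning_weight p r U \<pi>)"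
  unfolding irreducible_sum_def
proof (rule sum.mono_neutral_right[OF finite_NC_on[OF assms]])
  show "\<forall>\<pi>\<in>NC_on U - spanned_NC_on U. hook_weight nests \<pi> * spanning_weight p r U \<pi> = 0"
  proof
    fix \<pi> assume "\<pi> \<in> NC_on U - spanned_NC_on U"
    hence S: "{V. V \<in> \<pi> \<and> Min U \<in> V \<and> Max U \<in> V} = {}" by (simp add: spanned_NC_on_def)
    show "hook_weight nests \<pi> * spanning_weight p r U \<pi> = 0" unfolding spanning_weight_def S by simp
  qed
qed (auto simp: spanned_NC_on_def)

lemma moment_sum_prefix_recursion:
  assumes A: "finite A" "A \<noteq> {}"
  shows "moment_sum p r A =
    (\<Sum>U | convex_in A U \<and> Min A \<in> U. irreducible_sum p r U * moment_sum p r (A - U))"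
proof -
  let ?w = "\<lambda>\<pi>. (\<Prod>V\<in>outer_blocks \<pi>. p V) * (\<Prod>V\<in>inner_blocks \<pi>. r V)"
  let ?S = "{U. convex_in A U \<and> Min A \<in> U}"
  let ?T = "\<lambda>U. spanned_NC_on U \<times> NC_on (A - U)"
  let ?cut = "\<lambda>\<pi>. {a\<in>A. \<exists>V\<in>\<pi>. Min A \<in> V \<and> a \<le> Max V}"
  have fS: "finite ?S" by (rule finite_subset[OF _ finite_convex_in[OF A(1)]]) blast
  have fU: "finite U" if "U \<in> ?S" for U
    using that by (intro finite_subset[OF _ A(1)]) (simp add: convex_in_def)
  have fT: "finite (?T U)" if "U \<in> ?S" for U
  proof -
    have "spanned_NC_on U \<subseteq> NC_on U" by (auto simp: spanned_NC_on_def)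
    hence "finite (spanned_NC_on U)" using finite_NC_on[OF fU[OF that]] by (rule finite_subset)
    thus ?thesis using finite_NC_on[OF finite_Diff[OF A(1)]] by blast
  qed
  let ?g = "\<lambda>(U, \<pi>, \<sigma>). (hook_weight nests \<pi> * spanning_weight p r U \<pi>) * (hook_weight nests \<sigma> * ?w \<sigma>)"
  have "(\<Sum>U\<in>?S. irreducible_sum p r U * moment_sum p r (A - U)) =
      (\<Sum>U\<in>?S. \<Sum>q\<in>?T U. ?g (U, q))"
  proof (rule sum.cong[OF refl])
    fix U assume U: "U \<in> ?S"
    show "irreducible_sum p r U * moment_sum p r (A - U) = (\<Sum>q\<in>?T U. ?g (U, q))"
      unfolding irreducible_sum_spanned[OF fU[OF U]] moment_sum_def sum_product sum.cartesian_product
      by (simp add: case_prod_beta)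
  qed
  also have "\<dots> = (\<Sum>t\<in>Sigma ?S ?T. ?g t)"
    using fS fT by (subst sum.Sigma) (auto simp: case_prod_beta)
  also have "\<dots> = (\<Sum>\<pi>\<in>NC_on A. hook_weight nests \<pi> * ?w \<pi>)"
  proof (rule sum.reindex_bij_witness[of _
      "\<lambda>\<pi>. (?cut \<pi>, {B\<in>\<pi>. B \<subseteq> ?cut \<pi>}, {B\<in>\<pi>. \<not> B \<subseteq> ?cut \<pi>})" "\<lambda>(U, \<pi>, \<sigma>). \<pi> \<union> \<sigma>"])
    fix t assume "t \<in> Sigma ?S ?T"
    then obtain U \<pi> \<sigma> where t: "t = (U, \<pi>, \<sigma>)" "convex_in A U" "Min A \<in> U" "\<pi> \<in> spanned_NC_on U" "\<sigma> \<in> NC_on (A - U)"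
      by auto
    then obtain V where V: "\<pi> \<in> NC_on U" "V \<in> \<pi>" "Min U \<in> V" "Max U \<in> V" by (auto simp: spanned_NC_on_def)
    have fU: "finite U" using t(2) by (intro finite_subset[OF _ A(1)]) (simp add: convex_in_def)
    note D = NC_onD[OF V(1) fU] and E = NC_onD[OF t(5) finite_Diff[OF A(1)]]
    note J = NC_on_join[OF A(1) t(2,3) V t(5)]
    have "{B \<in> \<pi> \<union> \<sigma>. \<not> B \<subseteq> U} = \<sigma>" using J(5,6) by blast
    thus "(case case t of (U, \<pi>, \<sigma>) \<Rightarrow> \<pi> \<union> \<sigma> of \<pi> \<Rightarrow>
        (?cut \<pi>, {B\<in>\<pi>. B \<subseteq> ?cut \<pi>}, {B\<in>\<pi>. \<not> B \<subseteq> ?cut \<pi>})) = t"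
      by (simp only: t(1) prod.case J(5,7))
    show "(case t of (U, \<pi>, \<sigma>) \<Rightarrow> \<pi> \<union> \<sigma>) \<in> NC_on A" using J(1) t(1) by simp
    have "{W. W \<in> \<pi> \<and> Min U \<in> W \<and> Max U \<in> W} = {V}" using V D(6) by blast
    hence w: "spanning_weight p r U \<pi> = p V * (\<Prod>W\<in>\<pi> - {V}. r W)" by (simp add: spanning_weight_def)
    have os: "outer_blocks \<sigma> \<subseteq> \<sigma>" "inner_blocks \<sigma> \<subseteq> \<sigma>" by (auto simp: outer_blocks_def inner_blocks_def)
    have fin: "finite (outer_blocks \<sigma>)" "finite (inner_blocks \<sigma>)" "finite (\<pi> - {V})"
      using os E(1) D(1) by (auto intro: finite_subset)
    have o: "(\<Prod>W\<in>outer_blocks (\<pi> \<union> \<sigma>). p W) = p V * (\<Prod>W\<in>outer_blocks \<sigma>. p W)"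
      unfolding J(3) using J(6) V(2) os(1) fin(1) by (subst prod.insert) auto
    have i: "(\<Prod>W\<in>inner_blocks (\<pi> \<union> \<sigma>). r W) = (\<Prod>W\<in>\<pi> - {V}. r W) * (\<Prod>W\<in>inner_blocks \<sigma>. r W)"
      unfolding J(4) by (rule prod.union_disjoint[OF fin(3,2)]) (use J(6) os(2) in blast)
    show "hook_weight nests (case t of (U, \<pi>, \<sigma>) \<Rightarrow> \<pi> \<union> \<sigma>) *
       ((\<Prod>V\<in>outer_blocks (case t of (U, \<pi>, \<sigma>) \<Rightarrow> \<pi> \<union> \<sigma>). p V) *
        (\<Prod>V\<in>inner_blocks (case t of (U, \<pi>, \<sigma>) \<Rightarrow> \<pi> \<union> \<sigma>). r V)) = ?g t"
      unfolding t(1) prod.case J(2) o i w by (simp add: algebra_simps)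
  next
    fix \<pi> assume \<pi>: "\<pi> \<in> NC_on A"
    note C = NC_on_cut[OF A \<pi>]
    show "(?cut \<pi>, {B\<in>\<pi>. B \<subseteq> ?cut \<pi>}, {B\<in>\<pi>. \<not> B \<subseteq> ?cut \<pi>}) \<in> Sigma ?S ?T"
      using C unfolding spanned_NC_on_def by (simp only: mem_Sigma_iff mem_Collect_eq simp_thms)
    show "(case (?cut \<pi>, {B\<in>\<pi>. B \<subseteq> ?cut \<pi>}, {B\<in>\<pi>. \<not> B \<subseteq> ?cut \<pi>}) of (U, \<pi>, \<sigma>) \<Rightarrow> \<pi> \<union> \<sigma>) = \<pi>"
      unfolding prod.case by blast
  qed
  finally show ?thesis by (simp add: moment_sum_def)
qed

section \<open>Products with an infinitesimal character on words\<close>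

text \<open>The empty word is the unit; \<open>bars [[]]\<close> would be 0.\<close>

definition word :: "'a::complex_vect list \<Rightarrow> 'a dta" where
  "word u = (if u = [] then 1 else bars [u])"

text \<open>The condition of an infinitesimal character tested on tensors of words, the elements on which the
  coproducts have an explicit form.\<close>

definition inf_char_on_words :: "('a::complex_vect dta \<Rightarrow> complex) \<Rightarrow> bool" where
  "inf_char_on_words f \<longleftrightarrow> clinear f \<and> f 1 = 0 \<and>
     (\<forall>ws. [] \<notin> set ws \<longrightarrow> length ws \<ge> 2 \<longrightarrow> f (bars ws) = 0)"

abbreviation pairing :: "('a::complex_vect dta \<Rightarrow> complex) \<Rightarrow> ('a dta \<Rightarrow> complex) \<Rightarrow> ('a dta, 'a dta) tens \<Rightarrow> complex" where
  "pairing f g \<equiv> tens_lift (\<lambda>s t. f s * g t)"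

lemma inf_char_on_words_if_infinitesimal: "infinitesimal_character f \<Longrightarrow> inf_char_on_words f"
  by (simp add: infinitesimal_character_def inf_char_on_words_def bars_def)

lemma bars_Nil: "bars [] = 1"
  by (simp add: bars_def tpure_Nil)

lemma bars_append: "bars (us @ vs) = bars us * bars vs"
  by (simp add: bars_def tpure_append)

lemma bilinear2_times:
  assumes "clinear f" "clinear g"
  shows "bilinear2 (\<lambda>s t. f s * g t :: complex)"
  unfolding bilinear2_def
  by (intro conjI allI clinearI; simp add: clinear_add[OF assms(1)] clinear_add[OF assms(2)]
      clinear_scale[OF assms(1)] clinear_scale[OF assms(2)] scaleC_complex_def algebra_simps)

lemma pairing_tens: "clinear f \<Longrightarrow> clinear g \<Longrightarrow> pairing f g (x \<otimes> y) = f x * g y"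
  by (simp add: tens_lift_tens bilinear2_times)

lemma clinear_pairing: "clinear f \<Longrightarrow> clinear g \<Longrightarrow> clinear (pairing f g)"
  by (simp add: clinear_tens_lift bilinear2_times)

lemma clinear_conv: "clinear f \<Longrightarrow> clinear g \<Longrightarrow> clinear (conv f g)"
  and clinear_hs_prec: "clinear f \<Longrightarrow> clinear g \<Longrightarrow> clinear (hs_prec f g)"
  and clinear_hs_succ: "clinear f \<Longrightarrow> clinear g \<Longrightarrow> clinear (hs_succ f g)"
  unfolding conv_def[abs_def] hs_prec_def[abs_def] hs_succ_def[abs_def]
  by (simp_all add: clinear_compose[OF clinear_coproduct(1) clinear_pairing]
      clinear_compose[OF clinear_coproduct(2) clinear_pairing] clinear_compose[OF clinear_coproduct(3) clinear_pairing])

lemma clinear_diff_form: "clinear f \<Longrightarrow> clinear g \<Longrightarrow> clinear (\<lambda>x. f x - g x :: complex)"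
  by (rule clinearI) (simp_all add: clinear_add clinear_scale scaleC_complex_def algebra_simps)

lemma multilinear_counit: "multilinear (\<lambda>vs :: 'v::complex_vect list. if vs = [] then 1 else 0 :: complex)"
  by (rule multilinearI) (simp_all add: scaleC_complex_def)

lemma clinear_counit: "clinear counit"
  unfolding counit_def by (rule clinear_talg_lift[OF multilinear_counit])

lemma counit_bars: "counit (bars ws) = (if ws = [] then 1 else 0)"
  using talg_lift_tpure[OF multilinear_counit, of "map tword ws"] by (simp add: counit_def bars_def)

lemma coproduct_one:
  "coproduct (1 :: 'a::complex_vect dta) = 1 \<otimes> 1"
  "coproduct_prec (1 :: 'a dta) = 0" "coproduct_succ (1 :: 'a dta) = 0"
proof -
  have "coproduct 1 = (1 :: ('a dta, 'a dta) tens)"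
    using coproduct_bars[of "[] :: 'a list list"] by (simp add: bars_Nil)
  moreover have "(1 :: ('a dta, 'a dta) tens) = 1 \<otimes> 1" by transfer (simp add: cvec.span_zero)
  ultimately show "coproduct 1 = (1 :: 'a dta) \<otimes> (1 :: 'a dta)" by simp
  show "coproduct_prec 1 = (0 :: ('a dta, 'a dta) tens)"
    unfolding coproduct_prec_def tpure_Nil[symmetric]
    by (subst talg_lift_tpure) (simp_all add: multilinear_half clinear_tplus_lift multilinear_coproduct_word)
  show "coproduct_succ 1 = (0 :: ('a dta, 'a dta) tens)"
    unfolding coproduct_succ_def tpure_Nil[symmetric]
    by (subst talg_lift_tpure) (simp_all add: multilinear_half clinear_tplus_lift multilinear_coproduct_word)
qed

lemma products_at_one:
  assumes "clinear f" "clinear g"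
  shows "conv f g 1 = f 1 * g 1" "hs_prec f g 1 = 0" "hs_succ f g 1 = 0"
  unfolding conv_def hs_prec_def hs_succ_def coproduct_one
  using assms by (simp_all add: pairing_tens clinear_0[OF clinear_pairing])

lemma convex_in_lessThan_eq_interval:
  assumes "convex_in {..<n} K"
  shows "K = {Min K..Max K}"
proof -
  have K: "K \<noteq> {}" "K \<subseteq> {..<n}" using assms by (simp_all add: convex_in_def)
  have fK: "finite K" using K(2) finite_lessThan by (rule finite_subset)
  have "x \<in> K" if x: "Min K \<le> x" "x \<le> Max K" for x
  proof (cases "x = Min K \<or> x = Max K")
    case True
    thus ?thesis using Min_in[OF fK K(1)] Max_in[OF fK K(1)] by blast
  next
    case False
    have "x < n" using x(2) Max_in[OF fK K(1)] K(2) by auto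
    thus ?thesis using assms x False Min_in[OF fK K(1)] Max_in[OF fK K(1)]
      unfolding convex_in_def by (metis lessThan_iff order_le_imp_less_or_eq)
  qed
  moreover have "K \<subseteq> {Min K..Max K}" using fK by auto
  ultimately show ?thesis by (intro equalityI subsetI) auto
qed

lemma components_list_convex:
  assumes "convex_in {..<n} K"
  shows "components_list K = [K]"
proof -
  have K: "K \<noteq> {}" "K \<subseteq> {..<n}" using assms by (simp_all add: convex_in_def)
  have fK: "finite K" using K(2) finite_lessThan by (rule finite_subset)
  obtain a b where ab: "K = {a..b}" using convex_in_lessThan_eq_interval[OF assms] by blast
  have "interval_components K = {K}"
  proof (intro equalityI subsetI)
    fix I assume "I \<in> interval_components K"
    hence I: "I \<subseteq> K" "\<forall>a b. I \<subseteq> {a..b} \<and> {a..b} \<subseteq> K \<longrightarrow> {a..b} = I"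
      unfolding interval_components_def mem_Collect_eq by simp_all
    have "I \<subseteq> {a..b} \<and> {a..b} \<subseteq> K" using I(1) ab by simp
    hence "{a..b} = I" using I(2) by blast
    thus "I \<in> {K}" using ab by simp
  next
    fix I assume "I \<in> {K}"
    hence I: "I = K" by simp
    have "\<exists>a b. K = {a..b}" using ab by blast
    moreover have "\<forall>c d. K \<subseteq> {c..d} \<and> {c..d} \<subseteq> K \<longrightarrow> {c..d} = K" by (simp add: set_eq_subset)
    ultimately show "I \<in> interval_components K"
      unfolding I interval_components_def mem_Collect_eq using K(1) by simp
  qed
  hence s: "set (components_list K) = {K}" using components_list(1)[OF fK] by simp
  hence "length (components_list K) = 1" using distinct_card[OF components_list(2)[OF fK]] by simp
  thus ?thesis using s by (cases "components_list K") auto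
qed

lemma components_list_not_convex:
  assumes "K \<subseteq> {..<n}" "\<not> convex_in {..<n} K"
  shows "length (components_list K) \<noteq> 1"
proof
  assume "length (components_list K) = 1"
  then obtain I where I: "components_list K = [I]" by (auto simp: length_Suc_conv)
  have fK: "finite K" using assms(1) finite_lessThan by (rule finite_subset)
  have c: "interval_components K = {I}" using components_list(1)[OF fK] I by simp
  have "K \<subseteq> I" using interval_components_cover[OF fK] c by (metis singletonD subsetI)
  moreover have "I \<in> interval_components K" using c by simp
  hence "I \<subseteq> K" "I \<noteq> {}" "\<exists>a b. I = {a..b}"
    unfolding interval_components_def mem_Collect_eq by simp_all
  ultimately obtain a b where "K = {a..b}" "K \<noteq> {}" by blast
  hence "convex_in {..<n} K" using assms(1) unfolding convex_in_def by auto
  thus False using assms(2) by blast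
qed

lemma nths_eq_Nil_iff: "S \<subseteq> {..<length w} \<Longrightarrow> nths w S = [] \<longleftrightarrow> S = {}"
  by (auto simp: length_0_conv[symmetric] length_nths simp del: length_0_conv)

lemma components_nonempty_words:
  assumes "K \<subseteq> {..<length w}"
  shows "[] \<notin> set (map (nths w) (components_list K))"
proof
  have fK: "finite K" using assms finite_lessThan by (rule finite_subset)
  assume "[] \<in> set (map (nths w) (components_list K))"
  then obtain I where "I \<in> interval_components K" "nths w I = []"
    using components_list(1)[OF fK] by auto
  moreover from this have "I \<subseteq> {..<length w}" "I \<noteq> {}" using assms by (auto simp: interval_components_def)
  ultimately show False by (simp add: nths_eq_Nil_iff)
qed

lemma components_list_eq_Nil_iff:
  assumes "finite K"
  shows "components_list K = [] \<longleftrightarrow> K = {}"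
proof
  assume "components_list K = []"
  hence "interval_components K = {}" using components_list(1)[OF assms] by simp
  thus "K = {}" using interval_components_cover[OF assms] by blast
next
  assume "K = {}"
  hence "interval_components K = {}" by (auto simp: interval_components_def)
  thus "components_list K = []" using components_list(1)[OF assms] by simp
qed

text \<open>An infinitesimal character vanishes on zero and on two or more components, so the positions in \<open>K\<close> have to
  form a single interval.\<close>

lemma inf_char_components:
  assumes g: "inf_char_on_words g" and K: "K \<subseteq> {..<length w}"
  shows "g (bars (map (nths w) (components_list K))) =
    (if convex_in {..<length w} K then g (word (nths w K)) else 0)"
proof (cases "convex_in {..<length w} K")
  case True
  hence "K \<noteq> {}" by (simp add: convex_in_def)
  hence "nths w K \<noteq> []" using K by (simp add: nths_eq_Nil_iff)
  thus ?thesis using True by (simp add: components_list_convex word_def)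
next
  case False
  have l: "length (components_list K) \<noteq> 1" by (rule components_list_not_convex[OF K False])
  have "g (bars (map (nths w) (components_list K))) = 0"
  proof (cases "components_list K = []")
    case True
    thus ?thesis using g by (simp add: bars_Nil inf_char_on_words_def)
  next
    case False
    hence "length (components_list K) \<ge> 2" using l by (cases "components_list K") (auto simp: Suc_le_eq)
    thus ?thesis using g components_nonempty_words[OF K] unfolding inf_char_on_words_def by simp
  qed
  thus ?thesis using False by simp
qed

lemma pairing_coproduct_term:
  assumes "clinear f" "clinear g"
  shows "pairing f g (coproduct_term w S) =
    f (word (nths w S)) * g (bars (map (nths w) (components_list ({..<length w} - S))))"
  unfolding coproduct_term_def pairing_tens[OF assms] word_def ..

text \<open>The predicate \<open>Q\<close> on the removed positions \<open>K\<close> makes one statement serve the coproduct and both of its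
  halves.\<close>

lemma pairing_sum_coproduct_term:
  assumes f: "clinear f" and g: "inf_char_on_words g"
  shows "pairing f g (\<Sum>S | S \<subseteq> {..<length w} \<and> Q ({..<length w} - S). coproduct_term w S) =
    (\<Sum>K | convex_in {..<length w} K \<and> Q K. f (word (nths w ({..<length w} - K))) * g (word (nths w K)))"
proof -
  let ?N = "{..<length w}"
  have gl: "clinear g" using g by (simp add: inf_char_on_words_def)
  have "pairing f g (\<Sum>S | S \<subseteq> ?N \<and> Q (?N - S). coproduct_term w S) =
    (\<Sum>S | S \<subseteq> ?N \<and> Q (?N - S). f (word (nths w S)) *
      (if convex_in ?N (?N - S) then g (word (nths w (?N - S))) else 0))"
    unfolding clinear_sum[OF clinear_pairing[OF f gl]] pairing_coproduct_term[OF f gl]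
    by (intro sum.cong refl) (subst inf_char_components[OF g], auto)
  also have "\<dots> = (\<Sum>K | K \<subseteq> ?N \<and> Q K. f (word (nths w (?N - K))) *
      (if convex_in ?N K then g (word (nths w K)) else 0))"
    by (rule sum.reindex_bij_witness[of _ "\<lambda>K. ?N - K" "\<lambda>K. ?N - K"]) (auto simp: double_diff)
  also have "\<dots> = (\<Sum>K | convex_in ?N K \<and> Q K. f (word (nths w (?N - K))) * g (word (nths w K)))"
  proof (rule sum.mono_neutral_cong_right)
    show "finite {K. K \<subseteq> ?N \<and> Q K}" by (rule finite_subset[of _ "Pow ?N"]) auto
    have "K \<subseteq> ?N" if "convex_in ?N K" for K using that by (simp add: convex_in_def)
    thus "{K. convex_in ?N K \<and> Q K} \<subseteq> {K. K \<subseteq> ?N \<and> Q K}" by blast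
  qed auto
  finally show ?thesis .
qed

lemma products_on_words:
  assumes f: "clinear f" and g: "inf_char_on_words g"
  shows "conv f g (word w) = (\<Sum>K | convex_in {..<length w} K.
      f (word (nths w ({..<length w} - K))) * g (word (nths w K)))"
    and "hs_prec f g (word w) = (\<Sum>K | convex_in {..<length w} K \<and> 0 \<notin> K.
      f (word (nths w ({..<length w} - K))) * g (word (nths w K)))"
    and "hs_succ f g (word w) = (\<Sum>K | convex_in {..<length w} K \<and> 0 \<in> K.
      f (word (nths w ({..<length w} - K))) * g (word (nths w K)))"
proof -
  let ?N = "{..<length w}"
  have gl: "clinear g" "g 1 = 0" using g by (simp_all add: inf_char_on_words_def)
  have e: "\<not> convex_in {} K" for K by (simp add: convex_in_def)
  show "conv f g (word w) = (\<Sum>K | convex_in ?N K.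
      f (word (nths w (?N - K))) * g (word (nths w K)))"
  proof (cases "w = []")
    case True
    thus ?thesis using gl(2) by (simp add: word_def products_at_one[OF f gl(1)] e)
  next
    case False
    have "conv f g (word w) = pairing f g (\<Sum>S | S \<subseteq> ?N \<and> True. coproduct_term w S)"
      using False coproduct_bars[of "[w]"] by (simp add: word_def conv_def coproduct_word_def Pow_def)
    thus ?thesis using pairing_sum_coproduct_term[OF f g, of w "\<lambda>_. True"] by simp
  qed
  show "hs_prec f g (word w) = (\<Sum>K | convex_in ?N K \<and> 0 \<notin> K.
      f (word (nths w (?N - K))) * g (word (nths w K)))"
  proof (cases "w = []")
    case True
    thus ?thesis by (simp add: word_def products_at_one[OF f gl(1)] e)
  next
    case False
    hence s: "{S \<in> Pow ?N. 0 \<in> S} = {S. S \<subseteq> ?N \<and> 0 \<notin> ?N - S}" by auto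
    have "hs_prec f g (word w) = pairing f g (\<Sum>S | S \<subseteq> ?N \<and> 0 \<notin> ?N - S. coproduct_term w S)"
      unfolding s[symmetric] using False coproduct_prec_bars[of w "[]"]
      by (simp add: word_def hs_prec_def coproduct_word_prec_def bars_Nil coproduct_bars[of "[]", unfolded bars_Nil])
    thus ?thesis using pairing_sum_coproduct_term[OF f g, of w "\<lambda>K. 0 \<notin> K"] by simp
  qed
  show "hs_succ f g (word w) = (\<Sum>K | convex_in ?N K \<and> 0 \<in> K.
      f (word (nths w (?N - K))) * g (word (nths w K)))"
  proof (cases "w = []")
    case True
    thus ?thesis by (simp add: word_def products_at_one[OF f gl(1)] e)
  next
    case False
    hence s: "{S \<in> Pow ?N. 0 \<notin> S} = {S. S \<subseteq> ?N \<and> 0 \<in> ?N - S}" by auto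
    have "hs_succ f g (word w) = pairing f g (\<Sum>S | S \<subseteq> ?N \<and> 0 \<in> ?N - S. coproduct_term w S)"
      unfolding s[symmetric] using False coproduct_succ_bars[of w "[]"]
      by (simp add: word_def hs_succ_def coproduct_word_succ_def bars_Nil coproduct_bars[of "[]", unfolded bars_Nil])
    thus ?thesis using pairing_sum_coproduct_term[OF f g, of w "\<lambda>K. 0 \<in> K"] by simp
  qed
qed

lemma convex_complement_of_prefix:
  assumes "convex_in {..<n} K" "0 \<in> K" "K \<noteq> {..<n}"
  shows "convex_in {..<n} ({..<n} - K) \<and> 0 \<notin> {..<n} - K \<and> n - 1 \<in> {..<n} - K"
proof -
  have K: "K \<subseteq> {..<n}" using assms(1) by (simp add: convex_in_def)
  obtain b where b: "K = {0..b}"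
    using convex_in_lessThan_eq_interval[OF assms(1)] assms(2) by (metis atLeastAtMost_iff le_zero_eq)
  have "b < n" using K b by auto
  moreover have "b \<noteq> n - 1"
  proof
    assume "b = n - 1"
    hence "K = {..<n}" using b \<open>b < n\<close> by auto
    thus False using assms(3) by blast
  qed
  ultimately have "n - 1 \<in> {..<n} - K" using b by auto
  thus ?thesis using b unfolding convex_in_def by auto
qed

lemma convex_complement_of_suffix:
  assumes "convex_in {..<n} K" "0 \<notin> K" "n - 1 \<in> K"
  shows "convex_in {..<n} ({..<n} - K) \<and> 0 \<in> {..<n} - K \<and> {..<n} - K \<noteq> {..<n}"
proof -
  have K: "K \<subseteq> {..<n}" using assms(1) by (simp add: convex_in_def)
  have n: "n > 0" using assms(3) K by auto
  obtain a b where ab: "K = {a..b}" using convex_in_lessThan_eq_interval[OF assms(1)] by blast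
  have "a > 0" "a \<le> n - 1" "n - 1 \<le> b" using ab assms(2,3) by auto
  hence "convex_in {..<n} ({..<n} - K)" using ab n unfolding convex_in_def by auto
  moreover have "0 \<in> {..<n} - K" using n assms(2) by simp
  moreover have "n - 1 \<in> {..<n}" using n by simp
  hence "{..<n} - K \<noteq> {..<n}" using assms(3) by blast
  ultimately show ?thesis by blast
qed

text \<open>The half-product \<open>f \<prec> g\<close> removes the intervals \<open>K\<close> without the first letter and evaluates \<open>g\<close> on them. In
  \<open>g \<succ> f\<close> a prefix is evaluated by \<open>f\<close> and the complementary suffix by \<open>g\<close>; read as the removal of that
  suffix, it cancels the intervals \<open>K\<close> that contain the last letter.\<close>

lemma pre_lie_on_words:
  assumes f: "inf_char_on_words f" and g: "inf_char_on_words g"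
  shows "pre_lie f g (word w) = (\<Sum>K | convex_in {..<length w} K \<and> 0 \<notin> K \<and> length w - 1 \<notin> K.
      f (word (nths w ({..<length w} - K))) * g (word (nths w K)))"
proof -
  let ?n = "length w" let ?N = "{..<?n}"
  let ?t = "\<lambda>K. f (word (nths w (?N - K))) * g (word (nths w K))"
  have lin: "clinear f" "clinear g" and g1: "g 1 = 0" using f g by (simp_all add: inf_char_on_words_def)
  have fin: "finite {K. convex_in ?N K \<and> P K}" for P
    by (rule finite_subset[OF _ finite_convex_in[OF finite_lessThan]]) blast
  have "hs_succ g f (word w) = (\<Sum>K | convex_in ?N K \<and> 0 \<in> K.
      g (word (nths w (?N - K))) * f (word (nths w K)))"
    by (rule products_on_words(3)[OF lin(2) f])
  \<comment> \<open>For \<open>K\<close> the whole word the other factor is \<open>g 1 = 0\<close>.\<close>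
  also have "\<dots> = (\<Sum>K | convex_in ?N K \<and> 0 \<in> K \<and> K \<noteq> ?N.
      g (word (nths w (?N - K))) * f (word (nths w K)))"
    by (rule sum.mono_neutral_right[OF fin]) (auto simp: word_def g1)
  also have "\<dots> = (\<Sum>K | convex_in ?N K \<and> 0 \<notin> K \<and> ?n - 1 \<in> K. ?t K)"
  proof (rule sum.reindex_bij_witness[of _ "\<lambda>K. ?N - K" "\<lambda>K. ?N - K"])
    fix K assume "K \<in> {K. convex_in ?N K \<and> 0 \<in> K \<and> K \<noteq> ?N}"
    hence K: "convex_in ?N K" "0 \<in> K" "K \<noteq> ?N" by auto
    have d: "?N - (?N - K) = K" using K(1) by (auto simp: convex_in_def)
    show "?N - (?N - K) = K" by (fact d)
    show "?N - K \<in> {K. convex_in ?N K \<and> 0 \<notin> K \<and> ?n - 1 \<in> K}"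
      using convex_complement_of_prefix[OF K] by blast
    show "?t (?N - K) = g (word (nths w (?N - K))) * f (word (nths w K))" by (simp add: d)
  next
    fix K assume "K \<in> {K. convex_in ?N K \<and> 0 \<notin> K \<and> ?n - 1 \<in> K}"
    hence K: "convex_in ?N K" "0 \<notin> K" "?n - 1 \<in> K" by auto
    show "?N - (?N - K) = K" using K(1) by (auto simp: convex_in_def)
    show "?N - K \<in> {K. convex_in ?N K \<and> 0 \<in> K \<and> K \<noteq> ?N}"
      using convex_complement_of_suffix[OF K] by blast
  qed
  finally have succ: "hs_succ g f (word w) = (\<Sum>K | convex_in ?N K \<and> 0 \<notin> K \<and> ?n - 1 \<in> K. ?t K)" .
  have "hs_prec f g (word w) = (\<Sum>K | convex_in ?N K \<and> 0 \<notin> K. ?t K)"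
    by (rule products_on_words(2)[OF lin(1) g])
  also have "{K. convex_in ?N K \<and> 0 \<notin> K} =
      {K. convex_in ?N K \<and> 0 \<notin> K \<and> ?n - 1 \<notin> K} \<union> {K. convex_in ?N K \<and> 0 \<notin> K \<and> ?n - 1 \<in> K}"
    by blast
  also have "sum ?t \<dots> = (\<Sum>K | convex_in ?N K \<and> 0 \<notin> K \<and> ?n - 1 \<notin> K. ?t K) +
      (\<Sum>K | convex_in ?N K \<and> 0 \<notin> K \<and> ?n - 1 \<in> K. ?t K)"
    by (rule sum.union_disjoint[OF fin fin]) blast
  finally show ?thesis unfolding pre_lie_def succ by simp
qed

section \<open>The pre-Lie product of infinitesimal characters\<close>

text \<open>Identities that are bilinear in two tensors need to be checked on these elements only, since their span
  is closed under multiplication and contains all coproducts of words.\<close>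

definition pure_pairs :: "('a::complex_vect dta, 'a dta) tens set" where
  "pure_pairs = {bars us \<otimes> bars vs | us vs. [] \<notin> set us \<and> [] \<notin> set vs}"

lemma clinear_eq_on_span:
  assumes "clinear f" "clinear g" "\<And>r. r \<in> R \<Longrightarrow> f r = g r" "x \<in> cvec.span R"
  shows "f x = (g x :: 'b::complex_vect)"
  using assms(4)
  by (induction rule: cvec.span_induct_alt) (auto simp: clinear_0[OF assms(1)] clinear_0[OF assms(2)]
      clinear_add[OF assms(1)] clinear_add[OF assms(2)] clinear_scale[OF assms(1)] clinear_scale[OF assms(2)] assms(3))

lemma pure_pairs_mult:
  "s \<in> pure_pairs \<Longrightarrow> t \<in> pure_pairs \<Longrightarrow> s * t \<in> pure_pairs"
proof -
  assume "s \<in> pure_pairs" "t \<in> pure_pairs"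
  then obtain us vs us' vs' where st: "s = bars us \<otimes> bars vs" "t = bars us' \<otimes> bars vs'"
    "[] \<notin> set us" "[] \<notin> set vs" "[] \<notin> set us'" "[] \<notin> set vs'" unfolding pure_pairs_def by blast
  have "s * t = bars (us @ us') \<otimes> bars (vs @ vs')" by (simp add: st tens_mult bars_append)
  thus ?thesis using st(3-) unfolding pure_pairs_def by fastforce
qed

lemma span_pure_pairs_mult:
  fixes s t :: "('a::complex_vect dta, 'a dta) tens"
  assumes "s \<in> cvec.span pure_pairs" "t \<in> cvec.span pure_pairs"
  shows "s * t \<in> cvec.span pure_pairs"
proof (rule clinear_span_image[OF clinear_mult(1) _ assms(1)])
  fix r :: "('a dta, 'a dta) tens" assume r: "r \<in> pure_pairs"
  show "r * t \<in> cvec.span pure_pairs"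
    by (rule clinear_span_image[OF clinear_mult(2) _ assms(2)])
      (rule cvec.span_base, rule pure_pairs_mult[OF r])
qed

lemma coproduct_term_in_span:
  assumes "S \<subseteq> {..<length w}"
  shows "coproduct_term w S \<in> cvec.span pure_pairs"
proof (rule cvec.span_base)
  have "coproduct_term w S = bars (if nths w S = [] then [] else [nths w S]) \<otimes>
      bars (map (nths w) (components_list ({..<length w} - S)))"
    by (simp add: coproduct_term_def bars_Nil)
  moreover have "[] \<notin> set (map (nths w) (components_list ({..<length w} - S)))"
    by (rule components_nonempty_words) blast
  ultimately show "coproduct_term w S \<in> pure_pairs" unfolding pure_pairs_def by fastforce
qed

lemma coproduct_words_in_span:
  "coproduct_word w \<in> cvec.span pure_pairs"
  "coproduct_word_prec w \<in> cvec.span pure_pairs"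
  "coproduct_word_succ w \<in> cvec.span pure_pairs"
  unfolding coproduct_word_def coproduct_word_prec_def coproduct_word_succ_def
  by (rule cvec.span_sum, rule coproduct_term_in_span, simp)+

lemma coproduct_bars_in_span:
  "[] \<notin> set ws \<Longrightarrow> coproduct (bars ws) \<in> cvec.span pure_pairs"
proof (induction ws)
  case Nil
  have "1 \<otimes> 1 \<in> (pure_pairs :: ('a dta, 'a dta) tens set)"
    unfolding pure_pairs_def bars_Nil[symmetric] by fastforce
  thus ?case by (simp add: bars_Nil coproduct_one(1) cvec.span_base)
next
  case (Cons w ws)
  hence "coproduct (bars (w # ws)) = coproduct_word w * coproduct (bars ws)"
    by (simp add: coproduct_bars)
  thus ?case using Cons by (simp add: span_pure_pairs_mult coproduct_words_in_span)
qed

lemma scaleC_eq_times: "c *\<^sub>C x = c * (x :: complex)"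
  by (simp add: scaleC_complex_def)

lemma pairing_add_scale:
  assumes "clinear f" "clinear g"
  shows "pairing f g (x + y) = pairing f g x + pairing f g y"
    and "pairing f g (c *\<^sub>C x) = c * pairing f g x"
  using clinear_add[OF clinear_pairing[OF assms]] clinear_scale[OF clinear_pairing[OF assms]]
  by (simp_all add: scaleC_complex_def)

text \<open>If \<open>f\<close> and \<open>g\<close> send products to \<open>f\<^sub>1 \<cdot> f\<^sub>2 + f\<^sub>3 \<cdot> f\<^sub>4\<close> and \<open>g\<^sub>1 \<cdot> g\<^sub>2 + g\<^sub>3 \<cdot> g\<^sub>4\<close>, as characters and
  derivations along the counit do, then \<open>f \<otimes> g\<close> sends products of tensors to the expanded product.\<close>

lemma pairing_mult:
  assumes lin: "clinear f" "clinear f1" "clinear f2" "clinear f3" "clinear f4"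
    "clinear g" "clinear g1" "clinear g2" "clinear g3" "clinear g4"
    and f: "\<And>us us'. [] \<notin> set us \<Longrightarrow> [] \<notin> set us' \<Longrightarrow>
      f (bars us * bars us') = f1 (bars us) * f2 (bars us') + f3 (bars us) * f4 (bars us')"
    and g: "\<And>us us'. [] \<notin> set us \<Longrightarrow> [] \<notin> set us' \<Longrightarrow>
      g (bars us * bars us') = g1 (bars us) * g2 (bars us') + g3 (bars us) * g4 (bars us')"
    and s: "s \<in> cvec.span pure_pairs" and t: "t \<in> cvec.span pure_pairs"
  shows "pairing f g (s * t) =
    pairing f1 g1 s * pairing f2 g2 t + pairing f1 g3 s * pairing f2 g4 t +
    pairing f3 g1 s * pairing f4 g2 t + pairing f3 g3 s * pairing f4 g4 t"
proof -
  let ?rhs = "\<lambda>s t. pairing f1 g1 s * pairing f2 g2 t + pairing f1 g3 s * pairing f2 g4 t +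
    pairing f3 g1 s * pairing f4 g2 t + pairing f3 g3 s * pairing f4 g4 t"
  note cl = lin[THEN clinear_pairing]
  have R1: "clinear (\<lambda>s. ?rhs s t)" and R2: "clinear (?rhs s)" for s t
    by (rule clinearI; simp add: pairing_add_scale lin scaleC_eq_times algebra_simps)+
  have L1: "clinear (\<lambda>s. pairing f g (s * t))" and L2: "clinear (\<lambda>t. pairing f g (s * t))" for s t
    using clinear_compose[OF clinear_mult(1) cl(1)[OF lin(6)]]
      clinear_compose[OF clinear_mult(2) cl(1)[OF lin(6)]] by blast+
  have base: "pairing f g (s * t) = ?rhs s t" if st: "s \<in> pure_pairs" "t \<in> pure_pairs" for s t
  proof -
    obtain us vs us' vs' where st: "s = bars us \<otimes> bars vs" "t = bars us' \<otimes> bars vs'"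
      "[] \<notin> set us" "[] \<notin> set vs" "[] \<notin> set us'" "[] \<notin> set vs'" 
      using st unfolding pure_pairs_def by blast
    show ?thesis unfolding st(1,2) tens_mult
      by (simp add: pairing_tens lin f[OF st(3,5)] g[OF st(4,6)] algebra_simps)
  qed
  have "pairing f g (s * t) = ?rhs s t" if "s \<in> pure_pairs" for s
    by (rule clinear_eq_on_span[OF L2 R2 _ t]) (rule base[OF that])
  thus ?thesis by (rule clinear_eq_on_span[OF L1 R1 _ s])
qed

lemma counit_one: "counit 1 = 1"
  using counit_bars[of "[]"] by (simp add: bars_Nil)

lemma inf_char_derivation:
  assumes "inf_char_on_words f" "[] \<notin> set us" "[] \<notin> set us'"
  shows "f (bars us * bars us') = f (bars us) * counit (bars us') + counit (bars us) * f (bars us')"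
proof (cases "us = [] \<or> us' = []")
  case True
  thus ?thesis using assms(1) by (auto simp: bars_Nil inf_char_on_words_def counit_one)
next
  case False
  hence "length (us @ us') \<ge> 2" by (cases us; cases us') auto
  moreover have "[] \<notin> set (us @ us')" using assms(2,3) by simp
  ultimately have "f (bars (us @ us')) = 0" using assms(1) unfolding inf_char_on_words_def by blast
  thus ?thesis using False by (simp add: bars_append counit_bars)
qed

text \<open>The vacuous summand gives this the form that \<open>pairing_mult\<close> expects, with zero as the second pair of
  functionals.\<close>

lemma counit_mult: "counit (bars us * bars us') = counit (bars us) * counit (bars us') + 0 * 0"
  by (simp add: bars_append[symmetric] counit_bars)

lemma clinear_zero: "clinear (\<lambda>_. 0 :: complex)"
  by (rule clinearI) (simp_all add: scaleC_complex_def)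

lemma pairing_products:
  assumes f: "inf_char_on_words f" and g: "inf_char_on_words g"
    and s: "s \<in> cvec.span pure_pairs" and t: "t \<in> cvec.span pure_pairs"
  shows "pairing f g (s * t) = pairing f g s * pairing counit counit t + pairing f counit s * pairing counit g t +
      pairing counit g s * pairing f counit t + pairing counit counit s * pairing f g t"
    and "pairing counit counit (s * t) = pairing counit counit s * pairing counit counit t"
    and "pairing f counit (s * t) = pairing f counit s * pairing counit counit t + pairing counit counit s * pairing f counit t"
    and "pairing counit g (s * t) = pairing counit g s * pairing counit counit t + pairing counit counit s * pairing counit g t"
proof -
  have lin: "clinear f" "clinear g" using f g by (simp_all add: inf_char_on_words_def)
  note cc = clinear_counit and cz = clinear_zero
  have z: "tens_lift (\<lambda>s t. 0 :: complex) x = 0" for x :: "('a dta, 'a dta) tens"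
    by (simp add: tens_lift_def lin_ext_def case_prod_beta scaleC_complex_def)
  show "pairing f g (s * t) = pairing f g s * pairing counit counit t + pairing f counit s * pairing counit g t +
      pairing counit g s * pairing f counit t + pairing counit counit s * pairing f g t"
    by (rule pairing_mult[OF lin(1,1) cc cc lin(1) lin(2,2) cc cc lin(2)
          inf_char_derivation[OF f] inf_char_derivation[OF g] s t])
  show "pairing counit counit (s * t) = pairing counit counit s * pairing counit counit t"
    using pairing_mult[OF cc cc cc cz cz cc cc cc cz cz counit_mult counit_mult s t] by (simp add: z)
  show "pairing f counit (s * t) = pairing f counit s * pairing counit counit t + pairing counit counit s * pairing f counit t"
    using pairing_mult[OF lin(1,1) cc cc lin(1) cc cc cc cz cz inf_char_derivation[OF f] counit_mult s t]
    by (simp add: z)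
  show "pairing counit g (s * t) = pairing counit g s * pairing counit counit t + pairing counit counit s * pairing counit g t"
    using pairing_mult[OF cc cc cc cz cz lin(2,2) cc cc lin(2) counit_mult inf_char_derivation[OF g] s t]
    by (simp add: z)
qed

text \<open>A counit on one side leaves only the term in which that side is empty, that is, all letters are kept or
  all are removed.\<close>

lemma pairing_counit_term:
  assumes f: "clinear f" and S: "S \<subseteq> {..<length w}" and w: "w \<noteq> []"
  shows "pairing f counit (coproduct_term w S) = (if S = {..<length w} then f (bars [w]) else 0)"
    and "pairing counit f (coproduct_term w S) = (if S = {} then f (bars [w]) else 0)"
proof -
  let ?N = "{..<length w}"
  have N: "nths w ?N = w" by (rule nths_all) simp
  have c: "convex_in ?N ?N" using w unfolding convex_in_def by auto
  have "components_list (?N - S) = [] \<longleftrightarrow> S = ?N" using S by (simp add: components_list_eq_Nil_iff) blast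
  thus "pairing f counit (coproduct_term w S) = (if S = ?N then f (bars [w]) else 0)"
    unfolding pairing_coproduct_term[OF f clinear_counit] using w N by (auto simp: counit_bars word_def)
  have "counit (word (nths w S)) = (if S = {} then 1 else 0)"
    using counit_bars[of "[nths w S]"] nths_eq_Nil_iff[OF S] by (simp add: word_def counit_one)
  thus "pairing counit f (coproduct_term w S) = (if S = {} then f (bars [w]) else 0)"
    unfolding pairing_coproduct_term[OF clinear_counit f] using N by (simp add: components_list_convex[OF c])
qed

lemma pairing_counit_words:
  assumes f: "inf_char_on_words f" and w: "w \<noteq> []"
  shows "pairing f counit (coproduct_word_prec w) = f (bars [w])" "pairing counit f (coproduct_word_prec w) = 0"
    "pairing f counit (coproduct_word_succ w) = 0" "pairing counit f (coproduct_word_succ w) = f (bars [w])"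
    "pairing counit counit (coproduct_word_prec w) = 0" "pairing counit counit (coproduct_word_succ w) = 0"
proof -
  let ?N = "{..<length w}"
  let ?P = "{S \<in> Pow ?N. 0 \<in> S}" and ?Q = "{S \<in> Pow ?N. 0 \<notin> S}"
  have lin: "clinear f" using f by (simp add: inf_char_on_words_def)
  have fin: "finite ?P" "finite ?Q" by simp_all
  have eq: "pairing h counit (\<Sum>S\<in>X. coproduct_term w S) = (if ?N \<in> X then h (bars [w]) else 0)"
     "pairing counit h (\<Sum>S\<in>X. coproduct_term w S) = (if {} \<in> X then h (bars [w]) else 0)"
    if h: "clinear h" and X: "X \<subseteq> Pow ?N" for h X
  proof -
    have fX: "finite X" using X by (rule finite_subset) simp
    have "pairing h counit (\<Sum>S\<in>X. coproduct_term w S) = (\<Sum>S\<in>X. if S = ?N then h (bars [w]) else 0)"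
      unfolding clinear_sum[OF clinear_pairing[OF h clinear_counit]]
      by (rule sum.cong[OF refl], rule pairing_counit_term(1)[OF h _ w]) (use X in blast)
    thus "pairing h counit (\<Sum>S\<in>X. coproduct_term w S) = (if ?N \<in> X then h (bars [w]) else 0)"
      using fX by (simp add: sum.delta)
    have "pairing counit h (\<Sum>S\<in>X. coproduct_term w S) = (\<Sum>S\<in>X. if S = {} then h (bars [w]) else 0)"
      unfolding clinear_sum[OF clinear_pairing[OF clinear_counit h]]
      by (rule sum.cong[OF refl], rule pairing_counit_term(2)[OF h _ w]) (use X in blast)
    thus "pairing counit h (\<Sum>S\<in>X. coproduct_term w S) = (if {} \<in> X then h (bars [w]) else 0)"
      using fX by (simp add: sum.delta)
  qed
  have PQ: "?P \<subseteq> Pow ?N" "?Q \<subseteq> Pow ?N" and mem: "?N \<in> ?P" "?N \<notin> ?Q" "{} \<notin> ?P" "{} \<in> ?Q"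
    using w by auto
  show "pairing f counit (coproduct_word_prec w) = f (bars [w])" "pairing counit f (coproduct_word_prec w) = 0"
    "pairing f counit (coproduct_word_succ w) = 0" "pairing counit f (coproduct_word_succ w) = f (bars [w])"
    "pairing counit counit (coproduct_word_prec w) = 0" "pairing counit counit (coproduct_word_succ w) = 0"
    unfolding coproduct_word_prec_def coproduct_word_succ_def
      eq[OF lin PQ(1)] eq[OF lin PQ(2)] eq(1)[OF clinear_counit PQ(2)] eq(2)[OF clinear_counit PQ(1)]
    using mem by (simp_all only: if_True if_False simp_thms)
qed

text \<open>The counit laws of the coproduct, tested with an infinitesimal character.\<close>

lemma pairing_counit_bars:
  assumes f: "inf_char_on_words f"
  shows "[] \<notin> set ws \<Longrightarrow> pairing counit counit (coproduct (bars ws)) = (if ws = [] then 1 else 0) \<and>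
    pairing counit f (coproduct (bars ws)) = f (bars ws) \<and>
    pairing f counit (coproduct (bars ws)) = f (bars ws)"
proof (induction ws)
  case Nil
  have "clinear f" "f 1 = 0" using f by (simp_all add: inf_char_on_words_def)
  thus ?case by (simp add: bars_Nil coproduct_one(1) pairing_tens clinear_counit counit_one)
next
  case (Cons w ws)
  have lin: "clinear f" using f by (simp add: inf_char_on_words_def)
  have w: "w \<noteq> []" "[] \<notin> set ws" using Cons.prems by auto
  have split: "pairing h k (coproduct_word w) = pairing h k (coproduct_word_prec w) + pairing h k (coproduct_word_succ w)"
    if "clinear h" "clinear k" for h k
    unfolding coproduct_word_split by (rule clinear_add[OF clinear_pairing[OF that]])
  have cp: "coproduct (bars (w # ws)) = coproduct_word w * coproduct (bars ws)"
    using w by (simp add: coproduct_bars)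
  note pp = pairing_products[OF f f coproduct_words_in_span(1)[of w] coproduct_bars_in_span[OF w(2)]]
  have "f (bars (w # ws)) = 0" if "ws \<noteq> []"
    using f Cons.prems that unfolding inf_char_on_words_def by (cases ws) auto
  thus ?case
    unfolding cp pp(2,3,4) split[OF clinear_counit clinear_counit] split[OF clinear_counit lin] split[OF lin clinear_counit]
    using Cons.IH[OF w(2)] by (simp add: pairing_counit_words[OF f w(1)])
qed

text \<open>On a tensor \<open>w | x\<close> with a nonempty \<open>x\<close> both \<open>f \<prec> g\<close> and \<open>g \<succ> f\<close> take the value \<open>f(w) g(x)\<close>: as \<open>f\<close> and \<open>g\<close> are
  derivations along the counit and the half-coproducts keep, respectively remove, the first letter, a
  single term of the product formula survives in each case. The two cancel in the pre-Lie product.\<close>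

lemma inf_char_pre_lie:
  assumes f: "inf_char_on_words f" and g: "inf_char_on_words g"
  shows "inf_char_on_words (pre_lie f g)"
proof -
  have lin: "clinear f" "clinear g" using f g by (simp_all add: inf_char_on_words_def)
  have "pre_lie f g (bars ws) = 0" if ws: "[] \<notin> set ws" "length ws \<ge> 2" for ws
  proof -
    obtain w ws' where w: "ws = w # ws'" "ws' \<noteq> []" using ws(2) by (cases ws; cases "tl ws") auto
    have ne: "w \<noteq> []" "[] \<notin> set ws'" using ws(1) w(1) by auto
    note t = coproduct_bars_in_span[OF ne(2)]
    have "hs_prec f g (bars ws) = f (bars [w]) * g (bars ws')"
      unfolding hs_prec_def w(1) coproduct_prec_bars[OF ws(1)[unfolded w(1)]]
        pairing_products(1)[OF f g coproduct_words_in_span(2) t]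
      using w(2) pairing_counit_bars[OF g ne(2)]
      by (simp add: pairing_counit_words[OF f ne(1)] pairing_counit_words[OF g ne(1)])
    moreover have "hs_succ g f (bars ws) = f (bars [w]) * pairing g counit (coproduct (bars ws'))"
      unfolding hs_succ_def w(1) coproduct_succ_bars[OF ws(1)[unfolded w(1)]]
        pairing_products(1)[OF g f coproduct_words_in_span(3) t]
      using w(2) pairing_counit_bars[OF f ne(2)]
      by (simp add: pairing_counit_words[OF f ne(1)] pairing_counit_words[OF g ne(1)])
    moreover have "pairing g counit (coproduct (bars ws')) = g (bars ws')"
      using pairing_counit_bars[OF g ne(2)] by simp
    ultimately show ?thesis by (simp add: pre_lie_def)
  qed
  moreover have "pre_lie f g 1 = 0" by (simp add: pre_lie_def products_at_one lin)
  moreover have "clinear (pre_lie f g)"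
    unfolding pre_lie_def[abs_def] by (rule clinear_diff_form[OF clinear_hs_prec[OF lin] clinear_hs_succ[OF lin(2,1)]])
  ultimately show ?thesis by (simp add: inf_char_on_words_def)
qed

section \<open>Words restricted to sets of positions\<close>

text \<open>The position of letter \<open>i\<close> in the word that keeps only the letters with positions in \<open>A\<close>. It transports
  intervals of \<open>A\<close> to intervals of \<open>{..<card A}\<close>.\<close>

definition rank :: "nat set \<Rightarrow> nat \<Rightarrow> nat" where
  "rank A i = card {j\<in>A. j < i}"

lemma rank_less: "finite A \<Longrightarrow> i \<in> A \<Longrightarrow> i < j \<Longrightarrow> rank A i < rank A j"
  unfolding rank_def by (rule psubset_card_mono) auto

lemma inj_on_rank: "finite A \<Longrightarrow> inj_on (rank A) A"
  by (rule linorder_inj_onI) (auto dest: rank_less)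

lemma rank_less_iff:
  assumes "finite A" "i \<in> A" "j \<in> A"
  shows "rank A i < rank A j \<longleftrightarrow> i < j"
  using rank_less[OF assms(1,2), of j] rank_less[OF assms(1,3), of i]
  by (metis less_asym less_irrefl linorder_neqE_nat)

lemma rank_image:
  assumes "finite A"
  shows "rank A ` A = {..<card A}"
proof (rule card_subset_eq)
  have "rank A i < card A" if "i \<in> A" for i
    unfolding rank_def by (rule psubset_card_mono[OF assms]) (use that in auto)
  thus "rank A ` A \<subseteq> {..<card A}" by blast
  show "card (rank A ` A) = card {..<card A}" by (simp add: card_image inj_on_rank assms)
qed simp

lemma convex_in_rank_image:
  assumes A: "finite A" and J: "J \<subseteq> A"
  shows "convex_in {..<card A} (rank A ` J) \<longleftrightarrow> convex_in A J"
proof -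
  note iff = rank_less_iff[OF A] and inj = inj_on_image_mem_iff[OF inj_on_rank[OF A] _ J]
  have "(\<forall>a\<in>rank A ` J. \<forall>b\<in>rank A ` J. \<forall>x\<in>rank A ` A. a < x \<and> x < b \<longrightarrow> x \<in> rank A ` J) \<longleftrightarrow>
    (\<forall>a\<in>J. \<forall>b\<in>J. \<forall>x\<in>A. a < x \<and> x < b \<longrightarrow> x \<in> J)"
    unfolding ball_simps(9)
  proof (intro ball_cong refl)
    fix a b x assume "a \<in> J" "b \<in> J" "x \<in> A"
    moreover from this have "a \<in> A" "b \<in> A" using J by blast+
    ultimately show "(rank A a < rank A x \<and> rank A x < rank A b \<longrightarrow> rank A x \<in> rank A ` J) =
        (a < x \<and> x < b \<longrightarrow> x \<in> J)" by (simp add: iff inj)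
  qed
  thus ?thesis unfolding convex_in_def rank_image[OF A, symmetric] using J by auto
qed

lemma nths_rank_image:
  assumes "finite A" "J \<subseteq> A"
  shows "nths (nths w A) (rank A ` J) = nths w J"
proof -
  have "{i \<in> A. \<exists>j\<in>rank A ` J. card {i' \<in> A. i' < i} = j} = {i\<in>A. rank A i \<in> rank A ` J}"
    by (auto simp: rank_def)
  also have "\<dots> = J" using inj_on_image_mem_iff[OF inj_on_rank[OF assms(1)] _ assms(2)] assms(2) by auto
  finally show ?thesis by (simp add: nths_nths)
qed

lemma length_nths_subset:
  assumes "A \<subseteq> {..<length w}"
  shows "length (nths w A) = card A"
proof -
  have "{i. i < length w \<and> i \<in> A} = A" using assms by auto
  thus ?thesis by (simp add: length_nths)
qed

text \<open>Removing an interval from \<open>nths w A\<close> amounts to removing an interval of \<open>A\<close> from \<open>A\<close>; thus iterated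
  removals can be described with subsets of the positions of one fixed word \<open>w\<close>.\<close>

lemma sum_convex_in_nths:
  fixes F :: "'a list \<Rightarrow> 'a list \<Rightarrow> complex"
  assumes A: "A \<subseteq> {..<length w}"
    and Q: "\<And>J. J \<subseteq> A \<Longrightarrow> A \<noteq> {} \<Longrightarrow> Q (rank A ` J) \<longleftrightarrow> Q' J"
  shows "(\<Sum>K | convex_in {..<length (nths w A)} K \<and> Q K.
      F (nths (nths w A) ({..<length (nths w A)} - K)) (nths (nths w A) K)) =
    (\<Sum>J | convex_in A J \<and> Q' J. F (nths w (A - J)) (nths w J))"
proof (rule sum.reindex_bij_witness[of _ "\<lambda>J. rank A ` J" "\<lambda>K. {i\<in>A. rank A i \<in> K}"])
  have fA: "finite A" using A by (rule finite_subset) simp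
  note len = length_nths_subset[OF A]
  have img: "rank A ` {i\<in>A. rank A i \<in> K} = K" if "K \<subseteq> {..<card A}" for K
    using that unfolding rank_image[OF fA, symmetric] by auto
  have preim: "{i\<in>A. rank A i \<in> rank A ` J} = J" if "J \<subseteq> A" for J
  proof (intro equalityI subsetI)
    fix i assume "i \<in> {i\<in>A. rank A i \<in> rank A ` J}"
    thus "i \<in> J" using inj_on_image_mem_iff[OF inj_on_rank[OF fA] _ that, of i] by simp
  qed (use that in auto)
  {
    fix K assume "K \<in> {K. convex_in {..<length (nths w A)} K \<and> Q K}"
    hence K: "convex_in {..<card A} K" "Q K" "K \<subseteq> {..<card A}" by (simp_all add: len convex_inD)
    let ?J = "{i\<in>A. rank A i \<in> K}"
    have J: "?J \<subseteq> A" by blast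
    show "rank A ` ?J = K" by (rule img[OF K(3)])
    have "K \<noteq> {}" using K(1) by (rule convex_inD)
    hence ne: "A \<noteq> {}" using K(3) by auto
    have "convex_in A ?J" using convex_in_rank_image[OF fA J] K(1) img[OF K(3)] by simp
    moreover have "Q' ?J" using Q[OF J ne] K(2) img[OF K(3)] by simp
    ultimately show "?J \<in> {J. convex_in A J \<and> Q' J}" by simp
    have 1: "nths (nths w A) K = nths w ?J" using nths_rank_image[OF fA J] img[OF K(3)] by simp
    have "{..<card A} - K = rank A ` (A - ?J)"
      using inj_on_image_set_diff[OF inj_on_rank[OF fA], of A ?J] img[OF K(3)] rank_image[OF fA] by simp
    hence 2: "nths (nths w A) ({..<card A} - K) = nths w (A - ?J)"
      using nths_rank_image[OF fA, of "A - ?J"] by simp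
    show "F (nths w (A - ?J)) (nths w ?J) =
        F (nths (nths w A) ({..<length (nths w A)} - K)) (nths (nths w A) K)"
      unfolding len 1 2 ..
  }
  {
    fix J assume "J \<in> {J. convex_in A J \<and> Q' J}"
    hence J: "convex_in A J" "Q' J" "J \<subseteq> A" by (simp_all add: convex_inD)
    have "J \<noteq> {}" using J(1) by (rule convex_inD)
    hence ne: "A \<noteq> {}" using J(3) by auto
    show "{i\<in>A. rank A i \<in> rank A ` J} = J" by (rule preim[OF J(3)])
    show "rank A ` J \<in> {K. convex_in {..<length (nths w A)} K \<and> Q K}"
      using convex_in_rank_image[OF fA J(3)] J(1,2) Q[OF J(3) ne] by (simp add: len)
  }
qed

lemma rank_image_ends:
  assumes "finite A" "A \<noteq> {}" "J \<subseteq> A"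
  shows "0 \<in> rank A ` J \<longleftrightarrow> Min A \<in> J" and "card A - 1 \<in> rank A ` J \<longleftrightarrow> Max A \<in> J"
proof -
  note inj = inj_on_image_mem_iff[OF inj_on_rank[OF assms(1)] _ assms(3)]
  have "{j\<in>A. j < Min A} = {}" using Min_le[OF assms(1)] by (auto simp: not_less[symmetric])
  hence "rank A (Min A) = 0" by (simp only: rank_def card.empty)
  thus "0 \<in> rank A ` J \<longleftrightarrow> Min A \<in> J" using inj[OF Min_in[OF assms(1,2)]] by simp
  have "{j\<in>A. j < Max A} = A - {Max A}" using assms(1) Max_ge[OF assms(1)] by (auto simp: less_le)
  hence "rank A (Max A) = card A - 1" using assms(1,2) by (simp add: rank_def)
  thus "card A - 1 \<in> rank A ` J \<longleftrightarrow> Max A \<in> J" using inj[OF Max_in[OF assms(1,2)]] by simp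
qed

lemma products_on_subwords:
  assumes A: "A \<subseteq> {..<length w}" and f: "clinear f" and g: "inf_char_on_words g"
  shows "conv f g (word (nths w A)) =
      (\<Sum>J | convex_in A J. f (word (nths w (A - J))) * g (word (nths w J)))"
    and "hs_succ f g (word (nths w A)) =
      (\<Sum>J | convex_in A J \<and> Min A \<in> J. f (word (nths w (A - J))) * g (word (nths w J)))"
    and "inf_char_on_words f \<Longrightarrow> pre_lie f g (word (nths w A)) =
      (\<Sum>J | convex_in A J \<and> Min A \<notin> J \<and> Max A \<notin> J. f (word (nths w (A - J))) * g (word (nths w J)))"
proof -
  have fA: "finite A" using A by (rule finite_subset) simp
  let ?F = "\<lambda>u v. f (word u) * g (word v)"
  show "conv f g (word (nths w A)) =
      (\<Sum>J | convex_in A J. f (word (nths w (A - J))) * g (word (nths w J)))"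
    using sum_convex_in_nths[OF A, of "\<lambda>_. True" "\<lambda>_. True" ?F] products_on_words(1)[OF f g] by simp
  show "hs_succ f g (word (nths w A)) =
      (\<Sum>J | convex_in A J \<and> Min A \<in> J. f (word (nths w (A - J))) * g (word (nths w J)))"
    unfolding products_on_words(3)[OF f g]
    by (rule sum_convex_in_nths[OF A]) (rule rank_image_ends(1)[OF fA])
  assume f': "inf_char_on_words f"
  show "pre_lie f g (word (nths w A)) =
      (\<Sum>J | convex_in A J \<and> Min A \<notin> J \<and> Max A \<notin> J. f (word (nths w (A - J))) * g (word (nths w J)))"
    unfolding pre_lie_on_words[OF f' g]
    by (rule sum_convex_in_nths[OF A])
      (simp only: rank_image_ends[OF fA] length_nths_subset[OF A] simp_thms)
qed

section \<open>The exponentials as sums over non-crossing partitions\<close>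

abbreviation subword_value :: "('a::complex_vect dta \<Rightarrow> complex) \<Rightarrow> 'a list \<Rightarrow> nat set \<Rightarrow> complex" where
  "subword_value f w A \<equiv> f (word (nths w A))"

lemma counit_word: "counit (word u) = (if u = [] then 1 else 0)"
  using counit_bars[of "[u]"] by (simp add: word_def counit_one)

lemma exp_conv_eq_moment_sum:
  assumes r: "inf_char_on_words r" and A: "A \<subseteq> {..<length w}"
  shows "exp_conv r (word (nths w A)) = moment_sum (subword_value r w) (subword_value r w) A"
proof -
  have fA: "finite A" using A by (rule finite_subset) simp
  have lin: "clinear (conv_power r n)" for n
    using r by (induction n) (simp_all add: clinear_counit clinear_conv inf_char_on_words_def)
  let ?c = "\<lambda>n A. subword_value (conv_power r n) w A"
  let ?W = "\<lambda>\<pi>. \<Prod>V\<in>\<pi>. subword_value r w V"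
  have c: "?c n A = (\<Sum>\<pi> | \<pi> \<in> NC_on A \<and> card \<pi> = n. fact n * hook_weight nests \<pi> * ?W \<pi>)" for n
  proof (rule iterated_interval_removal[OF finite_lessThan[of "length w"] _ _ A])
    show "?c 0 B = (if B = {} then 1 else 0)" if "B \<subseteq> {..<length w}" for B
      using nths_eq_Nil_iff[OF that] by (simp add: counit_word)
    show "?c (Suc n) B = (\<Sum>J | convex_in B J. ?c n (B - J) * subword_value r w J)" if "B \<subseteq> {..<length w}" for n B
      using products_on_subwords(1)[OF that lin r] by simp
  qed
  \<comment> \<open>A set of positions has no partition into more blocks than it has elements.\<close>
  have "?c n A = 0" if "n \<notin> {..card A}" for n
  proof -
    have e: "{\<pi>. \<pi> \<in> NC_on A \<and> card \<pi> = n} = {}" using card_NC_on_le[OF _ fA] that by auto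
    show ?thesis unfolding c e by simp
  qed
  hence "exp_conv r (word (nths w A)) = (\<Sum>n\<le>card A. ?c n A / fact n)"
    unfolding exp_conv_def by (intro suminf_finite) auto
  also have "\<dots> = (\<Sum>n\<le>card A. \<Sum>\<pi> | \<pi> \<in> NC_on A \<and> card \<pi> = n. hook_weight nests \<pi> * ?W \<pi>)"
    unfolding c by (simp add: sum_divide_distrib)
  also have "\<dots> = moment_sum (subword_value r w) (subword_value r w) A"
    using sum_over_card_NC_on[OF fA order_refl] moment_sum_same[OF fA] by simp
  finally show ?thesis .
qed

lemma pre_lie_exponential_eq_irreducible_sum:
  assumes p: "inf_char_on_words p" and r: "inf_char_on_words r"
    and A: "A \<subseteq> {..<length w}" "A \<noteq> {}"
  shows "subword_value p w A + suminf (\<lambda>n. subword_value (pre_lie_right_iter r (Suc n) p) w A / fact (Suc n + 1)) =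
    irreducible_sum (subword_value p w) (subword_value r w) A"
proof -
  have fA: "finite A" using A(1) by (rule finite_subset) simp
  have it: "inf_char_on_words (pre_lie_right_iter r n p)" for n
    by (induction n) (simp_all add: p inf_char_pre_lie r)
  let ?k = "\<lambda>n A. subword_value (pre_lie_right_iter r n p) w A"
  let ?W = "spanning_weight (subword_value p w) (subword_value r w) A"
  have k: "?k n A = (\<Sum>\<pi> | \<pi> \<in> NC_on A \<and> card \<pi> = Suc n. fact (Suc n) * hook_weight nests \<pi> * ?W \<pi>)" for n
  proof (rule iterated_inner_interval_removal[OF finite_lessThan[of "length w"] _ _ A])
    fix n B assume "B \<subseteq> {..<length w}" "B \<noteq> {}"
    thus "?k (Suc n) B = (\<Sum>J | convex_in B J \<and> Min B \<notin> J \<and> Max B \<notin> J. ?k n (B - J) * subword_value r w J)"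
      using products_on_subwords(3)[OF _ _ r it, of B w n] it[of n] by (simp add: inf_char_on_words_def)
  qed simp
  have "?k (Suc n) A / fact (Suc n + 1) = 0" if "n \<notin> {..<card A}" for n
  proof -
    have e: "{\<pi>. \<pi> \<in> NC_on A \<and> card \<pi> = Suc (Suc n)} = {}" using card_NC_on_le[OF _ fA] that by fastforce
    show ?thesis unfolding k e by simp
  qed
  hence "suminf (\<lambda>n. ?k (Suc n) A / fact (Suc n + 1)) = (\<Sum>n<card A. ?k (Suc n) A / fact (Suc n + 1))"
    by (intro suminf_finite) auto
  hence "subword_value p w A + suminf (\<lambda>n. ?k (Suc n) A / fact (Suc n + 1)) = (\<Sum>n<Suc (card A). ?k n A / fact (n + 1))"
    unfolding sum.lessThan_Suc_shift by simp
  also have "\<dots> = (\<Sum>n<Suc (card A). \<Sum>\<pi> | \<pi> \<in> NC_on A \<and> card \<pi> = Suc n. hook_weight nests \<pi> * ?W \<pi>)"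
    unfolding k by (simp add: sum_divide_distrib del: fact_Suc sum.lessThan_Suc)
  also have "\<dots> = (\<Sum>n<Suc (Suc (card A)). \<Sum>\<pi> | \<pi> \<in> NC_on A \<and> card \<pi> = n. hook_weight nests \<pi> * ?W \<pi>)"
  proof -
    have "card \<pi> \<noteq> 0" if "\<pi> \<in> NC_on A" for \<pi>
      using NC_onD(1,5)[OF that fA] A(2) by auto
    hence e: "{\<pi>. \<pi> \<in> NC_on A \<and> card \<pi> = 0} = {}" by blast
    show ?thesis unfolding sum.lessThan_Suc_shift[of _ "Suc (card A)"] e by simp
  qed
  also have "\<dots> = irreducible_sum (subword_value p w) (subword_value r w) A"
    using sum_over_card_NC_on[OF fA, of "Suc (card A)"] by (simp add: irreducible_sum_def lessThan_Suc_atMost)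
  finally show ?thesis .
qed

text \<open>Since \<open>b\<close> is an infinitesimal character, \<open>exp_succ b\<close> solves the fixed point equation
  \<open>\<Phi> = \<epsilon> + \<Phi> \<succ> b\<close>; on a word, \<open>\<Phi> \<succ> b\<close> cuts off a prefix and evaluates it with \<open>b\<close>.\<close>

lemma exp_succ_recursion:
  assumes b: "inf_char_on_words b" and A: "A \<subseteq> {..<length w}"
  shows "exp_succ b (word (nths w A)) = (if A = {} then 1 else
    \<Sum>U | convex_in A U \<and> Min A \<in> U. exp_succ b (word (nths w (A - U))) * subword_value b w U)"
proof -
  have lin: "clinear (succ_power b n)" for n
    using b by (induction n) (simp_all add: clinear_counit clinear_hs_succ inf_char_on_words_def)
  let ?s = "\<lambda>n A. subword_value (succ_power b n) w A"
  have s0: "?s 0 B = (if B = {} then 1 else 0)" if "B \<subseteq> {..<length w}" for B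
    using nths_eq_Nil_iff[OF that] by (simp add: counit_word)
  have sS: "?s (Suc n) B = (\<Sum>J | convex_in B J \<and> Min B \<in> J. ?s n (B - J) * subword_value b w J)"
    if "B \<subseteq> {..<length w}" for n B
    using products_on_subwords(2)[OF that lin b] by simp
  have van: "?s n B = 0" if "B \<subseteq> {..<length w}" "card B < n" for n B
    using that
  proof (induction n arbitrary: B)
    case (Suc n)
    have fB: "finite B" using Suc.prems(1) by (rule finite_subset) simp
    have "?s n (B - J) = 0" if "convex_in B J" for J
    proof (rule Suc.IH)
      have "J \<noteq> {}" "J \<subseteq> B" using that by (simp_all add: convex_in_def)
      hence "card (B - J) < card B" using fB by (intro psubset_card_mono) auto
      thus "card (B - J) < n" using Suc.prems(2) by simp
    qed (use Suc.prems(1) in blast)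
    thus ?case unfolding sS[OF Suc.prems(1)] by simp
  qed simp
  \<comment> \<open>The common bound N lets the series for a word and for its suffixes be truncated alike.\<close>
  have e: "exp_succ b (word (nths w B)) = (\<Sum>n\<le>N. ?s n B)" if "B \<subseteq> {..<length w}" "card B \<le> N" for B N
    unfolding exp_succ_def using van[OF that(1)] that(2) by (intro suminf_finite) auto
  have fA: "finite A" using A by (rule finite_subset) simp
  show ?thesis
  proof (cases "A = {}")
    case True
    thus ?thesis using e[of "{}" 0] s0[of "{}"] by simp
  next
    case False
    let ?N = "card A"
    have "exp_succ b (word (nths w A)) = (\<Sum>n\<le>Suc ?N. ?s n A)" by (rule e[OF A]) simp
    also have "\<dots> = (\<Sum>n\<le>?N. ?s (Suc n) A)"
      unfolding sum.atMost_Suc_shift using s0[OF A] False by simp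
    also have "\<dots> = (\<Sum>U | convex_in A U \<and> Min A \<in> U. \<Sum>n\<le>?N. ?s n (A - U) * subword_value b w U)"
      unfolding sS[OF A] by (rule sum.swap)
    also have "\<dots> = (\<Sum>U | convex_in A U \<and> Min A \<in> U. exp_succ b (word (nths w (A - U))) * subword_value b w U)"
    proof (rule sum.cong[OF refl])
      fix U
      have "A - U \<subseteq> {..<length w}" "card (A - U) \<le> ?N" using A fA by (auto intro: card_mono)
      thus "(\<Sum>n\<le>?N. ?s n (A - U) * subword_value b w U) =
          exp_succ b (word (nths w (A - U))) * subword_value b w U"
        by (simp add: e sum_distrib_right)
    qed
    finally show ?thesis using False by simp
  qed
qed

text \<open>Both sides satisfy the same recursion in terms of initial segments, by \<open>exp_succ_recursion\<close> and
  \<open>moment_sum_prefix_recursion\<close>.\<close>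

lemma exp_succ_eq_moment_sum:
  assumes b: "inf_char_on_words b"
    and irr: "\<And>U. U \<subseteq> {..<length w} \<Longrightarrow> U \<noteq> {} \<Longrightarrow> subword_value b w U = irreducible_sum p r U"
  shows "A \<subseteq> {..<length w} \<Longrightarrow> exp_succ b (word (nths w A)) = moment_sum p r A"
proof (induction "card A" arbitrary: A rule: less_induct)
  case less
  have fA: "finite A" using less.prems by (rule finite_subset) simp
  show ?case
  proof (cases "A = {}")
    case True
    thus ?thesis using exp_succ_recursion[OF b less.prems]
      by (simp add: moment_sum_def NC_on_empty hook_weight_def outer_blocks_def inner_blocks_def)
  next
    case False
    have "exp_succ b (word (nths w A)) =
        (\<Sum>U | convex_in A U \<and> Min A \<in> U. exp_succ b (word (nths w (A - U))) * subword_value b w U)"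
      using exp_succ_recursion[OF b less.prems] False by simp
    also have "\<dots> = (\<Sum>U | convex_in A U \<and> Min A \<in> U. irreducible_sum p r U * moment_sum p r (A - U))"
    proof (rule sum.cong[OF refl])
      fix U assume "U \<in> {U. convex_in A U \<and> Min A \<in> U}"
      hence U: "U \<subseteq> A" "U \<noteq> {}" using convex_inD[of A U] by simp_all
      have "card (A - U) < card A" using U fA by (intro psubset_card_mono) auto
      hence "exp_succ b (word (nths w (A - U))) = moment_sum p r (A - U)"
        by (rule less.hyps) (use less.prems in blast)
      moreover have "subword_value b w U = irreducible_sum p r U"
        by (rule irr) (use U less.prems in blast)+
      ultimately show "exp_succ b (word (nths w (A - U))) * subword_value b w U =
          irreducible_sum p r U * moment_sum p r (A - U)" by simp
    qed
    also have "\<dots> = moment_sum p r A" by (rule moment_sum_prefix_recursion[OF fA False, symmetric])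
    finally show ?thesis .
  qed
qed

section \<open>Cumulants\<close>

lemma inverse_forest_factorial_NC: "\<pi> \<in> NC n \<Longrightarrow> 1 / of_nat (forest_factorial (nesting_forest \<pi>)) = hook_weight nests \<pi>"
  unfolding NC_on_lessThan
  by (rule forest_factorial_nesting_forest[OF forest_order_nests[OF _ finite_lessThan]])

lemma cond_monotone_cumulants_iff:
  "cond_monotone_cumulants \<phi> h' hc \<longleftrightarrow> (\<forall>w. w \<noteq> [] \<longrightarrow> \<phi> (prod_list w) =
    moment_sum (\<lambda>V. hc (nths w V)) (\<lambda>V. h' (nths w V)) {..<length w})"
  unfolding cond_monotone_cumulants_def moment_sum_def NC_on_lessThan[symmetric]
  by (simp add: inverse_forest_factorial_NC mult.assoc)

lemma monotone_cumulants_iff: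
  "monotone_cumulants \<psi> h' \<longleftrightarrow> (\<forall>w. w \<noteq> [] \<longrightarrow> \<psi> (prod_list w) =
    moment_sum (\<lambda>V. h' (nths w V)) (\<lambda>V. h' (nths w V)) {..<length w})"
  unfolding monotone_cumulants_def moment_sum_same[OF finite_lessThan] NC_on_lessThan[symmetric]
  by (simp add: inverse_forest_factorial_NC)

text \<open>The shape of the second hypothesis covers two situations: equal inner weights, and inner weights that
  coincide with the outer ones and are therefore equal by induction.\<close>

lemma cumulants_unique:
  assumes eq: "\<And>w. w \<noteq> [] \<Longrightarrow> moment_sum (\<lambda>V. p (nths w V)) (\<lambda>V. r (nths w V)) {..<length w} =
      moment_sum (\<lambda>V. p' (nths w V)) (\<lambda>V. r' (nths w V)) {..<length w}"
    and r: "\<And>w n. (\<And>v. v \<noteq> [] \<Longrightarrow> length v < n \<Longrightarrow> p v = p' v) \<Longrightarrow> w \<noteq> [] \<Longrightarrow> length w < n \<Longrightarrow> r w = r' w"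
  shows "w \<noteq> [] \<Longrightarrow> p w = p' w"
proof (induction "length w" arbitrary: w rule: less_induct)
  case less
  let ?N = "{..<length w}"
  have "p (nths w ?N) = p' (nths w ?N)"
  proof (rule moment_sum_determines[OF finite_lessThan[of "length w"] _ _ eq[OF less.prems]])
    show "?N \<noteq> {}" using less.prems by auto
    fix V assume V: "V \<subset> ?N" "V \<noteq> {}"
    have "length (nths w V) < length w"
      using length_nths_subset[of V w] V(1) psubset_card_mono[OF finite_lessThan V(1)] by simp
    moreover have "nths w V \<noteq> []" using V nths_eq_Nil_iff[of V w] by blast
    ultimately show "p (nths w V) = p' (nths w V) \<and> r (nths w V) = r' (nths w V)"
      using less.hyps r[of "length w" "nths w V"] by blast
  qed
  thus ?case by (simp add: nths_all)
qed

theorem theorem4p6: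
  fixes \<phi> \<psi> :: "'a::complex_algebra_1 \<Rightarrow> complex"
    and \<Phi> \<Psi> \<beta> \<rho>' P :: "'a dta \<Rightarrow> complex"
    and h' hc :: "'a list \<Rightarrow> complex"
  assumes "cond_nc_prob_space \<phi> \<psi>"
    and "extending_character \<phi> \<Phi>" and "extending_character \<psi> \<Psi>"
    and "infinitesimal_character \<beta>" and "\<Phi> = exp_succ \<beta>"
    and "infinitesimal_character \<rho>'" and "\<Psi> = exp_conv \<rho>'"
    and "monotone_cumulants \<psi> h'" and "cond_monotone_cumulants \<phi> h' hc"
    and "infinitesimal_character P"
    and "\<And>x. P x + suminf (\<lambda>n. pre_lie_right_iter \<rho>' (Suc n) P x / fact (Suc n + 1)) = \<beta> x"
  shows "\<forall>w. w \<noteq> [] \<longrightarrow> P (bars [w]) = hc w"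
proof -
  note inf = assms(4,6,10)[THEN inf_char_on_words_if_infinitesimal]
  have word: "bars [w] = word (nths w {..<length w})" if "w \<noteq> []" for w :: "'a list"
    using that by (simp add: word_def nths_all)
  have \<rho>: "\<rho>' (word w) = h' w" if "w \<noteq> []" for w
  proof (rule cumulants_unique[where r = "\<lambda>w. \<rho>' (word w)" and r' = h', OF _ _ that])
    fix w :: "'a list" assume w: "w \<noteq> []"
    have "moment_sum (subword_value \<rho>' w) (subword_value \<rho>' w) {..<length w} = \<Psi> (bars [w])"
      unfolding assms(7) word[OF w] by (rule exp_conv_eq_moment_sum[OF inf(2) order_refl, symmetric])
    also have "\<dots> = \<psi> (prod_list w)" using assms(3) w by (simp add: extending_character_def)
    also have "\<dots> = moment_sum (\<lambda>V. h' (nths w V)) (\<lambda>V. h' (nths w V)) {..<length w}"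
      using assms(8) w by (simp add: monotone_cumulants_iff)
    finally show "moment_sum (subword_value \<rho>' w) (subword_value \<rho>' w) {..<length w} =
        moment_sum (\<lambda>V. h' (nths w V)) (\<lambda>V. h' (nths w V)) {..<length w}" .
  qed
  have "P (word w) = hc w" if "w \<noteq> []" for w
  proof (rule cumulants_unique[where r = "\<lambda>w. \<rho>' (word w)" and r' = h', OF _ _ that])
    fix w :: "'a list" assume w: "w \<noteq> []"
    have "moment_sum (subword_value P w) (subword_value \<rho>' w) {..<length w} = \<Phi> (bars [w])"
      unfolding assms(5) word[OF w]
    proof (rule exp_succ_eq_moment_sum[OF inf(1) _ order_refl, symmetric])
      fix U assume "U \<subseteq> {..<length w}" "U \<noteq> {}"
      thus "subword_value \<beta> w U = irreducible_sum (subword_value P w) (subword_value \<rho>' w) U"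
        unfolding assms(11)[symmetric] by (rule pre_lie_exponential_eq_irreducible_sum[OF inf(3,2)])
    qed
    also have "\<dots> = \<phi> (prod_list w)" using assms(2) w by (simp add: extending_character_def)
    also have "\<dots> = moment_sum (\<lambda>V. hc (nths w V)) (\<lambda>V. h' (nths w V)) {..<length w}"
      using assms(9) w by (simp add: cond_monotone_cumulants_iff)
    finally show "moment_sum (subword_value P w) (subword_value \<rho>' w) {..<length w} =
        moment_sum (\<lambda>V. hc (nths w V)) (\<lambda>V. h' (nths w V)) {..<length w}" .
  qed (rule \<rho>)
  thus ?thesis by (simp add: word_def)
qed

end
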